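(* Let $d\in\mathbb N$, $z>0$. Assume that functions $a:\mathbb R^d\to[0,\infty]$ and $b:\mathbb R^d\to[0,\infty)$ satisfy the following conditions: a) $a(x)=\tilde a(|x|)$, where $\tilde a:[0,\infty)\to[0,\infty]$ is a measurable function, and $b$ is an even function; b) $a,b\in L^1(\mathbb R^d,dx)$; c) the function $a$ has a compact support; d) $b\in C^1_{\mathrm b}(\mathbb R^d)$, where $C^1_{\mathrm b}(\mathbb R^d)$ denotes the space of all bounded, continuously differentiable functions on $\mathbb R^d$ whose gradient is bounded; e) there exists $R>0$ such that $\int_{\mathbb R^d}dx\,\sup_{y\in B(x,R)}|\nabla b(y)|<\infty$, where $B(x,R)$ denotes the closed ball in $\mathbb R^d$ centered at $x$ and of radius $R$. For $\varepsilon>0$ let $$q_\varepsilon(x,h_1,h_2):=\varepsilon^{-2d-2}a(h_1/\varepsilon)a(h_2/\varepsilon)\big(b(x)+b(x+h_2-h_1)\big),$$ and $$(L_\varepsilon F)(\gamma)=\sum_{\{x_1,x_2\}\subset\gamma}\int_{\mathbb R^d}dh_1\int_{\mathbb R^d}dh_2\,q_\varepsilon(x_2-x_1,h_1,h_2)\big(F(\gamma\setminus\{x_1,x_2\}\cup\{x_1+h_1,x_2+h_2\})-F(\gamma)\big).$$ Then, for each $F\in\mathcal FC^\infty_{\mathrm b}(C^\infty_0(\mathbb R^d),\Gamma)$, $$L_\varepsilon F\to L_0F\quad\text{in }L^2(\Gamma,\pi_z)\text{ as }\varepsilon\to0.$$ Here $$(L_0F)(\gamma):=c\sum_{x\in\gamma}\left[\Delta_xF(\gamma)\sum_{y\in\gamma\setminus\{x\}}b(x-y)+\left\langle\nabla_xF(\gamma),\sum_{y\in\gamma\setminus\{x\}}\nabla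 b(x-y)\right\rangle\right],$$ where $$c:=\int_{\mathbb R^d}a(h)(h^1)^2\,dh,$$ $h^i$ denoting the $i$-th coordinate of $h\in\mathbb R^d$, $i=1,\dots,d$, and $\langle\cdot,\cdot\rangle$ in the formula for $L_0$ stands for the scalar product in $\mathbb R^d$.
   Context: $\Gamma$ is the set of all locally finite subsets $\gamma\subset\mathbb R^d$, identified with the Radon measures $\sum_{x\in\gamma}\delta_x$ and equipped with the relative vague topology and the corresponding Borel $\sigma$-algebra $\mathcal B(\Gamma)$; for a function $f$ on $\mathbb R^d$, $\langle f,\gamma\rangle:=\sum_{x\in\gamma}f(x)$. $\pi_z$ is the Poisson measure on $(\Gamma,\mathcal B(\Gamma))$ with intensity measure $z\,dx$. $\mathcal FC^\infty_{\mathrm b}(C^\infty_0(\mathbb R^d),\Gamma)$ is the set of functions $F(\gamma)=g(\langle\varphi_1,\gamma\rangle,\dots,\langle\varphi_N,\gamma\rangle)$ with $N\in\mathbb N$, $\varphi_1,\dots,\varphi_N\in C_0^\infty(\mathbb R^d)$ (smooth, compactly supported) and $g\in C^\infty_{\mathrm b}(\mathbb R^N)$ (smooth, bounded, with all derivatives bounded). For such $F$, $\gamma\in\Gamma$ and $x\in\gamma$, $$\nabla_xF(\gamma):=\nabla_yF(\gamma\setminus\{x\}\cup\{y\})\big|_{y=x},\qquad \Delta_xF(\gamma):=\Delta_yF(\gamma\setminus\{x\}\cup\{y\})\big|_{y=x},$$ where $\nabla_y$ and $\Delta_y$ are the gradient and Laplacian in the variable $y$. The series in $L_0F$ converge absolutely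 for $\pi_z$-a.a. $\gamma\in\Gamma$.
   Formalization: The constant is taken as c = (∫a(h)dh)(∫a(h)(h^1)^2 dh) rather than ∫a(h)(h^1)^2 dh; the printed value is right only if ∫a = 1, since replacing a by sa multiplies L_ε by s^2 but the printed L_0 only by s. *)

theory Defs
  imports "HOL-Probability.Probability"
begin

section \<open>Differential calculus in coordinates\<close>

definition partial_deriv :: "'n::finite \<Rightarrow> (real^'n \<Rightarrow> real) \<Rightarrow> real^'n \<Rightarrow> real" where
  "partial_deriv i f x = deriv (\<lambda>t. f (x + t *\<^sub>R axis i 1)) 0"

definition grad :: "(real^'n::finite \<Rightarrow> real) \<Rightarrow> real^'n \<Rightarrow> real^'n" where
  "grad f x = (\<chi> i. partial_deriv i f x)"

definition laplacian :: "(real^'n::finite \<Rightarrow> real) \<Rightarrow> real^'n \<Rightarrow> real" where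
  "laplacian f x = (\<Sum>i\<in>UNIV. partial_deriv i (partial_deriv i f) x)"

primrec Ck :: "nat \<Rightarrow> (real^'n::finite \<Rightarrow> real) \<Rightarrow> bool" where
  "Ck 0 f = continuous_on UNIV f"
| "Ck (Suc k) f = (f differentiable_on UNIV \<and> (\<forall>i. Ck k (partial_deriv i f)))"

definition smooth :: "(real^'n::finite \<Rightarrow> real) \<Rightarrow> bool" where
  "smooth f \<longleftrightarrow> (\<forall>k. Ck k f)"

text \<open>For a nonnegative extended real function, as for a real one, the support is the closure
  of the set of points where the function does not vanish.\<close>

definition compact_support :: "('a::topological_space \<Rightarrow> 'b::zero) \<Rightarrow> bool" where
  "compact_support f \<longleftrightarrow> compact (closure {x. f x \<noteq> 0})"

definition C0_infinity :: "(real^'n::finite \<Rightarrow> real) set" where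
  "C0_infinity = {f. smooth f \<and> compact_support f}"

text \<open>The list \<open>is\<close> runs over all iterated partial derivatives; the empty list gives
  the function itself.\<close>

definition Cb_infinity :: "(real^'n::finite \<Rightarrow> real) set" where
  "Cb_infinity = {f. smooth f \<and> (\<forall>is. bounded (range (foldr partial_deriv is f)))}"

definition Cb1 :: "(real^'n::finite \<Rightarrow> real) set" where
  "Cb1 = {f. Ck 1 f \<and> bounded (range f) \<and> bounded (range (grad f))}"


section \<open>The configuration space and the Poisson measure\<close>

definition Config :: "(real^'d::finite) set set" where
  "Config = {\<gamma>. \<forall>K. compact K \<longrightarrow> finite (\<gamma> \<inter> K)}"

definition pairing :: "(real^'d::finite \<Rightarrow> real) \<Rightarrow> (real^'d) set \<Rightarrow> real" where
  "pairing f \<gamma> = (\<Sum>\<^sub>\<infinity>x\<in>\<gamma>. f x)"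

definition vague_topology :: "(real^'d::finite) set topology" where
  "vague_topology = topology_generated_by
     {{\<gamma> \<in> Config. pairing f \<gamma> \<in> U} | f U.
        continuous_on UNIV f \<and> compact_support f \<and> open U}"

definition Config_borel :: "(real^'d::finite) set measure" where
  "Config_borel = sigma Config {U. openin vague_topology U}"

text \<open>\<open>P\<close> is the Poisson measure with intensity measure \<open>z dx\<close>: the numbers of points in
  disjoint bounded Borel sets are independent and Poisson distributed. The distribution is written
  out since \<^const>\<open>poisson_pmf\<close> is only meaningful for a positive rate, whereas \<open>A\<close> may
  be a null set.\<close>

definition is_Poisson_measure :: "real \<Rightarrow> (real^'d::finite) set measure \<Rightarrow> bool" where
  "is_Poisson_measure z P \<longleftrightarrow>
     prob_space P \<and> space P = Config \<and> sets P = sets Config_borel \<and>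
     (\<forall>A k. A \<in> sets borel \<longrightarrow> bounded A \<longrightarrow>
        measure P {\<gamma> \<in> Config. card (\<gamma> \<inter> A) = k} =
          exp (- (z * measure lborel A)) * (z * measure lborel A) ^ k / fact k) \<and>
     (\<forall>(A :: nat \<Rightarrow> (real^'d) set) n.
        (\<forall>i<n. A i \<in> sets borel \<and> bounded (A i)) \<longrightarrow> disjoint_family_on A {..<n} \<longrightarrow>
        prob_space.indep_vars P (\<lambda>_. count_space UNIV) (\<lambda>i \<gamma>. card (\<gamma> \<inter> A i)) {..<n})"

definition L2_space :: "'a measure \<Rightarrow> ('a \<Rightarrow> real) set" where
  "L2_space M = {f \<in> borel_measurable M. integrable M (\<lambda>x. (f x)\<^sup>2)}"

definition L2_norm :: "'a measure \<Rightarrow> ('a \<Rightarrow> real) \<Rightarrow> real" where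
  "L2_norm M f = sqrt (\<integral>x. (f x)\<^sup>2 \<partial>M)"


section \<open>Smooth local functions and the operators\<close>

text \<open>The number of test functions is the cardinality of the index type \<open>'n\<close>. Only the values
  of \<open>F\<close> on configurations are constrained, and only these are ever used.\<close>

definition FCb_infinity :: "'n::finite itself \<Rightarrow> ((real^'d::finite) set \<Rightarrow> real) set" where
  "FCb_infinity _ = {F. \<exists>(\<phi> :: 'n \<Rightarrow> real^'d \<Rightarrow> real) (g :: real^'n \<Rightarrow> real).
     (\<forall>i. \<phi> i \<in> C0_infinity) \<and> g \<in> Cb_infinity \<and>
     (\<forall>\<gamma>\<in>Config. F \<gamma> = g (\<chi> i. pairing (\<phi> i) \<gamma>))}"

definition grad_point :: "real^'d::finite \<Rightarrow> ((real^'d) set \<Rightarrow> real) \<Rightarrow> (real^'d) set \<Rightarrow> real^'d" where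
  "grad_point x F \<gamma> = grad (\<lambda>y. F ((\<gamma> - {x}) \<union> {y})) x"

definition laplacian_point :: "real^'d::finite \<Rightarrow> ((real^'d) set \<Rightarrow> real) \<Rightarrow> (real^'d) set \<Rightarrow> real" where
  "laplacian_point x F \<gamma> = laplacian (\<lambda>y. F ((\<gamma> - {x}) \<union> {y})) x"

definition q_rate :: "(real^'d::finite \<Rightarrow> ennreal) \<Rightarrow> (real^'d \<Rightarrow> real) \<Rightarrow> real \<Rightarrow>
    real^'d \<Rightarrow> real^'d \<Rightarrow> real^'d \<Rightarrow> ennreal" where
  "q_rate a b \<epsilon> x h1 h2 =
     ennreal (\<epsilon> powi (- 2 * int CARD('d) - 2)) * a (h1 /\<^sub>R \<epsilon>) * a (h2 /\<^sub>R \<epsilon>) *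
     ennreal (b x + b (x + h2 - h1))"

text \<open>The rate is infinite only on a null set of \<open>(h1, h2)\<close> when \<open>a\<close> is integrable,
  so the value \<open>enn2real \<infinity> = 0\<close> is immaterial.\<close>

definition L_eps_term :: "(real^'d::finite \<Rightarrow> ennreal) \<Rightarrow> (real^'d \<Rightarrow> real) \<Rightarrow> real \<Rightarrow>
    ((real^'d) set \<Rightarrow> real) \<Rightarrow> (real^'d) set \<Rightarrow> real^'d \<Rightarrow> real^'d \<Rightarrow> real" where
  "L_eps_term a b \<epsilon> F \<gamma> x1 x2 =
     (\<integral>h1. (\<integral>h2. enn2real (q_rate a b \<epsilon> (x2 - x1) h1 h2) *
        (F ((\<gamma> - {x1, x2}) \<union> {x1 + h1, x2 + h2}) - F \<gamma>) \<partial>lborel) \<partial>lborel)"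

text \<open>The summation is over unordered pairs. For even \<open>b\<close>, exchanging \<open>(x1, h1)\<close> and
  \<open>(x2, h2)\<close> leaves the integrand unchanged, so it does not matter which enumeration
  of the pair is chosen.\<close>

definition pairs :: "'a set \<Rightarrow> 'a set set" where
  "pairs \<gamma> = {e. e \<subseteq> \<gamma> \<and> card e = 2}"

definition L_eps_pair :: "(real^'d::finite \<Rightarrow> ennreal) \<Rightarrow> (real^'d \<Rightarrow> real) \<Rightarrow> real \<Rightarrow>
    ((real^'d) set \<Rightarrow> real) \<Rightarrow> (real^'d) set \<Rightarrow> (real^'d) set \<Rightarrow> real" where
  "L_eps_pair a b \<epsilon> F \<gamma> e =
     (case SOME (x1, x2). e = {x1, x2} of (x1, x2) \<Rightarrow> L_eps_term a b \<epsilon> F \<gamma> x1 x2)"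

definition L_eps :: "(real^'d::finite \<Rightarrow> ennreal) \<Rightarrow> (real^'d \<Rightarrow> real) \<Rightarrow> real \<Rightarrow>
    ((real^'d) set \<Rightarrow> real) \<Rightarrow> (real^'d) set \<Rightarrow> real" where
  "L_eps a b \<epsilon> F \<gamma> = (\<Sum>\<^sub>\<infinity>e\<in>pairs \<gamma>. L_eps_pair a b \<epsilon> F \<gamma> e)"

definition L_zero_term :: "(real^'d::finite \<Rightarrow> real) \<Rightarrow>
    ((real^'d) set \<Rightarrow> real) \<Rightarrow> (real^'d) set \<Rightarrow> real^'d \<Rightarrow> real" where
  "L_zero_term b F \<gamma> x =
     laplacian_point x F \<gamma> * (\<Sum>\<^sub>\<infinity>y\<in>\<gamma> - {x}. b (x - y)) +
     grad_point x F \<gamma> \<bullet> (\<Sum>\<^sub>\<infinity>y\<in>\<gamma> - {x}. grad b (x - y))"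

text \<open>The constant \<open>c\<close> is a parameter. Second-order expansion of \<open>L_eps\<close> yields
  \<open>c = (\<integral>a(h) dh) (\<integral>a(h) h_k^2 dh)\<close>, from the product \<open>a(h1) a(h2)\<close> in the rate; the first factor
  can be omitted only if \<open>a\<close> is normalised to have integral 1.\<close>

definition L_zero :: "real \<Rightarrow> (real^'d::finite \<Rightarrow> real) \<Rightarrow>
    ((real^'d) set \<Rightarrow> real) \<Rightarrow> (real^'d) set \<Rightarrow> real" where
  "L_zero c b F \<gamma> = c * (\<Sum>\<^sub>\<infinity>x\<in>\<gamma>. L_zero_term b F \<gamma> x)"

text \<open>Absolute convergence of the series defining the two operators (an infinite sum that does
  not converge has the value 0).\<close>

definition L_eps_converges :: "(real^'d::finite \<Rightarrow> ennreal) \<Rightarrow> (real^'d \<Rightarrow> real) \<Rightarrow> real \<Rightarrow>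
    ((real^'d) set \<Rightarrow> real) \<Rightarrow> (real^'d) set \<Rightarrow> bool" where
  "L_eps_converges a b \<epsilon> F \<gamma> \<longleftrightarrow> (\<lambda>e. norm (L_eps_pair a b \<epsilon> F \<gamma> e)) summable_on pairs \<gamma>"

definition L_zero_converges :: "(real^'d::finite \<Rightarrow> real) \<Rightarrow>
    ((real^'d) set \<Rightarrow> real) \<Rightarrow> (real^'d) set \<Rightarrow> bool" where
  "L_zero_converges b F \<gamma> \<longleftrightarrow>
     (\<forall>x\<in>\<gamma>. (\<lambda>y. norm (b (x - y))) summable_on (\<gamma> - {x}) \<and>
            (\<lambda>y. norm (grad b (x - y))) summable_on (\<gamma> - {x})) \<and>
     (\<lambda>x. norm (L_zero_term b F \<gamma> x)) summable_on \<gamma>"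

end

theory Submission
  imports Defs
begin

text \<open>Substituting \<open>\<epsilon> h\<close> for the jumps, a pair \<open>{x1, x2}\<close> contributes to \<open>L_eps\<close>
  \<open>\<epsilon>\<^sup>-\<^sup>2 \<integral>\<integral> a(h1) a(h2) (b(x) + b(x + \<epsilon>(h2 - h1))) (F(after) - F(before)) dh1 dh2\<close> with \<open>x = x2 - x1\<close>.
  Expand in \<open>\<epsilon>\<close>. The first order term is linear in the jumps and integrates to \<open>0\<close>, because \<open>a\<close> is
  radial. The second order terms are \<open>2 b(x)\<close> times half the second derivative of \<open>F\<close> along the jumps,
  and the product of the first derivatives of \<open>b\<close> and \<open>F\<close>. For radial \<open>a\<close> the second moments form a
  multiple of the identity matrix, so the former gives the Laplacians of \<open>F\<close> in \<open>x1\<close> and in \<open>x2\<close>, the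
  latter the scalar products of \<open>\<nabla>b\<close> with the gradients; \<open>\<integral>a\<close> appears in the constant since one of the
  two jumps is integrated out each time. As \<open>\<nabla>b\<close> is odd, the two points enter symmetrically, and the sum
  over unordered pairs becomes the sum over ordered pairs that defines \<open>L_zero\<close>. This is
  \<open>pair_term_limit\<close>, to be combined with \<open>L_eps_eq\<close> and \<open>L_zero_eq\<close>.

  The limit has to be exchanged with a sum over infinitely many pairs and with the norm of \<open>L\<^sup>2\<close>. The
  derivatives of \<open>F\<close> in a point vanish outside the supports of the test functions. So for all small
  \<open>\<epsilon>\<close> the contribution of a pair is at most a constant times \<open>(1\<^sub>B(x1) + 1\<^sub>B(x2)) w(x1 - x2)\<close>, where \<open>B\<close>
  is a ball and \<open>w\<close> is \<open>b\<close> plus a local supremum of \<open>|\<nabla>b|\<close> (\<open>pair_term_uniform_bound\<close>). If the sum of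
  these majorants over all pairs has a finite second moment, dominated convergence applies, first for
  almost every configuration and then under the Poisson measure.

  The second moment is estimated by counting points in balls (\<open>pair_sum_square_integrable\<close>). Since \<open>b\<close>
  varies no faster than its gradient allows, \<open>w(x1 - x2)\<close> is bounded by an integrable weight \<open>W(p - u)\<close> for all \<open>p\<close> close to \<open>x1\<close>
  and \<open>u\<close> close to \<open>x2\<close>. Averaging over such \<open>p\<close> and \<open>u\<close> bounds the pair sum by
  \<open>\<integral>\<integral> W(p - u) N\<^sub>p N\<^sub>u dp du\<close> with the numbers \<open>N\<^sub>p\<close>, \<open>N\<^sub>u\<close> of points in small balls around \<open>p\<close> and \<open>u\<close>, and
  these are Poisson distributed with a fixed mean.

  Membership in \<open>L\<^sup>2\<close> includes Borel measurability of the generators everywhere, also where the series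
  diverge. It follows from a general statement on sums over the points of a configuration
  (\<open>integral_points_measurable\<close>), because \<open>F\<close> depends on the configuration only through finitely many
  pairings, and the summands are jointly measurable in these and the points.\<close>

section \<open>Measurability of sums over the points of a configuration\<close>

lemma Config_finite_Int_bounded:
  assumes "\<gamma> \<in> Config" "bounded A"
  shows "finite (\<gamma> \<inter> A)"
proof -
  have "compact (closure A)" using assms(2) by (simp add: compact_closure)
  then have "finite (\<gamma> \<inter> closure A)" using assms(1) by (auto simp: Config_def)
  then show ?thesis by (rule finite_subset[rotated]) (use closure_subset in auto)
qed

lemma Config_countable:
  fixes \<gamma> :: "(real^'d::finite) set"
  assumes "\<gamma> \<in> Config"
  shows "countable \<gamma>"
proof -
  have "\<gamma> = (\<Union>n::nat. \<gamma> \<inter> cball 0 (real n))"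
  proof (safe)
    fix x assume "x \<in> \<gamma>"
    obtain n :: nat where "norm x \<le> real n" using real_arch_simple by blast
    then show "x \<in> (\<Union>n::nat. \<gamma> \<inter> cball 0 (real n))" using \<open>x \<in> \<gamma>\<close> by auto
  qed
  also have "countable \<dots>"
    using Config_finite_Int_bounded[OF assms bounded_cball] by (intro countable_UN) (auto intro: countable_finite)
  finally show ?thesis .
qed

text \<open>Integrating over the points of a configuration is integration against a random counting measure;
  its measurability rests on that of the counts alone. The map \<open>G\<close> allows further variables to be
  carried along, so that sums over several points can be treated one point at a time.\<close>

locale random_configuration =
  fixes M :: "'w measure" and G :: "'w \<Rightarrow> (real^'d::finite) set"
  assumes config: "\<And>w. w \<in> space M \<Longrightarrow> G w \<in> Config"
    and card_measurable: "\<And>A. A \<in> sets borel \<Longrightarrow> bounded A \<Longrightarrow>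
      (\<lambda>w. real (card (G w \<inter> A))) \<in> borel_measurable M"
begin

text \<open>Cutting down to a bounded set makes the counts finite, which the complement step of the
  Dynkin argument needs.\<close>

lemma card_section_measurable:
  assumes E: "E \<in> sets (M \<Otimes>\<^sub>M borel)" and B: "B \<in> sets borel" "bounded B"
  shows "(\<lambda>w. real (card {x \<in> G w \<inter> B. (w, x) \<in> E})) \<in> borel_measurable M"
    (is "?s E \<in> _")
  using Int_stable_pair_measure_generator pair_measure_closed E
  unfolding sets_pair_measure
proof (induct rule: sigma_sets_induct_disjoint)
  case (basic E)
  then obtain A C where E_eq: "E = A \<times> C" and AC: "A \<in> sets M" "C \<in> sets borel" by auto
  have "(\<lambda>w. indicator A w * real (card (G w \<inter> (C \<inter> B)))) \<in> borel_measurable M"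
    using AC B by (intro borel_measurable_times card_measurable) (auto intro: bounded_subset)
  also have "(\<lambda>w. indicator A w * real (card (G w \<inter> (C \<inter> B)))) = ?s E"
  proof
    fix w
    have "{x \<in> G w \<inter> B. (w, x) \<in> E} = (if w \<in> A then G w \<inter> (C \<inter> B) else {})"
      by (auto simp: E_eq)
    then show "indicator A w * real (card (G w \<inter> (C \<inter> B))) = ?s E w" by auto
  qed
  finally show ?case .
next
  case empty
  then show ?case by simp
next
  case (compl E)
  then have [measurable]: "?s E \<in> borel_measurable M" by simp
  have [measurable]: "(\<lambda>w. real (card (G w \<inter> B))) \<in> borel_measurable M"
    by (rule card_measurable[OF B])
  have "(\<lambda>w. real (card (G w \<inter> B)) - ?s E w) \<in> borel_measurable M" by measurable
  also have "(\<lambda>w. real (card (G w \<inter> B)) - ?s E w) \<in> borel_measurable M \<longleftrightarrow>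
      ?s (space M \<times> space borel - E) \<in> borel_measurable M"
  proof (rule measurable_cong)
    fix w assume w: "w \<in> space M"
    have fin: "finite (G w \<inter> B)" by (rule Config_finite_Int_bounded[OF config[OF w] B(2)])
    have "{x \<in> G w \<inter> B. (w, x) \<in> space M \<times> space borel - E}
        = (G w \<inter> B) - {x \<in> G w \<inter> B. (w, x) \<in> E}" using w by auto
    moreover have "card {x \<in> G w \<inter> B. (w, x) \<in> E} \<le> card (G w \<inter> B)"
      using fin by (intro card_mono) auto
    moreover have "card ((G w \<inter> B) - {x \<in> G w \<inter> B. (w, x) \<in> E})
        = card (G w \<inter> B) - card {x \<in> G w \<inter> B. (w, x) \<in> E}"
      by (rule card_Diff_subset) (auto intro: finite_subset[OF _ fin])
    ultimately show "real (card (G w \<inter> B)) - ?s E w = ?s (space M \<times> space borel - E) w"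
      by (simp only: of_nat_diff)
  qed
  finally show ?case .
next
  case (union E)
  then have [measurable]: "\<And>i. ?s (E i) \<in> borel_measurable M" by simp
  have "(\<lambda>w. \<Sum>i. ?s (E i) w) \<in> borel_measurable M" by measurable
  also have "(\<lambda>w. \<Sum>i. ?s (E i) w) \<in> borel_measurable M \<longleftrightarrow> ?s (\<Union>i. E i) \<in> borel_measurable M"
  proof (rule measurable_cong)
    fix w assume w: "w \<in> space M"
    let ?S = "\<lambda>E. {x \<in> G w \<inter> B. (w, x) \<in> E}"
    have fin: "finite (G w \<inter> B)" by (rule Config_finite_Int_bounded[OF config[OF w] B(2)])
    have m: "measure (count_space (G w \<inter> B)) A = real (card A)" if "A \<subseteq> G w \<inter> B" for A
      using that finite_subset[OF that fin] by (simp add: measure_def emeasure_count_space)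
    interpret C: finite_measure "count_space (G w \<inter> B)" by (rule finite_measure_count_space[OF fin])
    have "(\<lambda>i. measure (count_space (G w \<inter> B)) (?S (E i))) sums
        measure (count_space (G w \<inter> B)) (\<Union>i. ?S (E i))"
      using union(1) by (intro C.finite_measure_UNION) (auto simp: disjoint_family_on_def)
    moreover have "(\<Union>i. ?S (E i)) = ?S (\<Union>i. E i)" by auto
    moreover have "measure (count_space (G w \<inter> B)) (?S E) = ?s E w" for E by (rule m) auto
    ultimately have "(\<lambda>i. ?s (E i) w) sums ?s (\<Union>i. E i) w"
      by (simp only:)
    then show "(\<Sum>i. ?s (E i) w) = ?s (\<Union>i. E i) w" by (rule sums_unique[symmetric])
  qed
  finally show ?case .
qed

lemma nn_integral_points_bounded_measurable:
  assumes K: "K \<in> borel_measurable (M \<Otimes>\<^sub>M borel)" and B: "B \<in> sets borel" "bounded B"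
  shows "(\<lambda>w. \<integral>\<^sup>+x. K (w, x) * indicator B x \<partial>count_space (G w)) \<in> borel_measurable M"
  using K
proof (induction rule: borel_measurable_induct)
  case (cong f g)
  have "(\<lambda>w. \<integral>\<^sup>+x. f (w, x) * indicator B x \<partial>count_space (G w)) \<in> borel_measurable M \<longleftrightarrow>
      (\<lambda>w. \<integral>\<^sup>+x. g (w, x) * indicator B x \<partial>count_space (G w)) \<in> borel_measurable M"
    by (intro measurable_cong nn_integral_cong) (use cong(3) in \<open>auto simp: space_pair_measure\<close>)
  then show ?case using cong by simp
next
  case (set E)
  have "(\<lambda>w. ennreal (real (card {x \<in> G w \<inter> B. (w, x) \<in> E}))) \<in> borel_measurable M"
    using card_section_measurable[OF set B] by measurable
  also have "?this \<longleftrightarrow>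
      (\<lambda>w. \<integral>\<^sup>+x. indicator E (w, x) * indicator B x \<partial>count_space (G w)) \<in> borel_measurable M"
  proof (rule measurable_cong)
    fix w assume w: "w \<in> space M"
    have fin: "finite (G w \<inter> B)" by (rule Config_finite_Int_bounded[OF config[OF w] B(2)])
    have "(\<integral>\<^sup>+x. indicator E (w, x) * indicator B x \<partial>count_space (G w))
       = (\<integral>\<^sup>+x. indicator {x \<in> G w \<inter> B. (w, x) \<in> E} x \<partial>count_space (G w))"
      by (intro nn_integral_cong) (auto simp: indicator_def)
    also have "\<dots> = emeasure (count_space (G w)) {x \<in> G w \<inter> B. (w, x) \<in> E}"
      by (rule nn_integral_indicator) auto
    also have "\<dots> = ennreal (real (card {x \<in> G w \<inter> B. (w, x) \<in> E}))"
      using finite_subset[OF _ fin, of "{x \<in> G w \<inter> B. (w, x) \<in> E}"]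
      by (subst emeasure_count_space_finite) (auto simp: ennreal_of_nat_eq_real_of_nat)
    finally show "ennreal (real (card {x \<in> G w \<inter> B. (w, x) \<in> E}))
      = (\<integral>\<^sup>+x. indicator E (w, x) * indicator B x \<partial>count_space (G w))" by simp
  qed
  finally show ?case .
next
  case (mult u c)
  have "(\<integral>\<^sup>+x. c * u (w, x) * indicator B x \<partial>count_space (G w))
      = c * (\<integral>\<^sup>+x. u (w, x) * indicator B x \<partial>count_space (G w))" for w
    by (subst nn_integral_cmult[symmetric]) (auto simp: mult.assoc)
  then show ?case using mult(4) by simp
next
  case (add u v)
  have "(\<integral>\<^sup>+x. (v (w, x) + u (w, x)) * indicator B x \<partial>count_space (G w))
      = (\<integral>\<^sup>+x. v (w, x) * indicator B x \<partial>count_space (G w))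
        + (\<integral>\<^sup>+x. u (w, x) * indicator B x \<partial>count_space (G w))" for w
    by (subst nn_integral_add[symmetric]) (auto simp: distrib_right)
  then show ?case using add by (simp add: add.commute)
next
  case (seq U)
  have eq: "(\<integral>\<^sup>+x. (SUP i. U i) (w, x) * indicator B x \<partial>count_space (G w))
      = (SUP i. \<integral>\<^sup>+x. U i (w, x) * indicator B x \<partial>count_space (G w))" for w
    unfolding SUP_apply SUP_mult_right_ennreal
    using seq by (intro nn_integral_monotone_convergence_SUP)
      (auto simp: incseq_def le_fun_def intro!: mult_right_mono)
  show ?case unfolding eq using seq by (intro borel_measurable_SUP) auto
qed

lemma nn_integral_points_measurable:
  assumes K: "K \<in> borel_measurable (M \<Otimes>\<^sub>M borel)"
  shows "(\<lambda>w. \<integral>\<^sup>+x. K (w, x) \<partial>count_space (G w)) \<in> borel_measurable M"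
proof -
  let ?B = "\<lambda>n::nat. cball (0::real^'d) (real n)"
  have "(\<lambda>w. SUP n. \<integral>\<^sup>+x. K (w, x) * indicator (?B n) x \<partial>count_space (G w)) \<in> borel_measurable M"
    by (intro borel_measurable_SUP nn_integral_points_bounded_measurable[OF K]) auto
  also have "(\<lambda>w. SUP n. \<integral>\<^sup>+x. K (w, x) * indicator (?B n) x \<partial>count_space (G w))
     = (\<lambda>w. \<integral>\<^sup>+x. K (w, x) \<partial>count_space (G w))"
  proof
    fix w
    have "(SUP n. \<integral>\<^sup>+x. K (w, x) * indicator (?B n) x \<partial>count_space (G w))
       = (\<integral>\<^sup>+x. (SUP n. K (w, x) * indicator (?B n) x) \<partial>count_space (G w))"
      by (intro nn_integral_monotone_convergence_SUP[symmetric])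
        (auto simp: incseq_def le_fun_def indicator_def)
    also have "\<dots> = (\<integral>\<^sup>+x. K (w, x) \<partial>count_space (G w))"
    proof (intro nn_integral_cong)
      fix x :: "real^'d"
      obtain n :: nat where "norm x \<le> real n" using real_arch_simple by blast
      then have "K (w, x) \<le> (SUP n. K (w, x) * indicator (?B n) x)"
        by (intro SUP_upper2[of n]) auto
      moreover have "(SUP n. K (w, x) * indicator (?B n) x) \<le> K (w, x)"
        by (intro SUP_least) (auto simp: indicator_def)
      ultimately show "(SUP n. K (w, x) * indicator (?B n) x) = K (w, x)" by (rule antisym[rotated])
    qed
    finally show "(SUP n. \<integral>\<^sup>+x. K (w, x) * indicator (?B n) x \<partial>count_space (G w))
      = (\<integral>\<^sup>+x. K (w, x) \<partial>count_space (G w))" .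
  qed
  finally show ?thesis .
qed

text \<open>The value is \<open>0\<close> wherever the series fails to converge absolutely, and the set where this happens
  is itself measurable, so no exceptional set has to be discarded.\<close>

lemma integral_points_measurable:
  fixes K :: "'w \<times> (real^'d) \<Rightarrow> real"
  assumes K: "K \<in> borel_measurable (M \<Otimes>\<^sub>M borel)"
  shows "(\<lambda>w. \<integral>x. K (w, x) \<partial>count_space (G w)) \<in> borel_measurable M"
proof -
  have [measurable]: "(\<lambda>w. \<integral>\<^sup>+x. norm (K (w, x)) \<partial>count_space (G w)) \<in> borel_measurable M"
    "(\<lambda>w. \<integral>\<^sup>+x. ennreal (K (w, x)) \<partial>count_space (G w)) \<in> borel_measurable M"
    "(\<lambda>w. \<integral>\<^sup>+x. ennreal (- K (w, x)) \<partial>count_space (G w)) \<in> borel_measurable M"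
    using nn_integral_points_measurable[of "\<lambda>p. ennreal (norm (K p))"]
      nn_integral_points_measurable[of "\<lambda>p. ennreal (K p)"]
      nn_integral_points_measurable[of "\<lambda>p. ennreal (- K p)"] K by auto
  have eq: "(\<integral>x. K (w, x) \<partial>count_space (G w)) =
      (if (\<integral>\<^sup>+x. norm (K (w, x)) \<partial>count_space (G w)) < \<infinity>
       then enn2real (\<integral>\<^sup>+x. ennreal (K (w, x)) \<partial>count_space (G w))
          - enn2real (\<integral>\<^sup>+x. ennreal (- K (w, x)) \<partial>count_space (G w)) else 0)" for w
    by (auto simp: integrable_iff_bounded not_integrable_integral_eq intro: real_lebesgue_integral_def)
  show ?thesis unfolding eq by measurable
qed

lemma integral_vec_points_measurable:
  fixes K :: "'w \<times> (real^'d) \<Rightarrow> real^'e::finite"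
  assumes K: "K \<in> borel_measurable (M \<Otimes>\<^sub>M borel)"
  shows "(\<lambda>w. \<integral>x. K (w, x) \<partial>count_space (G w)) \<in> borel_measurable M"
proof -
  have [measurable]: "(\<lambda>w. \<integral>\<^sup>+x. norm (K (w, x)) \<partial>count_space (G w)) \<in> borel_measurable M"
    using nn_integral_points_measurable[of "\<lambda>p. ennreal (norm (K p))"] K by auto
  have [measurable]: "(\<lambda>w. \<integral>x. K (w, x) $ i \<partial>count_space (G w)) \<in> borel_measurable M" for i
    using integral_points_measurable[of "\<lambda>p. K p $ i"] K
    by (auto simp: cart_eq_inner_axis)
  have eq: "(\<integral>x. K (w, x) \<partial>count_space (G w)) =
      (if (\<integral>\<^sup>+x. norm (K (w, x)) \<partial>count_space (G w)) < \<infinity>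
       then \<Sum>i\<in>UNIV. (\<integral>x. K (w, x) $ i \<partial>count_space (G w)) *\<^sub>R axis i 1 else 0)" for w
  proof (cases "integrable (count_space (G w)) (\<lambda>x. K (w, x))")
    case True
    have "(\<integral>x. K (w, x) \<partial>count_space (G w)) $ i = (\<integral>x. K (w, x) $ i \<partial>count_space (G w))" for i
      using integral_inner_left[of "axis i 1", OF True] by (simp add: cart_eq_inner_axis)
    then have "(\<integral>x. K (w, x) \<partial>count_space (G w)) =
      (\<Sum>i\<in>UNIV. (\<integral>x. K (w, x) $ i \<partial>count_space (G w)) *\<^sub>R axis i 1)"
      by (simp add: vec_eq_iff axis_def if_distrib cong: if_cong)
    then show ?thesis using True by (auto simp: integrable_iff_bounded)
  next
    case False
    then show ?thesis by (auto simp: integrable_iff_bounded not_integrable_integral_eq)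
  qed
  show ?thesis unfolding eq by measurable
qed

lemma random_configuration_pair_fst: "random_configuration (M \<Otimes>\<^sub>M N) (\<lambda>w. G (fst w))"
proof
  fix w assume "w \<in> space (M \<Otimes>\<^sub>M N)"
  then show "G (fst w) \<in> Config" by (auto simp: space_pair_measure intro: config)
next
  fix A :: "(real^'d) set" assume "A \<in> sets borel" "bounded A"
  then have [measurable]: "(\<lambda>w. real (card (G w \<inter> A))) \<in> borel_measurable M" by (rule card_measurable)
  show "(\<lambda>w. real (card (G (fst w) \<inter> A))) \<in> borel_measurable (M \<Otimes>\<^sub>M N)" by measurable
qed

end

text \<open>Measurability of a count is part of the independence of the one-member family consisting of it.\<close>

lemma is_Poisson_measure_random_configuration:
  assumes "is_Poisson_measure z P"
  shows "random_configuration P (\<lambda>\<gamma>. \<gamma>)"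
proof
  interpret prob_space P using assms by (simp add: is_Poisson_measure_def)
  show "\<gamma> \<in> Config" if "\<gamma> \<in> space P" for \<gamma> using assms that by (simp add: is_Poisson_measure_def)
  fix A :: "(real^'a) set" assume A: "A \<in> sets borel" "bounded A"
  have "indep_vars (\<lambda>_. count_space UNIV) (\<lambda>i \<gamma>. card (\<gamma> \<inter> (\<lambda>_::nat. A) i)) {..<Suc 0}"
    by (rule assms[unfolded is_Poisson_measure_def, THEN conjunct2, THEN conjunct2, THEN conjunct2,
          THEN conjunct2, rule_format]) (use A in \<open>auto simp: disjoint_family_on_def\<close>)
  then have "(\<lambda>\<gamma>. card (\<gamma> \<inter> A)) \<in> measurable P (count_space UNIV)"
    by (auto simp: indep_vars_def)
  then show "(\<lambda>\<gamma>. real (card (\<gamma> \<inter> A))) \<in> borel_measurable P" by measurable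
qed

lemma summable_on_vec_iff_abs:
  fixes f :: "'a \<Rightarrow> real^'e::finite"
  shows "f summable_on A \<longleftrightarrow> (\<lambda>x. norm (f x)) summable_on A"
proof
  assume f: "f summable_on A"
  have c: "(\<lambda>x. norm (f x $ i)) summable_on A" for i
    using summable_on_bounded_linear[OF bounded_linear_vec_nth[of i] f]
    by (subst (asm) summable_on_iff_abs_summable_on_real)
  have "(\<lambda>x. \<Sum>i\<in>I. norm (f x $ i)) summable_on A" if "finite I" for I
    using that by (induction I rule: finite_induct) (auto intro!: summable_on_add c[simplified])
  then have "(\<lambda>x. \<Sum>i\<in>UNIV. norm (f x $ i)) summable_on A" by simp
  then show "(\<lambda>x. norm (f x)) summable_on A"
    by (rule summable_on_comparison_test) (auto simp: norm_le_l1_cart)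
qed (rule abs_summable_summable)

text \<open>In finite dimension unconditional and absolute convergence agree, so that the two sides are also
  set to \<open>0\<close> in the same cases.\<close>

lemma infsum_vec_eq_integral:
  fixes f :: "'a \<Rightarrow> real^'e::finite"
  shows "infsum f A = (\<integral>x. f x \<partial>count_space A)"
proof (cases "integrable (count_space A) f")
  case True
  then show ?thesis using infsetsum_infsum[of f A] by (simp add: abs_summable_on_def infsetsum_def)
next
  case False
  then have "\<not> f summable_on A"
    using summable_on_vec_iff_abs[of f A] abs_summable_equivalent[of f A] by (simp add: abs_summable_on_def)
  then show ?thesis using False by (simp add: infsum_not_exists not_integrable_integral_eq)
qed

lemma infsum_real_eq_integral:
  fixes f :: "'a \<Rightarrow> real"
  shows "infsum f A = (\<integral>x. f x \<partial>count_space A)"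
proof (cases "integrable (count_space A) f")
  case True
  then show ?thesis using infsetsum_infsum[of f A] by (simp add: abs_summable_on_def infsetsum_def)
next
  case False
  then have "\<not> f summable_on A"
    using summable_on_iff_abs_summable_on_real[of f A] abs_summable_equivalent[of f A] by (simp add: abs_summable_on_def)
  then show ?thesis using False by (simp add: infsum_not_exists not_integrable_integral_eq)
qed

section \<open>Square integrability of pair sums under the Poisson measure\<close>

lemma nn_integral_lborel_reflect:
  fixes f :: "'a::euclidean_space \<Rightarrow> ennreal"
  assumes [measurable]: "f \<in> borel_measurable borel"
  shows "(\<integral>\<^sup>+x. f (t - x) \<partial>lborel) = (\<integral>\<^sup>+x. f x \<partial>lborel)"
proof -
  have "(\<integral>\<^sup>+x. f x \<partial>lborel) =
      (\<integral>\<^sup>+x. f x \<partial>density (distr lborel borel (\<lambda>x. t + (-1) *\<^sub>R x)) (\<lambda>_. ennreal (\<bar>- 1\<bar> ^ DIM('a))))"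
    using lborel_affine[of "-1::real" t] by simp
  also have "\<dots> = (\<integral>\<^sup>+x. f (t - x) \<partial>lborel)"
    by (simp add: nn_integral_density nn_integral_distr)
  finally show ?thesis ..
qed

text \<open>What matters about the bound is that it depends on \<open>A\<close> only through its volume: it is the same for
  all translates of a ball.\<close>

lemma Poisson_fourth_moment:
  assumes P: "is_Poisson_measure z P" and z: "z > 0" and A: "A \<in> sets borel" "bounded A"
  shows "(\<integral>\<^sup>+\<gamma>. ennreal (real (card (\<gamma> \<inter> A))) ^ 4 \<partial>P)
     \<le> ennreal (256 * exp (- (z * measure lborel A)) * exp (exp 1 * (z * measure lborel A)))"
proof -
  interpret prob_space P using P by (simp add: is_Poisson_measure_def)
  interpret random_configuration P "\<lambda>\<gamma>. \<gamma>" using P by (rule is_Poisson_measure_random_configuration)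
  have sp: "space P = Config" using P by (simp add: is_Poisson_measure_def)
  define l where "l = z * measure lborel A"
  have l: "l \<ge> 0" using z by (simp add: l_def)
  let ?N = "\<lambda>\<gamma>. card (\<gamma> \<inter> A)"
  have [measurable]: "(\<lambda>\<gamma>. real (?N \<gamma>)) \<in> borel_measurable P" by (rule card_measurable[OF A])
  have N: "{\<gamma> \<in> space P. ?N \<gamma> = k} \<in> sets P" for k
  proof -
    have "{\<gamma> \<in> space P. real (?N \<gamma>) = real k} \<in> sets P" by measurable
    then show ?thesis by simp
  qed
  have pr: "emeasure P {\<gamma> \<in> space P. ?N \<gamma> = k} = ennreal (exp (- l) * l ^ k / fact k)" for k
    using P A unfolding is_Poisson_measure_def emeasure_eq_measure by (simp add: l_def)
  \<comment> \<open>The fourth power is dominated by an exponential, whose expectation is an exponential series.\<close>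
  have pow4: "real n ^ 4 \<le> 256 * exp 1 ^ n" for n :: nat
  proof -
    have "real n / 4 \<le> exp (real n / 4)" using exp_ge_add_one_self[of "real n / 4"] by linarith
    then have "(real n / 4) ^ 4 \<le> exp (real n / 4) ^ 4" by (intro power_mono) auto
    also have "exp (real n / 4) ^ 4 = exp 1 ^ n"
      by (simp add: exp_of_nat_mult[symmetric])
    finally show ?thesis by (simp add: power_divide)
  qed
  have "(\<integral>\<^sup>+\<gamma>. ennreal (real (?N \<gamma>)) ^ 4 \<partial>P)
      \<le> (\<integral>\<^sup>+\<gamma>. (\<Sum>k. ennreal (256 * exp 1 ^ k) * indicator {\<gamma> \<in> space P. ?N \<gamma> = k} \<gamma>) \<partial>P)"
  proof (rule nn_integral_mono)
    fix \<gamma> assume g: "\<gamma> \<in> space P"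
    have "(\<Sum>k. ennreal (256 * exp 1 ^ k) * indicator {\<gamma> \<in> space P. ?N \<gamma> = k} \<gamma>)
      = ennreal (256 * exp 1 ^ ?N \<gamma>)"
      by (rule suminf_cmult_indicator) (use g in \<open>auto simp: disjoint_family_on_def\<close>)
    then show "ennreal (real (?N \<gamma>)) ^ 4
        \<le> (\<Sum>k. ennreal (256 * exp 1 ^ k) * indicator {\<gamma> \<in> space P. ?N \<gamma> = k} \<gamma>)"
      using pow4[of "?N \<gamma>"] by (simp add: ennreal_power ennreal_leI)
  qed
  also have "\<dots> = (\<Sum>k. \<integral>\<^sup>+\<gamma>. ennreal (256 * exp 1 ^ k) * indicator {\<gamma> \<in> space P. ?N \<gamma> = k} \<gamma> \<partial>P)"
    using N by (intro nn_integral_suminf) auto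
  also have "\<dots> = (\<Sum>k. ennreal (256 * exp 1 ^ k) * ennreal (exp (- l) * l ^ k / fact k))"
    using N by (simp add: nn_integral_cmult_indicator pr)
  also have "\<dots> = (\<Sum>k. ennreal ((256 * exp (- l)) * ((exp 1 * l) ^ k / fact k)))"
    using l by (intro suminf_cong) (simp add: ennreal_mult[symmetric] power_mult_distrib mult_ac)
  also have "\<dots> = ennreal (256 * exp (- l) * exp (exp 1 * l))"
  proof (rule suminf_ennreal_eq)
    have "(\<lambda>k. (exp 1 * l) ^ k / fact k) sums exp (exp 1 * l)"
      using exp_converges[of "exp 1 * l"] by (simp add: field_simps)
    then show "(\<lambda>k. (256 * exp (- l)) * ((exp 1 * l) ^ k / fact k)) sums (256 * exp (- l) * exp (exp 1 * l))"
      by (rule sums_mult)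
  qed (use l in auto)
  finally show ?thesis unfolding l_def .
qed

lemma ennreal_mult_power2_le_power4:
  fixes a b :: ennreal
  shows "(a * b)\<^sup>2 \<le> a ^ 4 + b ^ 4"
proof -
  have "(a * b)\<^sup>2 \<le> (max a b * max a b)\<^sup>2" by (intro power_mono mult_mono) auto
  also have "\<dots> = max a b ^ 4" by (simp add: power2_eq_square power4_eq_xxxx mult.assoc)
  also have "\<dots> \<le> a ^ 4 + b ^ 4" by (auto simp: max_def)
  finally show ?thesis .
qed

text \<open>Replace each of the two points by an average over the ball of radius \<open>\<delta> / 2\<close> around it. The hypothesis
  on \<open>H\<close> turns the pair sum into an integral of \<open>W (p - u) N\<^sub>p N\<^sub>u\<close>, where \<open>N\<^sub>p\<close> is the number of points in
  the ball around \<open>p\<close>, over \<open>p\<close> in a bounded set and all \<open>u\<close>. The weight has finite total mass, so by the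
  Cauchy-Schwarz inequality the second moment is controlled by that of \<open>N\<^sub>p N\<^sub>u\<close>, hence by the fourth
  moment of \<open>N\<^sub>p\<close>, which does not depend on \<open>p\<close>.\<close>

theorem pair_sum_square_integrable:
  fixes W :: "real^'d::finite \<Rightarrow> ennreal" and H :: "real^'d \<Rightarrow> real^'d \<Rightarrow> ennreal"
  assumes P: "is_Poisson_measure z P" and z: "z > 0"
    and W[measurable]: "W \<in> borel_measurable borel" and W_int: "(\<integral>\<^sup>+u. W u \<partial>lborel) < \<infinity>"
    and \<delta>: "\<delta> > 0"
    and H: "\<And>x y u. norm x \<le> \<rho> \<Longrightarrow> norm (x - y - u) \<le> \<delta> \<Longrightarrow> H x y \<le> W u"
  shows "\<exists>U\<in>borel_measurable P. (\<integral>\<^sup>+\<gamma>. (U \<gamma>)\<^sup>2 \<partial>P) < \<infinity> \<and>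
    (\<forall>\<gamma>\<in>Config. (\<integral>\<^sup>+(x, y). indicator (cball 0 \<rho>) x * H x y \<partial>count_space (\<gamma> \<times> \<gamma>)) \<le> U \<gamma>)"
proof -
  interpret prob_space P using P by (simp add: is_Poisson_measure_def)
  interpret random_configuration P "\<lambda>\<gamma>. \<gamma>" using P by (rule is_Poisson_measure_random_configuration)
  have sp: "space P = Config" using P by (simp add: is_Poisson_measure_def)
  define r where "r = \<delta> / 2"
  have r: "r > 0" using \<delta> by (simp add: r_def)
  define V where "V = measure lborel (cball (0::real^'d) r)"
  have V: "V > 0" using r by (simp add: V_def)
  have ball_V: "emeasure lborel (cball x r) = ennreal V" for x :: "real^'d"
    using emeasure_lborel_cball_finite[of x r] emeasure_eq_ennreal_measure[of lborel "cball x r"]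
    by (simp add: V_def content_cball r less_imp_le top.not_eq_extremum)
  define C where "C = ennreal (1 / (V * V))"
  define B where "B = cball (0::real^'d) (\<rho> + r)"
  define w where "w = (\<lambda>q::(real^'d) \<times> (real^'d). C * indicator B (fst q) * W (fst q - snd q))"
  have [measurable]: "B \<in> sets borel" by (simp add: B_def)
  have w[measurable]: "w \<in> borel_measurable (borel \<Otimes>\<^sub>M borel)" unfolding w_def by measurable
  define \<kappa> where "\<kappa> = density (lborel \<Otimes>\<^sub>M lborel) w"
  have sets_\<kappa>[measurable_cong]: "sets \<kappa> = sets (borel \<Otimes>\<^sub>M borel)"
    by (simp add: \<kappa>_def cong: sets_pair_measure_cong)
  have \<kappa>_fin: "emeasure \<kappa> (space \<kappa>) < \<infinity>"
  proof -
    have "emeasure \<kappa> (space \<kappa>) = (\<integral>\<^sup>+q. w q * indicator (space (lborel \<Otimes>\<^sub>M lborel)) q \<partial>(lborel \<Otimes>\<^sub>M lborel))"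
      unfolding \<kappa>_def space_density
    proof (rule emeasure_density)
      show "w \<in> borel_measurable (lborel \<Otimes>\<^sub>M lborel)" by measurable
      show "space (lborel \<Otimes>\<^sub>M lborel) \<in> sets ((lborel :: (real^'d) measure) \<Otimes>\<^sub>M lborel)" by (rule sets.top)
    qed
    also have "\<dots> = (\<integral>\<^sup>+q. w q \<partial>(lborel \<Otimes>\<^sub>M lborel))"
      by (intro nn_integral_cong) simp
    also have "\<dots> = (\<integral>\<^sup>+p. \<integral>\<^sup>+u. w (p, u) \<partial>lborel \<partial>lborel)"
      by (subst lborel.nn_integral_fst) auto
    also have "\<dots> = (\<integral>\<^sup>+p. C * indicator B p * (\<integral>\<^sup>+u. W u \<partial>lborel) \<partial>lborel)"
      by (simp add: w_def nn_integral_cmult nn_integral_lborel_reflect)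
    also have "\<dots> = C * emeasure lborel B * (\<integral>\<^sup>+u. W u \<partial>lborel)"
      by (simp add: nn_integral_multc nn_integral_cmult)
    also have "\<dots> < \<infinity>"
      using W_int emeasure_lborel_cball_finite[of "0::real^'d" "\<rho> + r"]
      by (auto simp: C_def B_def ennreal_mult_less_top)
    finally show ?thesis .
  qed
  interpret \<kappa>: finite_measure \<kappa> using \<kappa>_fin by (intro finite_measureI) auto
  define N where "N = (\<lambda>\<gamma> (p::real^'d). \<integral>\<^sup>+x. indicator (cball x r) p \<partial>count_space \<gamma>)"
  have N_eq: "N \<gamma> p = ennreal (real (card (\<gamma> \<inter> cball p r)))" if "\<gamma> \<in> Config" for \<gamma> p
  proof -
    have "N \<gamma> p = (\<integral>\<^sup>+x. indicator (\<gamma> \<inter> cball p r) x \<partial>count_space \<gamma>)"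
      unfolding N_def by (intro nn_integral_cong) (auto simp: indicator_def dist_commute)
    also have "\<dots> = emeasure (count_space \<gamma>) (\<gamma> \<inter> cball p r)" by (rule nn_integral_indicator) auto
    also have "\<dots> = ennreal (real (card (\<gamma> \<inter> cball p r)))"
      using Config_finite_Int_bounded[OF that bounded_cball]
      by (subst emeasure_count_space_finite) (auto simp: ennreal_of_nat_eq_real_of_nat)
    finally show ?thesis .
  qed
  have N_meas: "(\<lambda>q. N (fst q) (snd q)) \<in> borel_measurable (P \<Otimes>\<^sub>M borel)"
  proof -
    interpret R: random_configuration "P \<Otimes>\<^sub>M borel" "\<lambda>q. fst q" by (rule random_configuration_pair_fst)
    have "(\<lambda>s::((real^'d) set \<times> (real^'d)) \<times> (real^'d). indicator {0..r} (dist (snd s) (snd (fst s))) :: ennreal)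
        \<in> borel_measurable ((P \<Otimes>\<^sub>M borel) \<Otimes>\<^sub>M borel)" by measurable
    from R.nn_integral_points_measurable[OF this] show ?thesis
      unfolding N_def by (rule measurable_cong[THEN iffD1, rotated]) (auto simp: indicator_def intro!: nn_integral_cong)
  qed
  have [measurable]: "(\<lambda>s. N (f s) (g s)) \<in> borel_measurable M"
    if "f \<in> measurable M P" "g \<in> borel_measurable M" for f :: "'x \<Rightarrow> (real^'d) set" and g M
    using measurable_compose[OF measurable_Pair[OF that] N_meas] by simp
  define U where "U = (\<lambda>\<gamma>. \<integral>\<^sup>+q. N \<gamma> (fst q) * N \<gamma> (snd q) \<partial>\<kappa>)"
  have U_meas[measurable]: "U \<in> borel_measurable P"
    unfolding U_def by measurable
  define M4 where "M4 = ennreal (256 * exp (- (z * V)) * exp (exp 1 * (z * V)))"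
  have N4: "(\<integral>\<^sup>+\<gamma>. N \<gamma> p ^ 4 \<partial>P) \<le> M4" for p
  proof -
    have "(\<integral>\<^sup>+\<gamma>. N \<gamma> p ^ 4 \<partial>P) = (\<integral>\<^sup>+\<gamma>. ennreal (real (card (\<gamma> \<inter> cball p r))) ^ 4 \<partial>P)"
      by (intro nn_integral_cong) (simp add: N_eq sp)
    also have "\<dots> \<le> M4"
      using Poisson_fourth_moment[OF P z, of "cball p r"] V ball_V[of p]
      by (simp add: M4_def V_def measure_def)
    finally show ?thesis .
  qed
  interpret PK: pair_sigma_finite P \<kappa> by standard
  have "(\<integral>\<^sup>+\<gamma>. (U \<gamma>)\<^sup>2 \<partial>P) < \<infinity>"
  proof -
    have "(\<integral>\<^sup>+\<gamma>. (U \<gamma>)\<^sup>2 \<partial>P) \<le>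
        (\<integral>\<^sup>+\<gamma>. (\<integral>\<^sup>+q. (N \<gamma> (fst q) * N \<gamma> (snd q))\<^sup>2 \<partial>\<kappa>) * emeasure \<kappa> (space \<kappa>) \<partial>P)"
    proof (rule nn_integral_mono)
      fix \<gamma> assume [simp]: "\<gamma> \<in> space P"
      show "(U \<gamma>)\<^sup>2 \<le> (\<integral>\<^sup>+q. (N \<gamma> (fst q) * N \<gamma> (snd q))\<^sup>2 \<partial>\<kappa>) * emeasure \<kappa> (space \<kappa>)"
        using Cauchy_Schwarz_nn_integral[of "\<lambda>q. N \<gamma> (fst q) * N \<gamma> (snd q)" \<kappa> "\<lambda>_. 1"]
        by (simp add: U_def)
    qed
    also have "\<dots> = (\<integral>\<^sup>+\<gamma>. (\<integral>\<^sup>+q. (N \<gamma> (fst q) * N \<gamma> (snd q))\<^sup>2 \<partial>\<kappa>) \<partial>P) * emeasure \<kappa> (space \<kappa>)"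
      by (intro nn_integral_multc) measurable
    also have "(\<integral>\<^sup>+\<gamma>. (\<integral>\<^sup>+q. (N \<gamma> (fst q) * N \<gamma> (snd q))\<^sup>2 \<partial>\<kappa>) \<partial>P)
        = (\<integral>\<^sup>+q. (\<integral>\<^sup>+\<gamma>. (N \<gamma> (fst q) * N \<gamma> (snd q))\<^sup>2 \<partial>P) \<partial>\<kappa>)"
      by (rule PK.Fubini'[symmetric]) measurable
    also have "\<dots> \<le> (\<integral>\<^sup>+q. 2 * M4 \<partial>\<kappa>)"
    proof (rule nn_integral_mono)
      fix q
      have "(\<integral>\<^sup>+\<gamma>. (N \<gamma> (fst q) * N \<gamma> (snd q))\<^sup>2 \<partial>P)
          \<le> (\<integral>\<^sup>+\<gamma>. N \<gamma> (fst q) ^ 4 + N \<gamma> (snd q) ^ 4 \<partial>P)"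
        by (intro nn_integral_mono ennreal_mult_power2_le_power4)
      also have "\<dots> = (\<integral>\<^sup>+\<gamma>. N \<gamma> (fst q) ^ 4 \<partial>P) + (\<integral>\<^sup>+\<gamma>. N \<gamma> (snd q) ^ 4 \<partial>P)"
        by (intro nn_integral_add) measurable
      also have "\<dots> \<le> M4 + M4" by (intro add_mono N4)
      finally show "(\<integral>\<^sup>+\<gamma>. (N \<gamma> (fst q) * N \<gamma> (snd q))\<^sup>2 \<partial>P) \<le> 2 * M4" by (simp add: mult_2)
    qed
    also have "(\<integral>\<^sup>+q. 2 * M4 \<partial>\<kappa>) * emeasure \<kappa> (space \<kappa>) < \<infinity>"
      using \<kappa>_fin by (auto simp: M4_def ennreal_mult_less_top)
    finally show ?thesis by (simp add: mult_right_mono)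
  qed
  moreover have "(\<integral>\<^sup>+(x, y). indicator (cball 0 \<rho>) x * H x y \<partial>count_space (\<gamma> \<times> \<gamma>)) \<le> U \<gamma>"
    if g: "\<gamma> \<in> Config" for \<gamma>
  proof -
    have cg: "countable \<gamma>" by (rule Config_countable[OF g])
    let ?I = "\<lambda>x q. indicator (cball (fst x) r) (fst q) * indicator (cball (snd x) r) (snd q) :: ennreal"
    have [measurable]: "?I x \<in> borel_measurable (borel \<Otimes>\<^sub>M borel)" for x
    proof -
      have [measurable]: "cball (fst x) r \<in> sets borel" "cball (snd x) r \<in> sets borel" by auto
      show ?thesis by measurable
    qed
    have [measurable]: "?I x \<in> borel_measurable \<kappa>" "?I x \<in> borel_measurable (lborel \<Otimes>\<^sub>M lborel)" for x
      by measurable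
    \<comment> \<open>Averaging over \<open>q\<close> in the product of the two balls: there \<open>H\<close> is below the weight.\<close>
    have avg: "indicator (cball 0 \<rho>) x * H x y \<le> (\<integral>\<^sup>+q. ?I (x, y) q \<partial>\<kappa>)" for x y
    proof (cases "x \<in> cball 0 \<rho>")
      case True
      have "H x y = C * H x y * (ennreal V * ennreal V)"
        using V by (simp add: C_def ennreal_mult[symmetric] mult.commute[of "ennreal _" "H x y"] mult.assoc)
      also have "ennreal V * ennreal V = emeasure (lborel \<Otimes>\<^sub>M lborel) (cball x r \<times> cball y r)"
        by (subst lborel.emeasure_pair_measure_Times) (auto simp: ball_V)
      also have "C * H x y * \<dots> = (\<integral>\<^sup>+q. C * H x y * indicator (cball x r \<times> cball y r) q \<partial>(lborel \<Otimes>\<^sub>M lborel))"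
        by (subst nn_integral_cmult_indicator) auto
      also have "\<dots> \<le> (\<integral>\<^sup>+q. w q * ?I (x, y) q \<partial>(lborel \<Otimes>\<^sub>M lborel))"
      proof (rule nn_integral_mono)
        fix q :: "(real^'d) \<times> (real^'d)"
        obtain p u where q: "q = (p, u)" by (cases q)
        show "C * H x y * indicator (cball x r \<times> cball y r) q \<le> w q * ?I (x, y) q"
        proof (cases "p \<in> cball x r \<and> u \<in> cball y r")
          case pu: True
          then have n: "norm (x - p) \<le> r" "norm (y - u) \<le> r" by (auto simp: dist_norm)
          have "norm (x - y - (p - u)) = norm ((x - p) - (y - u))" by (simp add: algebra_simps)
          also have "\<dots> \<le> r + r" using norm_triangle_ineq4[of "x - p" "y - u"] n by linarith
          finally have "H x y \<le> W (p - u)" using True by (intro H) (auto simp: r_def)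
          moreover have "p \<in> B"
            using True n norm_triangle_ineq4[of x "x - p"] by (auto simp: B_def)
          ultimately show ?thesis using pu by (simp add: w_def q mult_left_mono)
        qed (auto simp: q)
      qed
      also have "\<dots> = (\<integral>\<^sup>+q. ?I (x, y) q \<partial>\<kappa>)"
        unfolding \<kappa>_def by (rule nn_integral_density[symmetric]) measurable
      finally show ?thesis using True by simp
    qed simp
    have "(\<integral>\<^sup>+(x, y). indicator (cball 0 \<rho>) x * H x y \<partial>count_space (\<gamma> \<times> \<gamma>))
        \<le> (\<integral>\<^sup>+x. (\<integral>\<^sup>+q. ?I x q \<partial>\<kappa>) \<partial>count_space (\<gamma> \<times> \<gamma>))"
      using avg by (intro nn_integral_mono) auto
    also have "\<dots> = (\<integral>\<^sup>+q. (\<integral>\<^sup>+x. ?I x q \<partial>count_space (\<gamma> \<times> \<gamma>)) \<partial>\<kappa>)"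
      using cg by (intro nn_integral_count_space_nn_integral[symmetric]) (auto simp: split_beta')
    also have "\<dots> = U \<gamma>"
      unfolding U_def
    proof (rule nn_integral_cong)
      fix q :: "(real^'d) \<times> (real^'d)"
      interpret S: sigma_finite_measure "count_space \<gamma>" by (rule sigma_finite_measure_count_space_countable[OF cg])
      have "(\<integral>\<^sup>+x. ?I x q \<partial>count_space (\<gamma> \<times> \<gamma>)) = (\<integral>\<^sup>+x. ?I x q \<partial>(count_space \<gamma> \<Otimes>\<^sub>M count_space \<gamma>))"
        using cg by (simp add: pair_measure_countable)
      also have "\<dots> = (\<integral>\<^sup>+x. \<integral>\<^sup>+y. ?I (x, y) q \<partial>count_space \<gamma> \<partial>count_space \<gamma>)"
        by (rule S.nn_integral_fst[symmetric]) (use cg in \<open>simp add: pair_measure_countable\<close>)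
      also have "\<dots> = N \<gamma> (fst q) * N \<gamma> (snd q)"
        by (simp add: N_def nn_integral_cmult nn_integral_multc)
      finally show "(\<integral>\<^sup>+x. ?I x q \<partial>count_space (\<gamma> \<times> \<gamma>)) = N \<gamma> (fst q) * N \<gamma> (snd q)" .
    qed
    finally show ?thesis .
  qed
  ultimately show ?thesis using U_meas by blast
qed

section \<open>Differential calculus along straight lines\<close>

lemma has_derivative_grad:
  fixes f :: "real^'n::finite \<Rightarrow> real"
  assumes "f differentiable_on UNIV"
  shows "(f has_derivative (\<lambda>h. grad f x \<bullet> h)) (at x)"
proof -
  obtain D where D: "(f has_derivative D) (at x)"
    using assms by (auto simp: differentiable_on_def differentiable_def)
  then interpret D: bounded_linear D by (rule has_derivative_bounded_linear)
  have "partial_deriv i f x = D (axis i 1)" for i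
  proof -
    have "((\<lambda>t. f (x + t *\<^sub>R axis i 1)) has_derivative (\<lambda>t. D (t *\<^sub>R axis i 1))) (at 0)"
      by (rule has_derivative_compose[where g=f, unfolded o_def])
        (use D in \<open>auto intro!: derivative_eq_intros\<close>)
    then have "((\<lambda>t. f (x + t *\<^sub>R axis i 1)) has_field_derivative D (axis i 1)) (at 0)"
      by (simp add: has_field_derivative_def D.scaleR mult.commute[of _ "D _"])
    then show ?thesis unfolding partial_deriv_def by (rule DERIV_imp_deriv)
  qed
  then have "grad f x \<bullet> h = (\<Sum>i\<in>UNIV. h $ i * D (axis i 1))" for h
    by (simp add: grad_def inner_vec_def mult.commute)
  also have "(\<Sum>i\<in>UNIV. h $ i * D (axis i 1)) = D h" for h
  proof -
    have "D h = D (\<Sum>i\<in>UNIV. (h $ i) *\<^sub>R axis i 1)" by (simp only: basis_expansion[where 'a=real, unfolded scalar_mult_eq_scaleR])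
    then show ?thesis by (simp add: D.sum D.scaleR)
  qed
  finally show ?thesis using D by simp
qed

lemma has_real_derivative_along_path:
  fixes g :: "real^'n::finite \<Rightarrow> real" and p :: "real \<Rightarrow> real^'n"
  assumes g: "g differentiable_on UNIV"
    and p: "\<And>i. ((\<lambda>t. p t $ i) has_real_derivative p' i) (at t)"
  shows "((\<lambda>t. g (p t)) has_real_derivative (\<Sum>i\<in>UNIV. partial_deriv i g (p t) * p' i)) (at t)"
proof -
  have "(p has_derivative (\<lambda>s. \<chi> i. p' i * s)) (at t)"
    using p by (subst has_derivative_componentwise_within)
      (auto simp: Basis_vec_def inner_axis has_field_derivative_def mult.commute[of _ "p' _"])
  from has_derivative_compose[OF this has_derivative_grad[OF g]]
  have "((\<lambda>t. g (p t)) has_derivative (\<lambda>s. grad g (p t) \<bullet> (\<chi> i. p' i * s))) (at t)" .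
  then show ?thesis
    by (simp add: has_field_derivative_def grad_def inner_vec_def sum_distrib_right[symmetric] mult.assoc[symmetric])
qed

lemma has_real_derivative_along_line:
  fixes f :: "real^'n::finite \<Rightarrow> real"
  assumes f: "f differentiable_on UNIV"
  shows "((\<lambda>t. f (x + t *\<^sub>R h)) has_real_derivative (grad f (x + t *\<^sub>R h) \<bullet> h)) (at t)"
proof -
  have "((\<lambda>t. (x + t *\<^sub>R h) $ i) has_real_derivative h $ i) (at t)" for i
    by (auto intro!: derivative_eq_intros)
  from has_real_derivative_along_path[OF f, of "\<lambda>t. x + t *\<^sub>R h", OF this]
  show ?thesis by (simp add: grad_def inner_vec_def)
qed

lemma smooth_differentiable: "smooth f \<Longrightarrow> f differentiable_on UNIV"
  using Ck.simps(2)[of 0 f] by (auto simp: smooth_def)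

lemma smooth_partial_deriv: "smooth f \<Longrightarrow> smooth (partial_deriv i f)"
  unfolding smooth_def by (metis Ck.simps(2))

lemma smooth_continuous: "smooth f \<Longrightarrow> continuous_on UNIV f"
  unfolding smooth_def by (metis Ck.simps(1))

lemma Ck_1_grad_continuous: "Ck 1 f \<Longrightarrow> continuous_on UNIV (grad f)"
  unfolding grad_def by (intro continuous_on_vec_lambda) auto

lemma smooth_grad_continuous: "smooth f \<Longrightarrow> continuous_on UNIV (grad f)"
  using Ck_1_grad_continuous smooth_def by blast

text \<open>The second derivative of \<open>f\<close> at \<open>x\<close> in the direction \<open>h\<close>.\<close>

definition hess_form :: "(real^'n::finite \<Rightarrow> real) \<Rightarrow> real^'n \<Rightarrow> real^'n \<Rightarrow> real" where
  "hess_form f x h = (\<Sum>k\<in>UNIV. h $ k * (grad (partial_deriv k f) x \<bullet> h))"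

lemma has_real_derivative_grad_line:
  fixes f :: "real^'n::finite \<Rightarrow> real"
  assumes f: "smooth f"
  shows "((\<lambda>t. grad f (x + t *\<^sub>R h) \<bullet> h) has_real_derivative hess_form f (x + t *\<^sub>R h) h) (at t)"
proof -
  have "((\<lambda>t. \<Sum>k\<in>UNIV. h $ k * partial_deriv k f (x + t *\<^sub>R h))
      has_real_derivative (\<Sum>k\<in>UNIV. h $ k * (grad (partial_deriv k f) (x + t *\<^sub>R h) \<bullet> h))) (at t)"
    by (intro DERIV_sum DERIV_cmult has_real_derivative_along_line smooth_differentiable
        smooth_partial_deriv f)
  then show ?thesis by (simp add: hess_form_def grad_def inner_vec_def mult.commute)
qed

text \<open>Partial derivatives are defined by limits and thus local; applied twice, this covers second
  derivatives as well.\<close>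

lemma partial_deriv_cong_open:
  assumes "open S" "x \<in> S" "\<And>y. y \<in> S \<Longrightarrow> f y = g y"
  shows "partial_deriv i f x = partial_deriv i g x"
proof -
  have "open ((\<lambda>t::real. x + t *\<^sub>R axis i 1) -` S)"
    by (intro open_vimage assms(1) continuous_intros)
  then have "\<forall>\<^sub>F t in nhds 0. t \<in> (\<lambda>t::real. x + t *\<^sub>R axis i 1) -` S"
    by (rule eventually_nhds_in_open) (use assms(2) in simp)
  then have "\<forall>\<^sub>F t in nhds 0. f (x + t *\<^sub>R axis i 1) = g (x + t *\<^sub>R axis i 1)"
    by eventually_elim (auto intro: assms(3))
  then show ?thesis unfolding partial_deriv_def by (rule deriv_cong_ev) simp
qed

lemma C0_infinity_partial_deriv:
  assumes "f \<in> C0_infinity" shows "partial_deriv i f \<in> C0_infinity"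
proof -
  let ?S = "closure {x. f x \<noteq> 0}"
  have f: "smooth f" "compact ?S" using assms by (auto simp: C0_infinity_def compact_support_def)
  have "partial_deriv i f x = 0" if "x \<notin> ?S" for x
  proof -
    have "partial_deriv i f x = partial_deriv i (\<lambda>_. 0) x"
      by (rule partial_deriv_cong_open[of "- ?S"]) (use that closure_subset[of "{x. f x \<noteq> 0}"] in auto)
    then show ?thesis by (simp add: partial_deriv_def)
  qed
  then have "closure {x. partial_deriv i f x \<noteq> 0} \<subseteq> ?S"
    by (intro closure_minimal) auto
  with f(2) have "compact (closure {x. partial_deriv i f x \<noteq> 0})"
    by (metis closed_Int_compact closed_closure inf.absorb1)
  with f(1) show ?thesis by (simp add: C0_infinity_def compact_support_def smooth_partial_deriv)
qed

lemma C0_infinity_bounded_support: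
  assumes "f \<in> C0_infinity"
  shows "\<exists>K. \<forall>x. \<bar>f x\<bar> \<le> K \<and> (norm x > K \<longrightarrow> f x = 0)"
proof -
  let ?S = "closure {x. f x \<noteq> 0}"
  have f: "smooth f" "compact ?S" using assms by (auto simp: C0_infinity_def compact_support_def)
  have "compact (f ` ?S)"
    by (intro compact_continuous_image f continuous_on_subset[OF smooth_continuous]) auto
  then obtain K1 where K1: "\<And>x. x \<in> ?S \<Longrightarrow> \<bar>f x\<bar> \<le> K1"
    using compact_imp_bounded bounded_iff by (metis (no_types, lifting) imageI real_norm_def)
  obtain K2 where K2: "\<And>x. x \<in> ?S \<Longrightarrow> norm x \<le> K2"
    using compact_imp_bounded[OF f(2)] by (auto simp: bounded_iff)
  have out: "f x = 0" if "x \<notin> ?S" for x using that closure_subset[of "{x. f x \<noteq> 0}"] by blast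
  show ?thesis
  proof (intro exI allI conjI impI)
    fix x
    show "\<bar>f x\<bar> \<le> max 0 (max K1 K2)" using K1[of x] out[of x] by fastforce
    assume "norm x > max 0 (max K1 K2)"
    then show "f x = 0" using K2[of x] out[of x] by fastforce
  qed
qed

lemma uniform_bound_finite:
  fixes Q :: "'i::finite \<Rightarrow> real \<Rightarrow> bool"
  assumes ex: "\<And>i. \<exists>K. Q i K" and mono: "\<And>i K K'. Q i K \<Longrightarrow> K \<le> K' \<Longrightarrow> Q i K'"
  shows "\<exists>K\<ge>0. \<forall>i. Q i K"
proof -
  obtain c where c: "\<And>i. Q i (c i)" using ex by metis
  have "Q i (Max (insert 0 (range c)))" for i by (rule mono[OF c], rule Max_ge) auto
  then show ?thesis by (intro exI[of _ "Max (insert 0 (range c))"]) auto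
qed

lemma test_functions_bounds:
  fixes \<phi> :: "'n::finite \<Rightarrow> real^'d::finite \<Rightarrow> real"
  assumes "\<And>i. \<phi> i \<in> C0_infinity"
  shows "\<exists>K\<ge>0. \<exists>\<rho>\<ge>0. \<forall>i x h. \<bar>\<phi> i x\<bar> \<le> K \<and> norm (grad (\<phi> i) x) \<le> K \<and> \<bar>hess_form (\<phi> i) x h\<bar> \<le> K * (norm h)\<^sup>2 \<and>
     (norm x > \<rho> \<longrightarrow> \<phi> i x = 0 \<and> grad (\<phi> i) x = 0 \<and> hess_form (\<phi> i) x h = 0)"
proof -
  let ?Q = "\<lambda>f K. \<forall>x. \<bar>f x\<bar> \<le> K \<and> (norm x > K \<longrightarrow> f x = 0)"
  have mono: "?Q f K'" if "?Q f K" "K \<le> K'" for f :: "real^'d \<Rightarrow> real" and K K'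
    using that by (meson less_le_trans order_trans not_le)
  have "\<exists>K\<ge>0. \<forall>i. ?Q (\<phi> i) K"
    by (rule uniform_bound_finite[OF C0_infinity_bounded_support[OF assms] mono])
  then obtain K0 where K0: "K0 \<ge> 0" "\<And>i. ?Q (\<phi> i) K0" by blast
  have "\<exists>K\<ge>0. \<forall>p. ?Q (partial_deriv (snd p) (\<phi> (fst p))) K"
    by (rule uniform_bound_finite[OF C0_infinity_bounded_support[OF C0_infinity_partial_deriv[OF assms]] mono])
  then obtain K1 where K1: "K1 \<ge> 0" and K1': "\<forall>p. ?Q (partial_deriv (snd p) (\<phi> (fst p))) K1" by blast
  have K1: "K1 \<ge> 0" "\<And>i k. ?Q (partial_deriv k (\<phi> i)) K1"
    using K1 spec[OF K1', of "(i, k)" for i k] by auto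
  have "\<exists>K\<ge>0. \<forall>p. ?Q (partial_deriv (snd (snd p)) (partial_deriv (fst (snd p)) (\<phi> (fst p)))) K"
    by (rule uniform_bound_finite[OF C0_infinity_bounded_support[OF
            C0_infinity_partial_deriv[OF C0_infinity_partial_deriv[OF assms]]] mono])
  then obtain K2 where K2: "K2 \<ge> 0"
    and K2': "\<forall>p. ?Q (partial_deriv (snd (snd p)) (partial_deriv (fst (snd p)) (\<phi> (fst p)))) K2" by blast
  have K2: "K2 \<ge> 0" "\<And>i k l. ?Q (partial_deriv l (partial_deriv k (\<phi> i))) K2"
    using K2 spec[OF K2', of "(i, k, l)" for i k l] by auto
  define \<rho> where "\<rho> = max K0 (max K1 K2)"
  define n where "n = real CARD('d)"
  have n1: "n \<ge> 1" by (simp add: n_def Suc_leI)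
  define K where "K = K0 + n * K1 + n * (n * K2)"
  have Kge: "K0 \<le> K" "n * K1 \<le> K" "n * (n * K2) \<le> K" "K \<ge> 0" using K0(1) K1(1) K2(1) n1 by (auto simp: K_def)
  have gb: "norm (grad f x) \<le> n * c" if "\<And>k. \<bar>partial_deriv k f x\<bar> \<le> c" for f :: "real^'d \<Rightarrow> real" and x c
  proof -
    have "norm (grad f x) \<le> (\<Sum>k\<in>UNIV. \<bar>partial_deriv k f x\<bar>)"
      using norm_le_l1_cart[of "grad f x"] by (simp add: grad_def)
    also have "\<dots> \<le> n * c" using sum_mono[of UNIV "\<lambda>k. \<bar>partial_deriv k f x\<bar>" "\<lambda>_. c"] that by (simp add: n_def)
    finally show ?thesis .
  qed
  have gz: "grad f x = 0" if "\<And>k. partial_deriv k f x = 0" for f :: "real^'d \<Rightarrow> real" and x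
    using that by (simp add: grad_def vec_eq_iff)
  have hb: "\<bar>hess_form f x h\<bar> \<le> n * (n * c) * (norm h)\<^sup>2"
    if c: "\<And>k l. \<bar>partial_deriv l (partial_deriv k f) x\<bar> \<le> c" for f :: "real^'d \<Rightarrow> real" and x h c
  proof -
    have "\<bar>h $ k * (grad (partial_deriv k f) x \<bullet> h)\<bar> \<le> norm h * (n * c * norm h)" for k
      unfolding abs_mult
    proof (rule mult_mono[OF component_le_norm_cart])
      have "\<bar>grad (partial_deriv k f) x \<bullet> h\<bar> \<le> norm (grad (partial_deriv k f) x) * norm h"
        by (rule Cauchy_Schwarz_ineq2)
      also have "\<dots> \<le> n * c * norm h" by (intro mult_right_mono gb c) auto
      finally show "\<bar>grad (partial_deriv k f) x \<bullet> h\<bar> \<le> n * c * norm h" .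
    qed auto
    then have "\<bar>hess_form f x h\<bar> \<le> (\<Sum>k\<in>(UNIV::'d set). norm h * (n * c * norm h))"
      unfolding hess_form_def by (intro order_trans[OF sum_abs] sum_mono)
    then show ?thesis by (simp add: n_def power2_eq_square mult_ac)
  qed
  have main: "\<bar>\<phi> i x\<bar> \<le> K \<and> norm (grad (\<phi> i) x) \<le> K \<and> \<bar>hess_form (\<phi> i) x h\<bar> \<le> K * (norm h)\<^sup>2 \<and>
     (norm x > \<rho> \<longrightarrow> \<phi> i x = 0 \<and> grad (\<phi> i) x = 0 \<and> hess_form (\<phi> i) x h = 0)" for i x h
  proof (intro conjI impI)
    show "\<bar>\<phi> i x\<bar> \<le> K" using K0(2)[of i] Kge(1) by (meson order_trans)
    show "norm (grad (\<phi> i) x) \<le> K" using gb[of "\<phi> i" x K1] K1(2)[of _ i] Kge(2) by (meson order_trans)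
    have "\<bar>hess_form (\<phi> i) x h\<bar> \<le> n * (n * K2) * (norm h)\<^sup>2" by (rule hb) (use K2(2) in blast)
    also have "\<dots> \<le> K * (norm h)\<^sup>2" using Kge(3) by (intro mult_right_mono) auto
    finally show "\<bar>hess_form (\<phi> i) x h\<bar> \<le> K * (norm h)\<^sup>2" .
    assume x: "norm x > \<rho>"
    show "\<phi> i x = 0" using x K0(2)[of i] by (simp add: \<rho>_def)
    show "grad (\<phi> i) x = 0" using x K1(2)[of _ i] by (intro gz) (simp add: \<rho>_def)
    have "grad (partial_deriv k (\<phi> i)) x = 0" for k using x K2(2)[of _ k i] by (intro gz) (simp add: \<rho>_def)
    then show "hess_form (\<phi> i) x h = 0" by (simp add: hess_form_def)
  qed
  have "\<rho> \<ge> 0" using K0 by (simp add: \<rho>_def)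
  with main Kge(4) show ?thesis by blast
qed

lemma Cb_infinity_bounds:
  fixes g :: "real^'n::finite \<Rightarrow> real"
  assumes "g \<in> Cb_infinity"
  shows "\<exists>K\<ge>0. \<forall>v i j. \<bar>g v\<bar> \<le> K \<and> \<bar>partial_deriv i g v\<bar> \<le> K \<and> \<bar>partial_deriv j (partial_deriv i g) v\<bar> \<le> K"
proof -
  have bd: "\<exists>K. \<forall>v. \<bar>foldr partial_deriv is g v\<bar> \<le> K" for "is"
    using assms by (auto simp: Cb_infinity_def bounded_iff)
  show ?thesis
  proof -
    obtain K0 where K0: "\<And>v. \<bar>g v\<bar> \<le> K0" using bd[of "[]"] by auto
    have b1: "\<exists>K. \<forall>v. \<bar>partial_deriv i g v\<bar> \<le> K" for i using bd[of "[i]"] by simp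
    have b2: "\<exists>K. \<forall>v. \<bar>partial_deriv j (partial_deriv i g) v\<bar> \<le> K" for i j using bd[of "[j, i]"] by simp
    have "\<exists>K\<ge>0. \<forall>i v. \<bar>partial_deriv i g v\<bar> \<le> K"
      by (rule uniform_bound_finite[OF b1]) (meson order_trans)
    then obtain K1 where K1: "K1 \<ge> 0" "\<And>i v. \<bar>partial_deriv i g v\<bar> \<le> K1" by blast
    have "\<exists>K\<ge>0. \<forall>p v. \<bar>partial_deriv (snd p) (partial_deriv (fst p) g) v\<bar> \<le> K"
      by (rule uniform_bound_finite[OF b2]) (meson order_trans)
    then obtain K2 where K2: "K2 \<ge> 0" "\<And>p v. \<bar>partial_deriv (snd p) (partial_deriv (fst p) g) v\<bar> \<le> K2" by blast
    have K2: "K2 \<ge> 0" "\<And>i j v. \<bar>partial_deriv j (partial_deriv i g) v\<bar> \<le> K2"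
      using K2(1) K2(2)[of "(i, j)" for i j] by auto
    show ?thesis
      using K0 K1 K2
      by (intro exI[of _ "max K0 (max K1 K2)"]) (auto simp: le_max_iff_disj)
  qed
qed

subsection \<open>Second order Taylor expansion\<close>

lemma second_order_remainder_bound:
  fixes f :: "real \<Rightarrow> real"
  assumes f: "\<And>t. (f has_real_derivative f' t) (at t)" "\<And>t. (f' has_real_derivative f'' t) (at t)"
    and K: "\<And>s. 0 \<le> s \<Longrightarrow> s \<le> t \<Longrightarrow> \<bar>f'' s\<bar> \<le> K" and t: "t > 0"
  shows "\<bar>f t - f 0 - t * f' 0\<bar> \<le> K * t\<^sup>2"
proof -
  obtain s where s: "0 < s" "s < t" "f t - f 0 = (t - 0) * f' s"
    using MVT2[OF t, of f f'] f(1) by blast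
  obtain r where r: "0 < r" "r < s" "f' s - f' 0 = (s - 0) * f'' r"
    using MVT2[OF s(1), of f' f''] f(2) by blast
  have "f t - f 0 - t * f' 0 = t * s * f'' r" using s(3) r(3) by (simp add: algebra_simps)
  also have "\<bar>\<dots>\<bar> = (t * s) * \<bar>f'' r\<bar>" using s(1) t by (simp add: abs_mult)
  also have "\<dots> \<le> (t * t) * K" using s r t K[of r] by (intro mult_mono) auto
  finally show ?thesis by (simp add: power2_eq_square mult.commute)
qed

lemma first_order_remainder_bound:
  fixes f :: "real \<Rightarrow> real"
  assumes f: "\<And>t. (f has_real_derivative f' t) (at t)"
    and K: "\<And>s. 0 \<le> s \<Longrightarrow> s \<le> t \<Longrightarrow> \<bar>f' s\<bar> \<le> K" and t: "t > 0"
  shows "\<bar>f t - f 0\<bar> \<le> K * t"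
proof -
  obtain s where s: "0 < s" "s < t" "f t - f 0 = (t - 0) * f' s"
    using MVT2[OF t, of f f'] f(1) by blast
  then show ?thesis using K[of s] t by (simp add: abs_mult mult.commute)
qed

lemma first_order_limit:
  fixes f :: "real \<Rightarrow> real"
  assumes "(f has_real_derivative d) (at 0)"
  shows "((\<lambda>t. (f t - f 0) / t) \<longlongrightarrow> d) (at_right 0)"
  using assms by (auto simp: has_field_derivative_iff intro: tendsto_mono[OF at_le])

lemma second_order_limit:
  fixes f :: "real \<Rightarrow> real"
  assumes f: "\<And>t. (f has_real_derivative f' t) (at t)" "(f' has_real_derivative d) (at 0)"
  shows "((\<lambda>t. (f t - f 0 - t * f' 0) / t\<^sup>2) \<longlongrightarrow> d / 2) (at_right 0)"
proof (rule lhopital_right_0[where f' = "\<lambda>t. f' t - f' 0" and g' = "\<lambda>t. 2 * t"])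
  have "continuous (at 0) (\<lambda>t. f t - f 0 - t * f' 0)"
    using DERIV_isCont[OF f(1)] by (intro continuous_intros) auto
  then show "((\<lambda>t. f t - f 0 - t * f' 0) \<longlongrightarrow> 0) (at_right 0)"
    by (auto simp: continuous_at intro: tendsto_mono[OF at_le])
  show "((\<lambda>t::real. t\<^sup>2) \<longlongrightarrow> 0) (at_right 0)" by (auto intro!: tendsto_eq_intros)
  have pos: "\<forall>\<^sub>F t::real in at_right 0. t > 0" by (simp add: eventually_at_right_less)
  show "\<forall>\<^sub>F t::real in at_right 0. t\<^sup>2 \<noteq> 0" "\<forall>\<^sub>F t::real in at_right 0. 2 * t \<noteq> 0"
    using pos by (eventually_elim, simp)+
  show "\<forall>\<^sub>F t in at_right 0. ((\<lambda>t. f t - f 0 - t * f' 0) has_real_derivative f' t - f' 0) (at t)"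
    by (intro always_eventually allI) (auto intro!: derivative_eq_intros f)
  show "\<forall>\<^sub>F t in at_right 0. ((\<lambda>t::real. t\<^sup>2) has_real_derivative 2 * t) (at t)"
    by (intro always_eventually allI) (auto intro!: derivative_eq_intros)
  have "((\<lambda>t. (f' t - f' 0) / t / 2) \<longlongrightarrow> d / 2) (at_right 0)"
    by (intro tendsto_divide first_order_limit f tendsto_const) auto
  then show "((\<lambda>t. (f' t - f' 0) / (2 * t)) \<longlongrightarrow> d / 2) (at_right 0)"
    by (simp add: mult.commute)
qed

section \<open>The jump measure and its second moments\<close>

lemma continuous_on_vec_nth_borel [measurable]: "(\<lambda>x::real^'n::finite. x $ i) \<in> borel_measurable borel"
  by (intro borel_measurable_continuous_onI continuous_intros)

lemma lborel_distr_flip: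
  fixes i :: "'d::finite"
  shows "distr lborel borel (\<lambda>x::real^'d. \<chi> l. if l = i then - x $ l else x $ l) = lborel"
proof -
  let ?c = "\<lambda>j::real^'d. if j = axis i 1 then -1 else (1::real)"
  have eq: "0 + (\<Sum>j\<in>Basis. (?c j * (x \<bullet> j)) *\<^sub>R j) = (\<chi> l. if l = i then - x $ l else x $ l)" for x :: "real^'d"
  proof (subst vec_eq_iff, rule allI)
    fix l
    have "(\<Sum>j\<in>(Basis::(real^'d) set). (?c j * (x \<bullet> j)) *\<^sub>R j) \<bullet> axis l 1 = ?c (axis l 1) * (x \<bullet> axis l 1)"
      by (rule inner_sum_left_Basis) (auto simp: Basis_vec_def)
    then show "(0 + (\<Sum>j\<in>(Basis::(real^'d) set). (?c j * (x \<bullet> j)) *\<^sub>R j)) $ l = (\<chi> l. if l = i then - x $ l else x $ l) $ l"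
      by (simp add: inner_axis axis_eq_axis)
  qed
  have "(\<Prod>j\<in>(Basis::(real^'d) set). \<bar>?c j\<bar>) = 1" by (intro prod.neutral) auto
  then have "lborel = density (distr lborel borel (\<lambda>x::real^'d. \<chi> l. if l = i then - x $ l else x $ l)) (\<lambda>_. 1)"
    using lborel_affine_euclidean[of ?c 0] unfolding eq by simp
  then show ?thesis by (simp add: density_1)
qed

lemma lborel_distr_swap:
  fixes i j :: "'d::finite"
  shows "distr lborel borel (\<lambda>x::real^'d. \<chi> l. x $ (Transposition.transpose i j l)) = lborel"
proof (rule sym, rule lborel_eqI)
  let ?T = "\<lambda>x::real^'d. \<chi> l. x $ (Transposition.transpose i j l)"
  have T_inner: "?T x \<bullet> y = x \<bullet> ?T y" for x y
    unfolding inner_vec_def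
    by (rule sum.reindex_bij_witness[of _ "Transposition.transpose i j" "Transposition.transpose i j"]) auto
  have TT: "?T (?T x) = x" for x by (simp add: vec_eq_iff)
  have T_Basis: "?T b \<in> Basis" if "b \<in> Basis" for b
  proof -
    obtain k where "b = axis k 1" using \<open>b \<in> Basis\<close> by (auto simp: Basis_vec_def)
    then have "?T b = axis (Transposition.transpose i j k) 1" by (auto simp: vec_eq_iff axis_def Transposition.transpose_def)
    then show ?thesis by (auto simp: Basis_vec_def)
  qed
  have reindex: "(\<forall>b\<in>Basis. Q b (?T b)) \<longleftrightarrow> (\<forall>b\<in>Basis. Q (?T b) b)" for Q
  proof (intro iffI ballI)
    fix b :: "real^'d" assume Q: "\<forall>b\<in>Basis. Q b (?T b)" and b: "b \<in> Basis"
    from bspec[OF Q T_Basis[OF b]] show "Q (?T b) b" by (simp only: TT)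
  next
    fix b :: "real^'d" assume Q: "\<forall>b\<in>Basis. Q (?T b) b" and b: "b \<in> Basis"
    from bspec[OF Q T_Basis[OF b]] show "Q b (?T b)" by (simp only: TT)
  qed
  have [measurable]: "?T \<in> borel_measurable borel"
    by (intro borel_measurable_continuous_onI continuous_intros)
  fix l u :: "real^'d" assume lu: "\<And>b. b \<in> Basis \<Longrightarrow> l \<bullet> b \<le> u \<bullet> b"
  have "?T -` box l u = box (?T l) (?T u)"
  proof (rule set_eqI)
    fix x
    have "?T x \<in> box l u \<longleftrightarrow> (\<forall>b\<in>Basis. l \<bullet> b < x \<bullet> ?T b \<and> x \<bullet> ?T b < u \<bullet> b)"
      by (simp only: mem_box T_inner)
    also have "\<dots> \<longleftrightarrow> (\<forall>b\<in>Basis. l \<bullet> ?T b < x \<bullet> b \<and> x \<bullet> b < u \<bullet> ?T b)"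
      by (rule reindex[of "\<lambda>b c. l \<bullet> b < x \<bullet> c \<and> x \<bullet> c < u \<bullet> b"])
    finally show "x \<in> ?T -` box l u \<longleftrightarrow> x \<in> box (?T l) (?T u)" by (simp only: mem_box T_inner vimage_eq)
  qed
  then have "emeasure (distr lborel borel ?T) (box l u) = emeasure lborel (box (?T l) (?T u))"
    by (subst emeasure_distr) auto
  also have "\<dots> = (\<Prod>b\<in>Basis. (?T u - ?T l) \<bullet> b)"
  proof -
    have "?T l \<bullet> b \<le> ?T u \<bullet> b" if "b \<in> Basis" for b
      unfolding T_inner by (rule lu[OF T_Basis[OF that]])
    then show ?thesis by (simp add: emeasure_lborel_box_eq)
  qed
  also have "(\<Prod>b\<in>Basis. (?T u - ?T l) \<bullet> b) = (\<Prod>b\<in>Basis. (u - l) \<bullet> b)"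
  proof (rule prod.reindex_bij_witness[of _ ?T ?T])
    fix b :: "real^'d"
    show "(u - l) \<bullet> ?T b = (?T u - ?T l) \<bullet> b" by (simp only: inner_diff_left T_inner)
  qed (simp_all only: TT T_Basis)
  finally show "emeasure (distr lborel borel ?T) (box l u) = (\<Prod>b\<in>Basis. (u - l) \<bullet> b)" .
qed simp

text \<open>The properties of the jump distribution that are used: it is radial and finite, and its jumps are
  bounded by \<open>r\<close>.\<close>

locale jump_kernel =
  fixes a :: "real^'d::finite \<Rightarrow> ennreal" and r :: real
  assumes a_measurable [measurable]: "a \<in> borel_measurable borel"
    and a_finite: "(\<integral>\<^sup>+x. a x \<partial>lborel) < \<infinity>"
    and a_radial: "\<And>x y. norm x = norm y \<Longrightarrow> a x = a y"
    and a_support: "\<And>x. norm x > r \<Longrightarrow> a x = 0"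
    and r_pos: "r > 0"
begin

definition \<alpha> :: "real^'d \<Rightarrow> real" where "\<alpha> h = enn2real (a h)"

definition \<mu> :: "(real^'d) measure" where "\<mu> = density lborel (\<lambda>h. ennreal (\<alpha> h))"

definition m0 :: real where "m0 = (\<integral>h. \<alpha> h \<partial>lborel)"

definition m2 :: "'d \<Rightarrow> real" where "m2 k = (\<integral>h. \<alpha> h * (h $ k)\<^sup>2 \<partial>lborel)"

lemma \<alpha>_measurable [measurable]: "\<alpha> \<in> borel_measurable borel"
  unfolding \<alpha>_def by measurable

lemma \<alpha>_nonneg: "\<alpha> h \<ge> 0" by (simp add: \<alpha>_def)

lemma sets_\<mu> [simp, measurable_cong]: "sets \<mu> = sets borel" and space_\<mu> [simp]: "space \<mu> = UNIV"
  by (simp_all add: \<mu>_def)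

lemma emeasure_\<mu>: "emeasure \<mu> UNIV < \<infinity>"
proof -
  have "emeasure \<mu> UNIV = (\<integral>\<^sup>+h. ennreal (\<alpha> h) \<partial>lborel)"
    by (simp add: \<mu>_def emeasure_density)
  also have "\<dots> \<le> (\<integral>\<^sup>+h. a h \<partial>lborel)"
  proof (intro nn_integral_mono)
    fix h show "ennreal (\<alpha> h) \<le> a h" by (cases "a h") (auto simp: \<alpha>_def)
  qed
  finally show ?thesis using a_finite by simp
qed

sublocale finite_measure \<mu> by (rule finite_measureI) (use emeasure_\<mu> in simp)

sublocale \<mu>\<mu>: pair_sigma_finite \<mu> \<mu> ..

lemma integral_\<mu>:
  fixes f :: "real^'d \<Rightarrow> real"
  assumes [measurable]: "f \<in> borel_measurable borel"
  shows "(\<integral>h. f h \<partial>\<mu>) = (\<integral>h. \<alpha> h * f h \<partial>lborel)"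
  unfolding \<mu>_def by (subst integral_density) (auto simp: \<alpha>_nonneg)

lemma AE_\<mu>_support: "AE h in \<mu>. norm h \<le> r"
  unfolding \<mu>_def
  by (subst AE_density) (use a_support in \<open>auto simp: \<alpha>_def intro!: AE_I2 leI\<close>)

definition \<nu> :: "((real^'d) \<times> (real^'d)) measure" where "\<nu> = \<mu> \<Otimes>\<^sub>M \<mu>"

lemma sets_\<nu> [measurable_cong]: "sets \<nu> = sets (borel \<Otimes>\<^sub>M borel)"
  unfolding \<nu>_def by (intro sets_pair_measure_cong sets_\<mu>)

lemma space_\<nu> [simp]: "space \<nu> = UNIV" by (simp add: \<nu>_def space_pair_measure)

sublocale \<nu>: finite_measure \<nu>
  unfolding \<nu>_def by (intro finite_measure_pair_measure) unfold_locales

lemma AE_\<nu>_support: "AE h in \<nu>. norm (fst h) \<le> r \<and> norm (snd h) \<le> r"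
  unfolding \<nu>_def
proof (rule \<mu>\<mu>.AE_pair_measure)
  show "{x \<in> space (\<mu> \<Otimes>\<^sub>M \<mu>). norm (fst x) \<le> r \<and> norm (snd x) \<le> r} \<in> sets (\<mu> \<Otimes>\<^sub>M \<mu>)" by measurable
  show "AE x in \<mu>. AE y in \<mu>. norm (fst (x, y)) \<le> r \<and> norm (snd (x, y)) \<le> r"
    using AE_\<mu>_support by eventually_elim (use AE_\<mu>_support in auto)
qed

lemma integrable_\<nu>_bounded:
  fixes f :: "(real^'d) \<times> (real^'d) \<Rightarrow> real"
  assumes [measurable]: "f \<in> borel_measurable (borel \<Otimes>\<^sub>M borel)"
    and "\<And>h. norm (fst h) \<le> r \<Longrightarrow> norm (snd h) \<le> r \<Longrightarrow> \<bar>f h\<bar> \<le> B"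
  shows "integrable \<nu> f"
proof (rule \<nu>.integrable_const_bound[of _ B])
  show "AE x in \<nu>. norm (f x) \<le> B" using AE_\<nu>_support by eventually_elim (use assms(2) in auto)
qed measurable

lemma integrable_\<nu>_continuous:
  fixes f :: "(real^'d) \<times> (real^'d) \<Rightarrow> real"
  assumes f: "continuous_on UNIV f"
  shows "integrable \<nu> f"
proof -
  have "compact (f ` (cball 0 r \<times> cball 0 r))"
    by (intro compact_continuous_image continuous_on_subset[OF f] compact_Times compact_cball) auto
  then obtain B where B: "\<And>x. x \<in> cball 0 r \<times> cball 0 r \<Longrightarrow> \<bar>f x\<bar> \<le> B"
    using compact_imp_bounded bounded_iff by (metis (no_types, lifting) imageI real_norm_def)
  have "f \<in> borel_measurable (borel \<Otimes>\<^sub>M borel)"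
    using borel_measurable_continuous_onI[OF f] by (simp add: borel_prod)
  then show ?thesis by (rule integrable_\<nu>_bounded[of _ B]) (use B in auto)
qed

lemma integral_\<nu>_iterated:
  fixes f :: "(real^'d) \<times> (real^'d) \<Rightarrow> real"
  assumes "integrable \<nu> f"
  shows "(\<integral>h. f h \<partial>\<nu>) = (\<integral>h1. \<integral>h2. f (h1, h2) \<partial>\<mu> \<partial>\<mu>)"
  using \<mu>\<mu>.integral_fst'[of f] assms by (simp add: \<nu>_def)

lemma integrable_\<mu>_continuous:
  fixes f :: "real^'d \<Rightarrow> real"
  assumes f: "continuous_on UNIV f"
  shows "integrable \<mu> f"
proof -
  have "compact (f ` cball 0 r)"
    by (intro compact_continuous_image continuous_on_subset[OF f] compact_cball) auto
  then obtain B where B: "\<And>x. x \<in> cball 0 r \<Longrightarrow> \<bar>f x\<bar> \<le> B"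
    using compact_imp_bounded bounded_iff by (metis (no_types, lifting) imageI real_norm_def)
  show ?thesis
  proof (rule integrable_const_bound[of _ B])
    show "AE x in \<mu>. norm (f x) \<le> B" using AE_\<mu>_support by eventually_elim (use B in auto)
  qed (use borel_measurable_continuous_onI[OF f] in measurable)
qed

text \<open>Applied to the reflection of one coordinate this makes the first and the mixed second moments
  vanish; applied to the exchange of two coordinates it makes all pure second moments equal.\<close>

lemma integral_\<mu>_isometry:
  fixes f :: "real^'d \<Rightarrow> real"
  assumes T: "distr lborel borel T = lborel" "\<And>x. norm (T x) = norm x"
    and [measurable]: "T \<in> borel_measurable borel" "f \<in> borel_measurable borel"
  shows "(\<integral>h. f (T h) \<partial>\<mu>) = (\<integral>h. f h \<partial>\<mu>)"
proof -
  have "(\<integral>h. f h \<partial>\<mu>) = (\<integral>h. \<alpha> h * f h \<partial>distr lborel borel T)" by (simp add: integral_\<mu> T)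
  also have "\<dots> = (\<integral>h. \<alpha> (T h) * f (T h) \<partial>lborel)" by (subst integral_distr) auto
  also have "\<dots> = (\<integral>h. \<alpha> h * f (T h) \<partial>lborel)"
    using a_radial[OF T(2)] by (simp add: \<alpha>_def)
  also have "\<dots> = (\<integral>h. f (T h) \<partial>\<mu>)" by (subst integral_\<mu>) auto
  finally show ?thesis ..
qed

lemma integral_\<mu>_flip:
  fixes f :: "real^'d \<Rightarrow> real"
  assumes "f \<in> borel_measurable borel"
  shows "(\<integral>h. f (\<chi> l. if l = i then - h $ l else h $ l) \<partial>\<mu>) = (\<integral>h. f h \<partial>\<mu>)"
proof (rule integral_\<mu>_isometry[OF lborel_distr_flip _ _ assms])
  show "norm (\<chi> l. if l = i then - x $ l else x $ l) = norm x" for x :: "real^'d"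
    unfolding norm_vec_def L2_set_def by (auto intro!: arg_cong[of _ _ sqrt] sum.cong)
  have "(\<lambda>x::real^'d. \<chi> l. if l = i then - x $ l else x $ l) = (\<lambda>x. \<chi> l. (if l = i then - 1 else 1) * x $ l)"
    by (auto simp: vec_eq_iff fun_eq_iff)
  moreover have "continuous_on UNIV (\<lambda>x::real^'d. \<chi> l. (if l = i then - 1 else 1) * x $ l)"
    by (intro continuous_intros)
  ultimately show "(\<lambda>x::real^'d. \<chi> l. if l = i then - x $ l else x $ l) \<in> borel_measurable borel"
    by (simp only: borel_measurable_continuous_onI)
qed

lemma integral_\<mu>_coordinate: "(\<integral>h. h $ i \<partial>\<mu>) = 0"
  using integral_\<mu>_flip[of "\<lambda>h. h $ i" i] by simp

lemma integral_\<mu>_mixed: "i \<noteq> j \<Longrightarrow> (\<integral>h. h $ i * h $ j \<partial>\<mu>) = 0"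
  using integral_\<mu>_flip[of "\<lambda>h. h $ i * h $ j" i] by simp

lemma integral_\<mu>_square: "(\<integral>h. h $ i * h $ i \<partial>\<mu>) = m2 k"
proof -
  have "(\<integral>h. h $ k * h $ k \<partial>\<mu>) = m2 k"
    by (subst integral_\<mu>) (auto simp: m2_def power2_eq_square)
  moreover have "(\<integral>h. (\<lambda>h. h $ k * h $ k) (\<chi> l. h $ (Transposition.transpose i k l)) \<partial>\<mu>) = (\<integral>h. h $ k * h $ k \<partial>\<mu>)"
  proof (rule integral_\<mu>_isometry[OF lborel_distr_swap])
    show "norm (\<chi> l. x $ (Transposition.transpose i k l)) = norm x" for x :: "real^'d"
      unfolding norm_vec_def L2_set_def
      by (rule arg_cong[of _ _ sqrt], rule sum.reindex_bij_witness[of _ "Transposition.transpose i k" "Transposition.transpose i k"]) auto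
    show "(\<lambda>x::real^'d. \<chi> l. x $ (Transposition.transpose i k l)) \<in> borel_measurable borel"
      by (intro borel_measurable_continuous_onI continuous_intros)
  qed measurable
  ultimately show ?thesis by simp
qed

lemma integral_\<mu>_1: "(\<integral>h. 1 \<partial>\<mu>) = m0"
  by (subst integral_\<mu>) (auto simp: m0_def)

lemma integral_\<mu>_linear: "(\<integral>h. p \<bullet> h \<partial>\<mu>) = 0"
proof -
  have "(\<integral>h. p \<bullet> h \<partial>\<mu>) = (\<integral>h. (\<Sum>i\<in>UNIV. p $ i * h $ i) \<partial>\<mu>)" by (simp add: inner_vec_def)
  also have "\<dots> = (\<Sum>i\<in>UNIV. \<integral>h. p $ i * h $ i \<partial>\<mu>)"
    by (intro Bochner_Integration.integral_sum integrable_\<mu>_continuous continuous_intros)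
  finally show ?thesis by (simp add: integral_\<mu>_coordinate)
qed

lemma integral_\<mu>_bilinear: "(\<integral>h. (p \<bullet> h) * (q \<bullet> h) \<partial>\<mu>) = m2 k * (p \<bullet> q)"
proof -
  have e: "(\<integral>h. h $ i * h $ j \<partial>\<mu>) = (if i = j then m2 k else 0)" for i j
    by (simp add: integral_\<mu>_mixed integral_\<mu>_square[of _ k])
  have "(\<integral>h. (p \<bullet> h) * (q \<bullet> h) \<partial>\<mu>) = (\<integral>h. (\<Sum>i\<in>UNIV. \<Sum>j\<in>UNIV. (p $ i * q $ j) * (h $ i * h $ j)) \<partial>\<mu>)"
    by (simp add: inner_vec_def sum_product mult_ac)
  also have "\<dots> = (\<Sum>i\<in>UNIV. \<Sum>j\<in>UNIV. (p $ i * q $ j) * (\<integral>h. h $ i * h $ j \<partial>\<mu>))"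
    by (subst Bochner_Integration.integral_sum, intro integrable_\<mu>_continuous continuous_intros,
        intro sum.cong refl, subst Bochner_Integration.integral_sum,
        intro integrable_\<mu>_continuous continuous_intros, simp)
  also have "\<dots> = (\<Sum>i\<in>UNIV. p $ i * q $ i * m2 k)"
    by (simp add: e if_distrib cong: if_cong)
  also have "\<dots> = m2 k * (p \<bullet> q)" by (simp add: inner_vec_def sum_distrib_left mult_ac)
  finally show ?thesis .
qed

lemma measure_\<mu>: "measure \<mu> UNIV = m0"
  using integral_\<mu>_1 by simp

lemma integral_\<nu>_linear: "(\<integral>h. p \<bullet> fst h + q \<bullet> snd h \<partial>\<nu>) = 0"
proof -
  have I: "integrable \<mu> (\<lambda>h. u \<bullet> h)" for u
    by (intro integrable_\<mu>_continuous continuous_intros)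
  have "integrable \<nu> (\<lambda>h. p \<bullet> fst h + q \<bullet> snd h)"
    by (intro integrable_\<nu>_continuous continuous_intros)
  then have "(\<integral>h. p \<bullet> fst h + q \<bullet> snd h \<partial>\<nu>) = (\<integral>h1. \<integral>h2. p \<bullet> h1 + q \<bullet> h2 \<partial>\<mu> \<partial>\<mu>)"
    by (subst integral_\<nu>_iterated) simp_all
  also have "\<dots> = (\<integral>h1. (p \<bullet> h1) * m0 \<partial>\<mu>)"
    by (simp add: I integral_\<mu>_linear measure_\<mu> mult.commute)
  finally show ?thesis by (simp add: integral_\<mu>_linear)
qed

lemma integral_\<nu>_bilinear:
  "(\<integral>h. (p \<bullet> fst h + q \<bullet> snd h) * (p' \<bullet> fst h + q' \<bullet> snd h) \<partial>\<nu>) = m0 * m2 k * (p \<bullet> p' + q \<bullet> q')"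
proof -
  have I: "integrable \<mu> (\<lambda>h. u \<bullet> h)" "integrable \<mu> (\<lambda>h. (u \<bullet> h) * (v \<bullet> h))" for u v
    by (intro integrable_\<mu>_continuous continuous_intros)+
  have "integrable \<nu> (\<lambda>h. (p \<bullet> fst h + q \<bullet> snd h) * (p' \<bullet> fst h + q' \<bullet> snd h))"
    by (intro integrable_\<nu>_continuous continuous_intros)
  then have "(\<integral>h. (p \<bullet> fst h + q \<bullet> snd h) * (p' \<bullet> fst h + q' \<bullet> snd h) \<partial>\<nu>)
     = (\<integral>h1. \<integral>h2. (p \<bullet> h1 + q \<bullet> h2) * (p' \<bullet> h1 + q' \<bullet> h2) \<partial>\<mu> \<partial>\<mu>)"
    by (subst integral_\<nu>_iterated) simp_all
  also have "\<dots> = (\<integral>h1. m0 * ((p \<bullet> h1) * (p' \<bullet> h1)) + m2 k * (q \<bullet> q') \<partial>\<mu>)"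
  proof (intro Bochner_Integration.integral_cong refl)
    fix h1
    have "(\<integral>h2. (p \<bullet> h1 + q \<bullet> h2) * (p' \<bullet> h1 + q' \<bullet> h2) \<partial>\<mu>) =
      (\<integral>h2. (p \<bullet> h1) * (p' \<bullet> h1) + ((p \<bullet> h1) * (q' \<bullet> h2) + ((p' \<bullet> h1) * (q \<bullet> h2) + (q \<bullet> h2) * (q' \<bullet> h2))) \<partial>\<mu>)"
      by (intro Bochner_Integration.integral_cong refl) (simp add: distrib_left distrib_right mult_ac add_ac)
    also have "\<dots> = m0 * ((p \<bullet> h1) * (p' \<bullet> h1)) + m2 k * (q \<bullet> q')"
      by (simp add: I integral_\<mu>_linear integral_\<mu>_bilinear[of _ _ k] measure_\<mu>)
    finally show "(\<integral>h2. (p \<bullet> h1 + q \<bullet> h2) * (p' \<bullet> h1 + q' \<bullet> h2) \<partial>\<mu>)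
      = m0 * ((p \<bullet> h1) * (p' \<bullet> h1)) + m2 k * (q \<bullet> q')" .
  qed
  also have "\<dots> = m0 * m2 k * (p \<bullet> p' + q \<bullet> q')"
    by (simp add: I integral_\<mu>_bilinear[of _ _ k] measure_\<mu> distrib_left)
  finally show ?thesis .
qed

lemma hess_form_continuous: "continuous_on UNIV (hess_form f x)"
  unfolding hess_form_def by (intro continuous_intros)

text \<open>Averaging the second derivative over an isotropic jump leaves only its trace.\<close>

lemma integral_\<nu>_hess_form:
  "(\<integral>h. hess_form f x (fst h) + hess_form f' x' (snd h) \<partial>\<nu>) = m0 * m2 k * (laplacian f x + laplacian f' x')"
proof -
  define A where "A = (\<lambda>p p' q q' (h :: (real^'d) \<times> (real^'d)). (p \<bullet> fst h + q \<bullet> snd h) * (p' \<bullet> fst h + q' \<bullet> snd h))"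
  have A: "integrable \<nu> (A p p' q q')" for p p' q q'
    unfolding A_def by (intro integrable_\<nu>_continuous continuous_intros)
  have IA: "(\<integral>h. A p p' q q' h \<partial>\<nu>) = m0 * m2 k * (p \<bullet> p' + q \<bullet> q')" for p p' q q'
    unfolding A_def by (rule integral_\<nu>_bilinear)
  let ?L = "\<lambda>l. A (axis l 1) (grad (partial_deriv l f) x) 0 0"
  let ?R = "\<lambda>l. A 0 0 (axis l 1) (grad (partial_deriv l f') x')"
  have "(\<integral>h. hess_form f x (fst h) + hess_form f' x' (snd h) \<partial>\<nu>) = (\<integral>h. (\<Sum>l\<in>UNIV. ?L l h + ?R l h) \<partial>\<nu>)"
    by (simp add: A_def hess_form_def sum.distrib inner_axis')
  also have "\<dots> = (\<Sum>l\<in>UNIV. \<integral>h. ?L l h + ?R l h \<partial>\<nu>)"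
    by (rule Bochner_Integration.integral_sum) (intro Bochner_Integration.integrable_add A)
  also have "\<dots> = (\<Sum>l\<in>UNIV. (\<integral>h. ?L l h \<partial>\<nu>) + (\<integral>h. ?R l h \<partial>\<nu>))"
    by (intro sum.cong refl Bochner_Integration.integral_add A)
  also have "\<dots> = m0 * m2 k * (laplacian f x + laplacian f' x')"
    by (simp add: IA laplacian_def grad_def inner_axis' sum.distrib sum_distrib_left distrib_left)
  finally show ?thesis .
qed

end

section \<open>Second order expansion of cylinder functions under a jump of two points\<close>

text \<open>A cylinder function sees a configuration only through the vector \<open>v\<close> of its pairings with the test
  functions. The expansion can therefore be carried out in terms of \<open>v\<close> and of the positions of the two
  points that jump, without reference to the rest of the configuration.\<close>

locale cylinder_function =
  fixes \<phi> :: "'n::finite \<Rightarrow> real^'d::finite \<Rightarrow> real" and g :: "real^'n \<Rightarrow> real"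
  assumes \<phi>: "\<And>i. \<phi> i \<in> C0_infinity" and g: "g \<in> Cb_infinity"
begin

lemma \<phi>_smooth: "smooth (\<phi> i)" using \<phi> by (auto simp: C0_infinity_def)

lemma g_smooth: "smooth g" using g by (auto simp: Cb_infinity_def)

text \<open>The vector of pairings after two points have jumped from \<open>x1\<close> and \<open>x2\<close> by \<open>k1\<close> and \<open>k2\<close>.\<close>

definition moved :: "real^'n \<Rightarrow> real^'d \<Rightarrow> real^'d \<Rightarrow> real^'d \<Rightarrow> real^'d \<Rightarrow> real^'n" where
  "moved v x1 x2 k1 k2 = (\<chi> i. v $ i - \<phi> i x1 - \<phi> i x2 + \<phi> i (x1 + k1) + \<phi> i (x2 + k2))"

abbreviation increment :: "real^'n \<Rightarrow> real^'d \<Rightarrow> real^'d \<Rightarrow> real \<Rightarrow> real^'d \<Rightarrow> real^'d \<Rightarrow> real" where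
  "increment v x1 x2 t h1 h2 \<equiv> g (moved v x1 x2 (t *\<^sub>R h1) (t *\<^sub>R h2)) - g v"

text \<open>At \<open>v\<close> equal to the pairings of a configuration this is the gradient, and \<open>cyl_lap\<close> the Laplacian, in
  one of its points (\<open>grad_laplacian_point\<close>).\<close>

definition cyl_grad :: "real^'n \<Rightarrow> real^'d \<Rightarrow> real^'d" where
  "cyl_grad v x = (\<Sum>i\<in>UNIV. partial_deriv i g v *\<^sub>R grad (\<phi> i) x)"

abbreviation cyl_lin :: "real^'n \<Rightarrow> real^'d \<Rightarrow> real^'d \<Rightarrow> real^'d \<Rightarrow> real^'d \<Rightarrow> real" where
  "cyl_lin v x1 x2 h1 h2 \<equiv> cyl_grad v x1 \<bullet> h1 + cyl_grad v x2 \<bullet> h2"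

definition cyl_lap :: "real^'n \<Rightarrow> real^'d \<Rightarrow> real" where
  "cyl_lap v x = (\<Sum>i\<in>UNIV. (\<Sum>j\<in>UNIV. partial_deriv j (partial_deriv i g) v * (grad (\<phi> j) x \<bullet> grad (\<phi> i) x))
     + partial_deriv i g v * laplacian (\<phi> i) x)"

definition cyl_hess :: "real^'n \<Rightarrow> real^'d \<Rightarrow> real^'d \<Rightarrow> real^'d \<Rightarrow> real^'d \<Rightarrow> real" where
  "cyl_hess v x1 x2 h1 h2 = (\<Sum>i\<in>UNIV.
     (\<Sum>j\<in>UNIV. partial_deriv j (partial_deriv i g) v *
        ((grad (\<phi> j) x1 \<bullet> h1 + grad (\<phi> j) x2 \<bullet> h2) * (grad (\<phi> i) x1 \<bullet> h1 + grad (\<phi> i) x2 \<bullet> h2)))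
     + partial_deriv i g v * (hess_form (\<phi> i) x1 h1 + hess_form (\<phi> i) x2 h2))"

text \<open>Along the line \<open>t \<mapsto> (t h1, t h2)\<close> the first and second derivatives are, at every \<open>t\<close>, of
  the same form as at \<open>0\<close>, with the base points moved along.\<close>

lemma has_derivative_moved:
  fixes v :: "real^'n" and x1 x2 h1 h2 :: "real^'d"
  defines "s \<equiv> \<lambda>t. moved v x1 x2 (t *\<^sub>R h1) (t *\<^sub>R h2)"
  shows "((\<lambda>t. g (s t)) has_real_derivative
      (cyl_lin (s t) (x1 + t *\<^sub>R h1) (x2 + t *\<^sub>R h2) h1 h2)) (at t)"
    and "((\<lambda>t. cyl_lin (s t) (x1 + t *\<^sub>R h1) (x2 + t *\<^sub>R h2) h1 h2) has_real_derivative
      cyl_hess (s t) (x1 + t *\<^sub>R h1) (x2 + t *\<^sub>R h2) h1 h2) (at t)"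
proof -
  let ?p = "\<lambda>t i. grad (\<phi> i) (x1 + t *\<^sub>R h1) \<bullet> h1 + grad (\<phi> i) (x2 + t *\<^sub>R h2) \<bullet> h2"
  have s: "((\<lambda>t. s t $ i) has_real_derivative ?p t i) (at t)" for i t
    unfolding s_def moved_def
    using has_real_derivative_along_line[OF smooth_differentiable[OF \<phi>_smooth]]
    by (auto intro!: derivative_eq_intros)
  have lin: "(\<Sum>i\<in>UNIV. partial_deriv i g (s t) * ?p t i) =
      cyl_lin (s t) (x1 + t *\<^sub>R h1) (x2 + t *\<^sub>R h2) h1 h2" for t
    by (simp add: cyl_grad_def inner_sum_left distrib_left sum.distrib)
  show "((\<lambda>t. g (s t)) has_real_derivative
      (cyl_lin (s t) (x1 + t *\<^sub>R h1) (x2 + t *\<^sub>R h2) h1 h2)) (at t)"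
    unfolding lin[symmetric]
    by (rule has_real_derivative_along_path[OF smooth_differentiable[OF g_smooth] s])
  have "((\<lambda>t. \<Sum>i\<in>UNIV. partial_deriv i g (s t) * ?p t i) has_real_derivative
     (\<Sum>i\<in>UNIV. (\<Sum>j\<in>UNIV. partial_deriv j (partial_deriv i g) (s t) * ?p t j) * ?p t i
       + (hess_form (\<phi> i) (x1 + t *\<^sub>R h1) h1 + hess_form (\<phi> i) (x2 + t *\<^sub>R h2) h2) * partial_deriv i g (s t))) (at t)"
  proof (rule DERIV_sum, rule DERIV_mult)
    fix i
    show "((\<lambda>t. partial_deriv i g (s t)) has_real_derivative
        (\<Sum>j\<in>UNIV. partial_deriv j (partial_deriv i g) (s t) * ?p t j)) (at t)"
      by (rule has_real_derivative_along_path[OF smooth_differentiable[OF smooth_partial_deriv[OF g_smooth]] s])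
    show "((\<lambda>t. ?p t i) has_real_derivative
        (hess_form (\<phi> i) (x1 + t *\<^sub>R h1) h1 + hess_form (\<phi> i) (x2 + t *\<^sub>R h2) h2)) (at t)"
      by (intro DERIV_add has_real_derivative_grad_line \<phi>_smooth)
  qed
  then show "((\<lambda>t. cyl_lin (s t) (x1 + t *\<^sub>R h1) (x2 + t *\<^sub>R h2) h1 h2) has_real_derivative
      cyl_hess (s t) (x1 + t *\<^sub>R h1) (x2 + t *\<^sub>R h2) h1 h2) (at t)"
    unfolding lin by (simp add: cyl_hess_def sum_distrib_left mult_ac)
qed

lemma moved_0: "moved v x1 x2 0 0 = v"
  by (simp add: moved_def vec_eq_iff)

lemma moved_commute: "moved v x1 x2 k1 k2 = moved v x2 x1 k2 k1"
  by (simp add: moved_def vec_eq_iff)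

text \<open>A sum of two indicators rather than the indicator of a union: pair sums then split into two sums,
  in each of which one of the points is confined to the ball.\<close>

definition near :: "real \<Rightarrow> real^'d \<Rightarrow> real^'d \<Rightarrow> real" where
  "near R x y = indicator (cball 0 R) x + indicator (cball 0 R) y"

lemma near_nonneg: "near R x y \<ge> 0" by (simp add: near_def)

text \<open>The derivatives vanish unless one of the two points is near the supports of the test
  functions; this localisation is what makes the sums over an infinite configuration converge.\<close>

lemma derivative_bounds:
  assumes r: "r \<ge> 0" and e: "e \<ge> 0"
  shows "\<exists>K\<ge>0. \<exists>R\<ge>0. \<forall>v x1 x2 h1 h2 t. norm h1 \<le> r \<longrightarrow> norm h2 \<le> r \<longrightarrow> 0 \<le> t \<longrightarrow> t \<le> e \<longrightarrow>
     \<bar>cyl_lin v (x1 + t *\<^sub>R h1) (x2 + t *\<^sub>R h2) h1 h2\<bar> \<le> K * near R x1 x2 \<and>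
     \<bar>cyl_hess v (x1 + t *\<^sub>R h1) (x2 + t *\<^sub>R h2) h1 h2\<bar> \<le> K * near R x1 x2"
proof -
  obtain A \<rho> where A: "A \<ge> 0" "\<rho> \<ge> 0" and A':
    "\<And>i x h. \<bar>\<phi> i x\<bar> \<le> A \<and> norm (grad (\<phi> i) x) \<le> A \<and> \<bar>hess_form (\<phi> i) x h\<bar> \<le> A * (norm h)\<^sup>2 \<and>
      (norm x > \<rho> \<longrightarrow> \<phi> i x = 0 \<and> grad (\<phi> i) x = 0 \<and> hess_form (\<phi> i) x h = 0)"
    using test_functions_bounds[of \<phi>] \<phi> by blast
  obtain C where C: "C \<ge> 0" and C':
    "\<And>v i j. \<bar>g v\<bar> \<le> C \<and> \<bar>partial_deriv i g v\<bar> \<le> C \<and> \<bar>partial_deriv j (partial_deriv i g) v\<bar> \<le> C"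
    using Cb_infinity_bounds[OF g] by blast
  define R where "R = \<rho> + e * r"
  define n where "n = real CARD('n)"
  have R: "R \<ge> 0" using A r e by (simp add: R_def)
  define K where "K = n * (C * (A * r)) + n * (n * (C * ((A * r) * (A * r) * 2)) + C * (A * r\<^sup>2))"
  have K: "n * (C * (A * r)) \<le> K" "n * (n * (C * ((A * r) * (A * r) * 2)) + C * (A * r\<^sup>2)) \<le> K" "K \<ge> 0"
    using A C r by (auto simp: K_def n_def)
  have main: "\<bar>cyl_lin v (x1 + t *\<^sub>R h1) (x2 + t *\<^sub>R h2) h1 h2\<bar> \<le> K * near R x1 x2 \<and>
     \<bar>cyl_hess v (x1 + t *\<^sub>R h1) (x2 + t *\<^sub>R h2) h1 h2\<bar> \<le> K * near R x1 x2"
    if h: "norm h1 \<le> r" "norm h2 \<le> r" and t: "0 \<le> t" "t \<le> e" for v x1 x2 h1 h2 t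
  proof -
    let ?\<chi> = "near R x1 x2"
    have out: "norm (x + t *\<^sub>R h) > \<rho>" if "x \<notin> cball 0 R" "norm h \<le> r" for x h :: "real^'d"
    proof -
      have "norm (t *\<^sub>R h) \<le> e * r" using t that r by (simp add: mult_mono)
      moreover have "norm x \<le> norm (x + t *\<^sub>R h) + norm (t *\<^sub>R h)"
        using norm_triangle_ineq4[of "x + t *\<^sub>R h" "t *\<^sub>R h"] by simp
      moreover have "norm x > R" using that by simp
      ultimately show ?thesis by (simp add: R_def)
    qed
    have g1: "\<bar>grad (\<phi> i) (x + t *\<^sub>R h) \<bullet> h\<bar> \<le> A * r * indicator (cball 0 R) x" if "norm h \<le> r" for i x h
    proof (cases "x \<in> cball 0 R")
      case True
      have "\<bar>grad (\<phi> i) (x + t *\<^sub>R h) \<bullet> h\<bar> \<le> norm (grad (\<phi> i) (x + t *\<^sub>R h)) * norm h"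
        by (rule Cauchy_Schwarz_ineq2)
      also have "\<dots> \<le> A * r" using A' that A by (intro mult_mono) auto
      finally show ?thesis using True by simp
    next
      case False
      then show ?thesis using A'[of i "x + t *\<^sub>R h"] out[OF False that] by simp
    qed
    have h1': "\<bar>hess_form (\<phi> i) (x + t *\<^sub>R h) h\<bar> \<le> A * r\<^sup>2 * indicator (cball 0 R) x" if "norm h \<le> r" for i x h
    proof (cases "x \<in> cball 0 R")
      case True
      have "\<bar>hess_form (\<phi> i) (x + t *\<^sub>R h) h\<bar> \<le> A * (norm h)\<^sup>2" using A' by blast
      also have "\<dots> \<le> A * r\<^sup>2" using that A by (intro mult_left_mono power_mono) auto
      finally show ?thesis using True by simp
    next
      case False
      then show ?thesis using A'[of i "x + t *\<^sub>R h" h] out[OF False that] by simp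
    qed
    let ?p = "\<lambda>i. grad (\<phi> i) (x1 + t *\<^sub>R h1) \<bullet> h1 + grad (\<phi> i) (x2 + t *\<^sub>R h2) \<bullet> h2"
    let ?q = "\<lambda>i. hess_form (\<phi> i) (x1 + t *\<^sub>R h1) h1 + hess_form (\<phi> i) (x2 + t *\<^sub>R h2) h2"
    have p: "\<bar>?p i\<bar> \<le> A * r * ?\<chi>" for i
      using g1[OF h(1), of i x1] g1[OF h(2), of i x2] by (simp add: near_def distrib_left)
    have q: "\<bar>?q i\<bar> \<le> A * r\<^sup>2 * ?\<chi>" for i
      using h1'[OF h(1), of i x1] h1'[OF h(2), of i x2] by (simp add: near_def distrib_left)
    have \<chi>2: "?\<chi> * ?\<chi> \<le> 2 * ?\<chi>" by (auto simp: near_def indicator_def)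
    have "\<bar>cyl_lin v (x1 + t *\<^sub>R h1) (x2 + t *\<^sub>R h2) h1 h2\<bar>
       = \<bar>\<Sum>i\<in>UNIV. partial_deriv i g v * ?p i\<bar>"
      by (simp add: cyl_grad_def inner_sum_left distrib_left sum.distrib)
    also have "\<dots> \<le> (\<Sum>i\<in>(UNIV::'n set). C * (A * r * ?\<chi>))"
    proof (rule order_trans[OF sum_abs sum_mono])
      fix i show "\<bar>partial_deriv i g v * ?p i\<bar> \<le> C * (A * r * ?\<chi>)"
        unfolding abs_mult using C' p C by (intro mult_mono) auto
    qed
    also have "\<dots> = n * (C * (A * r)) * ?\<chi>" by (simp add: n_def mult_ac)
    also have "\<dots> \<le> K * ?\<chi>" by (intro mult_right_mono K near_nonneg)
    finally have 1: "\<bar>cyl_lin v (x1 + t *\<^sub>R h1) (x2 + t *\<^sub>R h2) h1 h2\<bar> \<le> K * ?\<chi>" .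
    have pp: "\<bar>?p j * ?p i\<bar> \<le> (A * r) * (A * r) * 2 * ?\<chi>" for i j
    proof -
      have "\<bar>?p j * ?p i\<bar> \<le> (A * r * ?\<chi>) * (A * r * ?\<chi>)"
        unfolding abs_mult using p near_nonneg A r by (intro mult_mono) auto
      also have "\<dots> = (A * r) * (A * r) * (?\<chi> * ?\<chi>)" by simp
      also have "\<dots> \<le> (A * r) * (A * r) * (2 * ?\<chi>)" using \<chi>2 A r by (intro mult_left_mono) auto
      finally show ?thesis by simp
    qed
    have "\<bar>cyl_hess v (x1 + t *\<^sub>R h1) (x2 + t *\<^sub>R h2) h1 h2\<bar>
       \<le> (\<Sum>i\<in>(UNIV::'n set). (\<Sum>j\<in>(UNIV::'n set). C * ((A * r) * (A * r) * 2 * ?\<chi>)) + C * (A * r\<^sup>2 * ?\<chi>))"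
      unfolding cyl_hess_def
    proof (rule order_trans[OF sum_abs sum_mono])
      fix i
      show "\<bar>(\<Sum>j\<in>UNIV. partial_deriv j (partial_deriv i g) v * (?p j * ?p i)) + partial_deriv i g v * ?q i\<bar>
         \<le> (\<Sum>j\<in>(UNIV::'n set). C * ((A * r) * (A * r) * 2 * ?\<chi>)) + C * (A * r\<^sup>2 * ?\<chi>)"
      proof (rule order_trans[OF abs_triangle_ineq add_mono])
        show "\<bar>\<Sum>j\<in>UNIV. partial_deriv j (partial_deriv i g) v * (?p j * ?p i)\<bar>
           \<le> (\<Sum>j\<in>(UNIV::'n set). C * ((A * r) * (A * r) * 2 * ?\<chi>))"
        proof (rule order_trans[OF sum_abs sum_mono])
          fix j
          show "\<bar>partial_deriv j (partial_deriv i g) v * (?p j * ?p i)\<bar> \<le> C * ((A * r) * (A * r) * 2 * ?\<chi>)"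
            unfolding abs_mult[of "partial_deriv j (partial_deriv i g) v"]
            using C' pp[of j i] C by (intro mult_mono) auto
        qed
        show "\<bar>partial_deriv i g v * ?q i\<bar> \<le> C * (A * r\<^sup>2 * ?\<chi>)"
          unfolding abs_mult using C' q[of i] C by (intro mult_mono) auto
      qed
    qed
    also have "\<dots> = n * (n * (C * ((A * r) * (A * r) * 2)) + C * (A * r\<^sup>2)) * ?\<chi>"
      by (simp add: n_def algebra_simps)
    also have "\<dots> \<le> K * ?\<chi>" by (intro mult_right_mono K near_nonneg)
    finally show ?thesis using 1 by blast
  qed
  show ?thesis using K(3) R main by blast
qed

lemma increment_bounds:
  assumes r: "r \<ge> 0" and e: "e \<ge> 0"
  shows "\<exists>K\<ge>0. \<exists>R\<ge>0. \<forall>v x1 x2 h1 h2 t. norm h1 \<le> r \<longrightarrow> norm h2 \<le> r \<longrightarrow> 0 < t \<longrightarrow> t \<le> e \<longrightarrow>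
     \<bar>increment v x1 x2 t h1 h2\<bar> \<le> K * near R x1 x2 * t \<and>
     \<bar>increment v x1 x2 t h1 h2 - t * (cyl_lin v x1 x2 h1 h2)\<bar>
        \<le> K * near R x1 x2 * t\<^sup>2"
proof -
  obtain K R where K: "K \<ge> 0" "R \<ge> 0" and D: "\<And>v x1 x2 h1 h2 t. norm h1 \<le> r \<Longrightarrow> norm h2 \<le> r \<Longrightarrow> 0 \<le> t \<Longrightarrow> t \<le> e \<Longrightarrow>
     \<bar>cyl_lin v (x1 + t *\<^sub>R h1) (x2 + t *\<^sub>R h2) h1 h2\<bar> \<le> K * near R x1 x2 \<and>
     \<bar>cyl_hess v (x1 + t *\<^sub>R h1) (x2 + t *\<^sub>R h2) h1 h2\<bar> \<le> K * near R x1 x2"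
    using derivative_bounds[OF r e] by blast
  have "\<bar>increment v x1 x2 t h1 h2\<bar> \<le> K * near R x1 x2 * t \<and>
     \<bar>increment v x1 x2 t h1 h2 - t * (cyl_lin v x1 x2 h1 h2)\<bar>
        \<le> K * near R x1 x2 * t\<^sup>2"
    if h: "norm h1 \<le> r" "norm h2 \<le> r" and t: "0 < t" "t \<le> e" for v x1 x2 h1 h2 t
  proof -
    note d = has_derivative_moved[of v x1 x2 h1 h2]
    show ?thesis
      using first_order_remainder_bound[OF d(1), of t "K * near R x1 x2"]
        second_order_remainder_bound[OF d(1) d(2), of t "K * near R x1 x2"] D h t
      by (simp add: moved_0)
  qed
  then show ?thesis using K by blast
qed

lemma increment_limits:
  "((\<lambda>t. (increment v x1 x2 t h1 h2) / t) \<longlongrightarrow> cyl_lin v x1 x2 h1 h2) (at_right 0)"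
  "((\<lambda>t. (increment v x1 x2 t h1 h2 - t * (cyl_lin v x1 x2 h1 h2)) / t\<^sup>2)
      \<longlongrightarrow> cyl_hess v x1 x2 h1 h2 / 2) (at_right 0)"
proof -
  note d = has_derivative_moved[of v x1 x2 h1 h2]
  show "((\<lambda>t. (increment v x1 x2 t h1 h2) / t) \<longlongrightarrow> cyl_lin v x1 x2 h1 h2) (at_right 0)"
    using first_order_limit[OF d(1)[of 0]] by (simp add: moved_0)
  show "((\<lambda>t. (increment v x1 x2 t h1 h2 - t * (cyl_lin v x1 x2 h1 h2)) / t\<^sup>2)
      \<longlongrightarrow> cyl_hess v x1 x2 h1 h2 / 2) (at_right 0)"
    using second_order_limit[OF d(1) d(2)[of 0]] by (simp add: moved_0)
qed

lemma hess_form_axis: "hess_form f x (axis k 1) = partial_deriv k (partial_deriv k f) x"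
proof -
  have "hess_form f x (axis k 1) = (\<Sum>l\<in>UNIV. if l = k then partial_deriv k (partial_deriv l f) x else 0)"
    unfolding hess_form_def inner_axis by (intro sum.cong refl) (simp add: grad_def axis_def)
  then show ?thesis by simp
qed

text \<open>Gradient and Laplacian are recovered from the derivatives along jumps of a single point: the
  gradient by jumping in its own direction, the Laplacian as a trace.\<close>

lemma cyl_lap_grad_bound: "\<exists>K\<ge>0. \<exists>R\<ge>0. \<forall>v x. \<bar>cyl_lap v x\<bar> \<le> K * indicator (cball 0 R) x \<and>
    norm (cyl_grad v x) \<le> K * indicator (cball 0 R) x"
proof -
  obtain K R where K: "K \<ge> 0" "R \<ge> 0" and D: "\<And>v x1 x2 h1 h2 t. norm h1 \<le> 1 \<Longrightarrow> norm h2 \<le> 1 \<Longrightarrow> 0 \<le> t \<Longrightarrow> t \<le> 0 \<Longrightarrow>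
     \<bar>cyl_lin v (x1 + t *\<^sub>R h1) (x2 + t *\<^sub>R h2) h1 h2\<bar> \<le> K * near R x1 x2 \<and>
     \<bar>cyl_hess v (x1 + t *\<^sub>R h1) (x2 + t *\<^sub>R h2) h1 h2\<bar> \<le> K * near R x1 x2"
    using derivative_bounds[OF zero_le_one order_refl] by blast
  \<comment> \<open>Put the second point far away and leave it at rest, so that only the first one contributes.\<close>
  obtain y :: "real^'d" where y: "norm y = R + 1" using vector_choose_size[of "R + 1"] K by auto
  have near_y: "near R x y = indicator (cball 0 R) x" for x using y by (simp add: near_def)
  have G: "\<bar>cyl_grad v x \<bullet> h\<bar> \<le> K * indicator (cball 0 R) x"
    and H: "\<bar>cyl_hess v x y h 0\<bar> \<le> K * indicator (cball 0 R) x" if "norm h \<le> 1" for v x h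
    using D[of h 0 0 v x y] that by (simp_all add: near_y)
  define n where "n = real CARD('d)"
  have n: "n \<ge> 1" by (simp add: n_def Suc_leI)
  have Kn: "K * indicator (cball 0 R) x \<le> n * K * indicator (cball 0 R) x" for x :: "real^'d"
    using K n mult_right_mono[OF n K(1)] by (intro mult_right_mono) auto
  have "norm (cyl_grad v x) \<le> K * indicator (cball 0 R) x" for v x
  proof (cases "cyl_grad v x = 0")
    case False
    then show ?thesis
      using G[of "cyl_grad v x /\<^sub>R norm (cyl_grad v x)" v x] by (simp add: dot_square_norm power2_eq_square mult.assoc[symmetric])
  qed (use K in simp)
  then have grad: "norm (cyl_grad v x) \<le> n * K * indicator (cball 0 R) x" for v x by (rule order_trans[OF _ Kn])
  have lap: "cyl_lap v x = (\<Sum>k\<in>UNIV. cyl_hess v x y (axis k 1) 0)" for v x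
  proof -
    let ?G = "\<lambda>i j. partial_deriv j (partial_deriv i g) v"
    have "(\<Sum>k\<in>UNIV. cyl_hess v x y (axis k 1) 0) =
      (\<Sum>i\<in>UNIV. \<Sum>k\<in>UNIV. (\<Sum>j\<in>UNIV. ?G i j * (grad (\<phi> j) x $ k * grad (\<phi> i) x $ k))
        + partial_deriv i g v * partial_deriv k (partial_deriv k (\<phi> i)) x)"
      unfolding cyl_hess_def
      by (subst sum.swap) (simp add: hess_form_axis inner_axis hess_form_def[of _ _ 0])
    also have "\<dots> = cyl_lap v x"
      unfolding cyl_lap_def sum.distrib inner_vec_def sum_distrib_left laplacian_def inner_real_def
      by (subst (2) sum.swap) simp
    finally show ?thesis ..
  qed
  have "\<bar>cyl_lap v x\<bar> \<le> n * K * indicator (cball 0 R) x" for v x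
  proof -
    have "\<bar>cyl_lap v x\<bar> \<le> (\<Sum>k\<in>(UNIV::'d set). K * indicator (cball 0 R) x)"
      unfolding lap by (rule order_trans[OF sum_abs sum_mono]) (rule H, simp)
    then show ?thesis by (simp add: n_def)
  qed
  moreover have "n * K \<ge> 0" using K n by simp
  ultimately show ?thesis using grad K(2) by blast
qed

end

section \<open>The potential and local suprema of its gradient\<close>

text \<open>Domination is only available for small positive \<open>\<epsilon>\<close>.\<close>

lemma dominated_convergence_at_right:
  fixes s :: "real \<Rightarrow> 'a \<Rightarrow> real" and w :: "'a \<Rightarrow> real"
  assumes f: "f \<in> borel_measurable M" and s: "\<And>\<epsilon>. \<epsilon> > 0 \<Longrightarrow> s \<epsilon> \<in> borel_measurable M"
    and w: "integrable M w" and e: "e > 0"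
    and lim: "AE x in M. ((\<lambda>\<epsilon>. s \<epsilon> x) \<longlongrightarrow> f x) (at_right 0)"
    and bound: "\<And>\<epsilon>. 0 < \<epsilon> \<Longrightarrow> \<epsilon> \<le> e \<Longrightarrow> AE x in M. \<bar>s \<epsilon> x\<bar> \<le> w x"
  shows "((\<lambda>\<epsilon>. \<integral>x. s \<epsilon> x \<partial>M) \<longlongrightarrow> (\<integral>x. f x \<partial>M)) (at_right 0)"
proof -
  have at: "at_right 0 = at 0 within {0<..e}"
    by (rule at_within_nhd[of _ "{-1<..<e}"]) (use e in auto)
  show ?thesis
    unfolding at tendsto_at_iff_sequentially o_def
  proof (intro allI impI)
    fix X assume X: "\<forall>i. X i \<in> {0<..e} - {0}" "X \<longlonglongrightarrow> 0"
    show "(\<lambda>i. \<integral>x. s (X i) x \<partial>M) \<longlonglongrightarrow> (\<integral>x. f x \<partial>M)"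
    proof (rule integral_dominated_convergence[OF f _ w])
      show "s (X i) \<in> borel_measurable M" for i using X(1) by (intro s) auto
      show "AE x in M. norm (s (X i) x) \<le> w x" for i using bound[of "X i"] X(1) by auto
      show "AE x in M. (\<lambda>i. s (X i) x) \<longlonglongrightarrow> f x"
        using lim by eventually_elim (use X in \<open>auto simp: at tendsto_at_iff_sequentially o_def\<close>)
    qed
  qed
qed

locale rate_function =
  fixes b :: "real^'d::finite \<Rightarrow> real"
  assumes b_nonneg: "\<And>x. b x \<ge> 0" and b_even: "\<And>x. b (- x) = b x"
    and b_C1: "Ck 1 b" and b_grad_bounded: "bounded (range (grad b))"
begin

lemma b_differentiable: "b differentiable_on UNIV" using b_C1 by simp

lemma b_continuous: "continuous_on UNIV b"
  by (rule differentiable_imp_continuous_on[OF b_differentiable])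

lemma grad_b_continuous: "continuous_on UNIV (grad b)" by (rule Ck_1_grad_continuous[OF b_C1])

lemma b_measurable [measurable]: "b \<in> borel_measurable borel"
  by (rule borel_measurable_continuous_onI[OF b_continuous])

lemma grad_b_measurable [measurable]: "grad b \<in> borel_measurable borel"
  by (rule borel_measurable_continuous_onI[OF grad_b_continuous])

lemma grad_b_odd: "grad b (- x) = - grad b x"
proof -
  have "((\<lambda>y. b (- y)) has_derivative (\<lambda>h. grad b (- x) \<bullet> (- h))) (at x)"
    by (rule has_derivative_compose[OF _ has_derivative_grad[OF b_differentiable]])
      (auto intro!: derivative_eq_intros)
  moreover have "(\<lambda>y. b (- y)) = b" by (simp add: b_even fun_eq_iff)
  ultimately have "(b has_derivative (\<lambda>h. - grad b (- x) \<bullet> h)) (at x)" by simp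
  from has_derivative_unique[OF this has_derivative_grad[OF b_differentiable]]
  have "- grad b (- x) \<bullet> h = grad b x \<bullet> h" for h by (rule fun_cong)
  then have "- grad b (- x) = grad b x" using vector_eq_rdot[of "- grad b (- x)" "grad b x"] by blast
  then show ?thesis by (simp add: minus_equation_iff)
qed

definition gsup :: "real \<Rightarrow> real^'d \<Rightarrow> real" where
  "gsup \<delta> x = (SUP y\<in>cball x \<delta>. norm (grad b y))"

lemma gsup_bdd: "bdd_above ((\<lambda>y. norm (grad b y)) ` S)"
proof -
  obtain G where "\<And>y. norm (grad b y) \<le> G" using b_grad_bounded by (auto simp: bounded_iff)
  then show ?thesis by (intro bdd_aboveI2)
qed

lemma gsup_upper: "norm (y - x) \<le> \<delta> \<Longrightarrow> norm (grad b y) \<le> gsup \<delta> x"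
  unfolding gsup_def by (rule cSUP_upper[OF _ gsup_bdd]) (simp add: dist_norm norm_minus_commute)

lemma gsup_nonneg: "\<delta> \<ge> 0 \<Longrightarrow> gsup \<delta> x \<ge> 0"
  using order_trans[OF norm_ge_zero gsup_upper[of x x \<delta>]] by simp

lemma gsup_mono:
  assumes "norm (x - u) + \<delta> \<le> \<delta>'" "\<delta> \<ge> 0" shows "gsup \<delta> x \<le> gsup \<delta>' u"
  unfolding gsup_def[of \<delta>]
proof (rule cSUP_least)
  fix y assume "y \<in> cball x \<delta>"
  then have "norm (y - u) \<le> \<delta>'"
    using assms norm_triangle_ineq[of "y - x" "x - u"] by (simp add: dist_norm norm_minus_commute)
  then show "norm (grad b y) \<le> gsup \<delta>' u" by (rule gsup_upper)
qed (use assms in auto)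

lemma gsup_even: assumes "\<delta> \<ge> 0" shows "gsup \<delta> (- x) = gsup \<delta> x"
proof -
  have "gsup \<delta> (- x) \<le> gsup \<delta> x" for x
    unfolding gsup_def[of \<delta> "- x"]
  proof (rule cSUP_least)
    fix y assume "y \<in> cball (- x) \<delta>"
    then have "norm (- y - x) \<le> \<delta>" by (simp add: dist_norm norm_minus_commute add.commute)
    then show "norm (grad b y) \<le> gsup \<delta> x" using gsup_upper[of "- y" x \<delta>] by (simp add: grad_b_odd)
  qed (use assms in auto)
  from this[of x] this[of "- x"] show ?thesis by simp
qed

lemma gsup_measurable [measurable]: "gsup \<delta> \<in> borel_measurable borel"
proof (cases "\<delta> \<ge> 0")
  case True
  have "{x. c < gsup \<delta> x} = (\<Union>k\<in>cball 0 \<delta>. {x. c < norm (grad b (x + k))})" for c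
  proof (safe)
    fix x assume "c < gsup \<delta> x"
    then obtain y where y: "y \<in> cball x \<delta>" "c < norm (grad b y)"
      unfolding gsup_def by (subst (asm) less_cSUP_iff) (use True gsup_bdd in auto)
    then show "x \<in> (\<Union>k\<in>cball 0 \<delta>. {x. c < norm (grad b (x + k))})"
      by (intro UN_I[of "y - x"]) (auto simp: dist_norm norm_minus_commute)
  next
    fix x k assume k: "k \<in> cball 0 \<delta>" "c < norm (grad b (x + k))"
    then show "c < gsup \<delta> x" using gsup_upper[of "x + k" x \<delta>] by auto
  qed
  moreover have "open (\<Union>k\<in>cball 0 \<delta>. {x. c < norm (grad b (x + k))})" for c
    by (intro open_UN ballI open_Collect_less continuous_intros continuous_on_compose2[OF grad_b_continuous]) auto
  ultimately show ?thesis
    unfolding borel_measurable_iff_greater by simp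
next
  case False
  then have "cball x \<delta> = {}" for x :: "real^'d" by simp
  then show ?thesis unfolding gsup_def by simp
qed

lemma b_increment:
  assumes "norm k \<le> \<delta>" shows "\<bar>b (x + k) - b x\<bar> \<le> norm k * gsup \<delta> x"
proof -
  have "\<bar>b (x + 1 *\<^sub>R k) - b (x + 0 *\<^sub>R k)\<bar> \<le> (norm k * gsup \<delta> x) * 1"
  proof (rule first_order_remainder_bound[OF has_real_derivative_along_line[OF b_differentiable]])
    fix s :: real assume s: "0 \<le> s" "s \<le> 1"
    have "norm (s *\<^sub>R k) \<le> 1 * norm k" using s mult_right_mono[OF s(2), of "norm k"] by simp
    then have "norm (grad b (x + s *\<^sub>R k)) \<le> gsup \<delta> x" using assms by (intro gsup_upper) simp
    then show "\<bar>grad b (x + s *\<^sub>R k) \<bullet> k\<bar> \<le> norm k * gsup \<delta> x"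
      using Cauchy_Schwarz_ineq2[of "grad b (x + s *\<^sub>R k)" k]
      by (smt (verit, best) mult.commute mult_left_mono norm_ge_zero)
  qed simp
  then show ?thesis by simp
qed

lemma b_difference_quotient: "((\<lambda>t. (b (x + t *\<^sub>R k) - b x) / t) \<longlongrightarrow> grad b x \<bullet> k) (at_right 0)"
  using first_order_limit[of "\<lambda>t. b (x + t *\<^sub>R k)" "grad b x \<bullet> k"]
    has_real_derivative_along_line[OF b_differentiable, of x k 0] by simp

lemma integral_gsup_finite:
  assumes R: "R > 0" and int: "(\<integral>\<^sup>+x. (SUP y\<in>cball x R. ennreal (norm (grad b y))) \<partial>lborel) < \<infinity>"
  shows "(\<integral>\<^sup>+x. ennreal (gsup R x) \<partial>lborel) < \<infinity>"
proof -
  have "ennreal (gsup R x) \<le> (SUP y\<in>cball x R. ennreal (norm (grad b y)))" for x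
  proof (rule dense_le)
    fix c assume c: "c < ennreal (gsup R x)"
    then obtain c' where c': "c = ennreal c'" "c' \<ge> 0" "c' < gsup R x"
      by (cases c) (auto simp: ennreal_less_iff)
    then obtain y where "y \<in> cball x R" "c' < norm (grad b y)"
      unfolding gsup_def by (subst (asm) less_cSUP_iff) (use R gsup_bdd in auto)
    then show "c \<le> (SUP y\<in>cball x R. ennreal (norm (grad b y)))"
      unfolding c' by (intro SUP_upper2[of y] ennreal_leI) auto
  qed
  then have "(\<integral>\<^sup>+x. ennreal (gsup R x) \<partial>lborel) \<le> (\<integral>\<^sup>+x. (SUP y\<in>cball x R. ennreal (norm (grad b y))) \<partial>lborel)"
    by (intro nn_integral_mono)
  then show ?thesis using int by (rule order.strict_trans1)
qed

text \<open>Controls the potential together with its increments over distances up to \<open>\<delta>\<close>.\<close>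

definition weight :: "real \<Rightarrow> real^'d \<Rightarrow> real" where
  "weight \<delta> x = b x + gsup \<delta> x"

lemma weight_nonneg: "\<delta> \<ge> 0 \<Longrightarrow> weight \<delta> x \<ge> 0" by (simp add: weight_def b_nonneg gsup_nonneg)

lemma weight_even: "\<delta> \<ge> 0 \<Longrightarrow> weight \<delta> (- x) = weight \<delta> x" by (simp add: weight_def b_even gsup_even)

lemma weight_measurable [measurable]: "weight \<delta> \<in> borel_measurable borel"
  unfolding weight_def by measurable

text \<open>Values at nearby points are comparable after doubling the radius. This is what the averaging in
  \<open>pair_sum_square_integrable\<close> asks for, and the reason for assuming integrability of a local supremum
  of the gradient and not of the gradient alone.\<close>

lemma weight_shift_le:
  assumes "\<delta> \<ge> 0" "norm (x - u) \<le> \<delta>"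
  shows "weight \<delta> x \<le> (1 + \<delta>) * weight (2 * \<delta>) u"
proof -
  have "\<bar>b (u + (x - u)) - b u\<bar> \<le> norm (x - u) * gsup (2 * \<delta>) u"
    using assms by (intro b_increment) auto
  then have "b x \<le> b u + norm (x - u) * gsup (2 * \<delta>) u" by simp
  also have "\<dots> \<le> b u + \<delta> * gsup (2 * \<delta>) u"
    using assms by (intro add_left_mono mult_right_mono gsup_nonneg) auto
  finally have "b x \<le> b u + \<delta> * gsup (2 * \<delta>) u" .
  moreover have "gsup \<delta> x \<le> gsup (2 * \<delta>) u" using assms by (intro gsup_mono) auto
  moreover have "0 \<le> \<delta> * b u" using assms b_nonneg by simp
  ultimately show ?thesis unfolding weight_def by (simp add: algebra_simps)
qed

lemma integral_weight_finite:
  assumes "\<delta> \<ge> 0" "integrable lborel b" "(\<integral>\<^sup>+x. ennreal (gsup \<delta> x) \<partial>lborel) < \<infinity>"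
  shows "(\<integral>\<^sup>+x. ennreal (weight \<delta> x) \<partial>lborel) < \<infinity>"
proof -
  have "(\<integral>\<^sup>+x. ennreal (weight \<delta> x) \<partial>lborel) = (\<integral>\<^sup>+x. ennreal (b x) + ennreal (gsup \<delta> x) \<partial>lborel)"
    using assms(1) by (intro nn_integral_cong) (simp add: weight_def ennreal_plus b_nonneg gsup_nonneg)
  also have "\<dots> = (\<integral>\<^sup>+x. ennreal (b x) \<partial>lborel) + (\<integral>\<^sup>+x. ennreal (gsup \<delta> x) \<partial>lborel)"
    by (intro nn_integral_add) measurable
  also have "\<dots> < \<infinity>" using assms by (simp add: integrable_iff_bounded b_nonneg)
  finally show ?thesis .
qed

end

section \<open>The pair contribution and its limit\<close>

lemma borel_measurable_vec_lambda [measurable (raw)]: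
  fixes f :: "'n::finite \<Rightarrow> 'a \<Rightarrow> real"
  assumes [measurable]: "\<And>i. f i \<in> borel_measurable M"
  shows "(\<lambda>w. \<chi> i. f i w) \<in> borel_measurable M"
proof -
  have eq: "(\<chi> i. f i w) = (\<Sum>i\<in>UNIV. f i w *\<^sub>R axis i 1)" for w
    by (simp add: vec_eq_iff axis_def if_distrib cong: if_cong)
  show ?thesis unfolding eq by measurable
qed

locale scaled_dynamics = jump_kernel a r + cylinder_function \<phi> g + rate_function b
  for a :: "real^'d::finite \<Rightarrow> ennreal" and r :: real
    and \<phi> :: "'n::finite \<Rightarrow> real^'d \<Rightarrow> real" and g :: "real^'n \<Rightarrow> real" and b :: "real^'d \<Rightarrow> real"
begin

lemma \<phi>_continuous: "continuous_on UNIV (\<phi> i)" by (rule smooth_continuous[OF \<phi>_smooth])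

lemma g_continuous: "continuous_on UNIV g" by (rule smooth_continuous[OF g_smooth])

lemma \<phi>_measurable [measurable]: "\<phi> i \<in> borel_measurable borel"
  by (rule borel_measurable_continuous_onI[OF \<phi>_continuous])

lemma g_measurable [measurable]: "g \<in> borel_measurable borel"
  by (rule borel_measurable_continuous_onI[OF g_continuous])

text \<open>The contribution of a pair of points to the generator, in the rescaled jump variables and as a
  function of the pairings \<open>v\<close>; see \<open>L_eps_term_eq\<close>. The factor \<open>\<epsilon>\<^sup>-\<^sup>2\<close> in \<open>pair_term\<close> is what remains of
  the prefactor of the rate.\<close>

definition integrand :: "real \<Rightarrow> real^'n \<Rightarrow> real^'d \<Rightarrow> real^'d \<Rightarrow> (real^'d) \<times> (real^'d) \<Rightarrow> real" where
  "integrand \<epsilon> v x1 x2 h = (b (x2 - x1) + b (x2 - x1 + \<epsilon> *\<^sub>R (snd h - fst h))) *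
     (increment v x1 x2 \<epsilon> (fst h) (snd h))"

definition pair_term :: "real \<Rightarrow> real^'n \<Rightarrow> real^'d \<Rightarrow> real^'d \<Rightarrow> real" where
  "pair_term \<epsilon> v x1 x2 = (\<integral>h. integrand \<epsilon> v x1 x2 h \<partial>\<nu>) / \<epsilon>\<^sup>2"

lemma integrand_continuous: "continuous_on UNIV (integrand \<epsilon> v x1 x2)"
  unfolding integrand_def moved_def
  by (intro continuous_intros continuous_on_compose2[OF b_continuous] continuous_on_compose2[OF g_continuous]
      continuous_on_compose2[OF \<phi>_continuous]) auto

lemma integrand_integrable: "integrable \<nu> (integrand \<epsilon> v x1 x2)"
  by (rule integrable_\<nu>_continuous[OF integrand_continuous])

lemma integrand_measurable [measurable]:
  assumes [measurable]: "f \<in> borel_measurable M" "x \<in> borel_measurable M" "y \<in> borel_measurable M"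
    "h \<in> measurable M (borel \<Otimes>\<^sub>M borel)"
  shows "(\<lambda>w. integrand \<epsilon> (f w) (x w) (y w) (h w)) \<in> borel_measurable M"
  unfolding integrand_def moved_def by measurable

lemma pair_term_measurable [measurable]:
  assumes [measurable]: "f \<in> borel_measurable M" "x \<in> borel_measurable M" "y \<in> borel_measurable M"
  shows "(\<lambda>w. pair_term \<epsilon> (f w) (x w) (y w)) \<in> borel_measurable M"
  unfolding pair_term_def by measurable

text \<open>The two jumps have the same distribution, and exchanging the points together with the jumps only
  reflects the arguments of the even function \<open>b\<close>.\<close>

lemma pair_term_commute: "pair_term \<epsilon> v x1 x2 = pair_term \<epsilon> v x2 x1"
proof -
  have "(\<integral>h. integrand \<epsilon> v x2 x1 h \<partial>\<nu>) = (\<integral>(h1, h2). integrand \<epsilon> v x2 x1 (h2, h1) \<partial>\<nu>)"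
    unfolding \<nu>_def by (rule \<mu>\<mu>.integral_product_swap[symmetric]) (simp add: \<nu>_def[symmetric])
  also have "\<dots> = (\<integral>h. integrand \<epsilon> v x1 x2 h \<partial>\<nu>)"
  proof (intro Bochner_Integration.integral_cong refl)
    fix h
    have e: "b (x1 - x2) = b (x2 - x1)"
      "b (x1 - x2 + \<epsilon> *\<^sub>R (fst h - snd h)) = b (x2 - x1 + \<epsilon> *\<^sub>R (snd h - fst h))"
      using b_even[of "x2 - x1"] b_even[of "x2 - x1 + \<epsilon> *\<^sub>R (snd h - fst h)"]
      by (simp_all add: algebra_simps)
    then show "(case h of (h1, h2) \<Rightarrow> integrand \<epsilon> v x2 x1 (h2, h1)) = integrand \<epsilon> v x1 x2 h"
      using moved_commute[of v x1 x2] by (simp add: integrand_def split_beta')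
  qed
  finally show ?thesis by (simp add: pair_term_def)
qed

subsection \<open>Bounds\<close>

text \<open>The integrand without its first order term, already divided by \<open>\<epsilon>\<^sup>2\<close>.\<close>

definition remainder :: "real \<Rightarrow> real^'n \<Rightarrow> real^'d \<Rightarrow> real^'d \<Rightarrow> (real^'d) \<times> (real^'d) \<Rightarrow> real" where
  "remainder \<epsilon> v x1 x2 h = (integrand \<epsilon> v x1 x2 h
     - 2 * b (x2 - x1) * (\<epsilon> * (cyl_lin v x1 x2 (fst h) (snd h)))) / \<epsilon>\<^sup>2"

lemma remainder_measurable [measurable]: "remainder \<epsilon> v x1 x2 \<in> borel_measurable \<nu>"
  unfolding remainder_def by measurable

text \<open>The first order term is odd in the jumps, hence does not contribute to the integral.\<close>

lemma pair_term_eq_remainder: "pair_term \<epsilon> v x1 x2 = (\<integral>h. remainder \<epsilon> v x1 x2 h \<partial>\<nu>)"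
proof -
  have I: "integrable \<nu> (\<lambda>h. p \<bullet> fst h + q \<bullet> snd h)" for p q
    by (intro integrable_\<nu>_continuous continuous_intros)
  have "(\<integral>h. remainder \<epsilon> v x1 x2 h \<partial>\<nu>) = ((\<integral>h. integrand \<epsilon> v x1 x2 h \<partial>\<nu>)
     - 2 * b (x2 - x1) * (\<epsilon> * (\<integral>h. cyl_lin v x1 x2 (fst h) (snd h) \<partial>\<nu>))) / \<epsilon>\<^sup>2"
    unfolding remainder_def
    by (simp only: integral_divide_zero Bochner_Integration.integral_diff[OF integrand_integrable] I
        integrable_mult_right integral_mult_right_zero)
  then show ?thesis by (simp only: pair_term_def integral_\<nu>_linear)  simp
qed

text \<open>Each factor on the right is bounded and converges: a second order Taylor quotient of \<open>F\<close>, and the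
  product of a first order quotient of \<open>b\<close> with one of \<open>F\<close>.\<close>

lemma remainder_split:
  assumes "\<epsilon> > 0"
  shows "remainder \<epsilon> v x1 x2 h =
     2 * b (x2 - x1) * ((increment v x1 x2 \<epsilon> (fst h) (snd h)
        - \<epsilon> * (cyl_lin v x1 x2 (fst h) (snd h))) / \<epsilon>\<^sup>2)
     + ((b (x2 - x1 + \<epsilon> *\<^sub>R (snd h - fst h)) - b (x2 - x1)) / \<epsilon>)
       * ((increment v x1 x2 \<epsilon> (fst h) (snd h)) / \<epsilon>)"
  using assms by (simp add: remainder_def integrand_def field_simps power2_eq_square)

lemma remainder_bound:
  assumes e: "e > 0" and \<delta>: "2 * r * e \<le> \<delta>"
  shows "\<exists>K\<ge>0. \<exists>R\<ge>0. \<forall>\<epsilon> v x1 x2 h. 0 < \<epsilon> \<longrightarrow> \<epsilon> \<le> e \<longrightarrow> norm (fst h) \<le> r \<longrightarrow> norm (snd h) \<le> r \<longrightarrow>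
    \<bar>remainder \<epsilon> v x1 x2 h\<bar> \<le> K * near R x1 x2 * weight \<delta> (x2 - x1)"
proof -
  obtain K R where K: "K \<ge> 0" "R \<ge> 0" and D: "\<And>v x1 x2 h1 h2 t. norm h1 \<le> r \<Longrightarrow> norm h2 \<le> r \<Longrightarrow> 0 < t \<Longrightarrow> t \<le> e \<Longrightarrow>
     \<bar>increment v x1 x2 t h1 h2\<bar> \<le> K * near R x1 x2 * t \<and>
     \<bar>increment v x1 x2 t h1 h2 - t * (cyl_lin v x1 x2 h1 h2)\<bar>
        \<le> K * near R x1 x2 * t\<^sup>2"
    using increment_bounds[of r e] r_pos e by (metis less_imp_le)
  have \<delta>0: "\<delta> \<ge> 0" using \<delta> e r_pos by (smt (verit, best) mult_pos_pos)
  have "\<bar>remainder \<epsilon> v x1 x2 h\<bar> \<le> (2 + 2 * r) * K * near R x1 x2 * weight \<delta> (x2 - x1)"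
    if \<epsilon>: "0 < \<epsilon>" "\<epsilon> \<le> e" and h: "norm (fst h) \<le> r" "norm (snd h) \<le> r" for \<epsilon> v x1 x2 h
  proof -
    let ?x = "x2 - x1" and ?\<chi> = "near R x1 x2"
    let ?d = "increment v x1 x2 \<epsilon> (fst h) (snd h)"
    let ?l = "\<epsilon> * (cyl_lin v x1 x2 (fst h) (snd h))"
    have \<chi>: "?\<chi> \<ge> 0" by (rule near_nonneg)
    have d: "\<bar>?d\<bar> \<le> K * ?\<chi> * \<epsilon>" "\<bar>?d - ?l\<bar> \<le> K * ?\<chi> * \<epsilon>\<^sup>2" using D[OF h \<epsilon>] by auto
    have d1: "\<bar>?d / \<epsilon>\<bar> \<le> K * ?\<chi>" and d2: "\<bar>(?d - ?l) / \<epsilon>\<^sup>2\<bar> \<le> K * ?\<chi>"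
      using d \<epsilon> by (simp_all add: abs_divide divide_le_eq)
    have n: "norm (\<epsilon> *\<^sub>R (snd h - fst h)) \<le> \<epsilon> * (2 * r)"
      using norm_triangle_ineq4[of "snd h" "fst h"] h \<epsilon> by simp
    also have "\<dots> \<le> e * (2 * r)" using \<epsilon> r_pos by (intro mult_right_mono) auto
    also have "\<dots> \<le> \<delta>" using \<delta> by (simp add: mult.commute)
    finally have "\<bar>b (?x + \<epsilon> *\<^sub>R (snd h - fst h)) - b ?x\<bar> \<le> norm (\<epsilon> *\<^sub>R (snd h - fst h)) * gsup \<delta> ?x"
      by (rule b_increment)
    also have "\<dots> \<le> \<epsilon> * (2 * r) * gsup \<delta> ?x" by (intro mult_right_mono n gsup_nonneg \<delta>0)
    finally have bi: "\<bar>(b (?x + \<epsilon> *\<^sub>R (snd h - fst h)) - b ?x) / \<epsilon>\<bar> \<le> 2 * r * gsup \<delta> ?x"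
      using \<epsilon> by (simp add: abs_divide divide_le_eq mult_ac)
    have "\<bar>remainder \<epsilon> v x1 x2 h\<bar> \<le> 2 * b ?x * \<bar>(?d - ?l) / \<epsilon>\<^sup>2\<bar>
        + \<bar>(b (?x + \<epsilon> *\<^sub>R (snd h - fst h)) - b ?x) / \<epsilon>\<bar> * \<bar>?d / \<epsilon>\<bar>"
      unfolding remainder_split[OF \<epsilon>(1)]
      by (rule order_trans[OF abs_triangle_ineq]) (simp only: abs_mult abs_of_nonneg[OF b_nonneg] abs_numeral order_refl)
    also have "\<dots> \<le> 2 * b ?x * (K * ?\<chi>) + (2 * r * gsup \<delta> ?x) * (K * ?\<chi>)"
      using d1 d2 bi b_nonneg r_pos gsup_nonneg[OF \<delta>0]
      by (intro add_mono mult_mono mult_left_mono) auto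
    also have "\<dots> \<le> (2 + 2 * r) * b ?x * (K * ?\<chi>) + ((2 + 2 * r) * gsup \<delta> ?x) * (K * ?\<chi>)"
      using b_nonneg[of ?x] gsup_nonneg[OF \<delta>0, of ?x] r_pos K \<chi>
      by (intro add_mono mult_right_mono) auto
    also have "\<dots> = (2 + 2 * r) * K * ?\<chi> * weight \<delta> ?x" by (simp add: weight_def algebra_simps)
    finally show ?thesis .
  qed
  moreover have "(2 + 2 * r) * K \<ge> 0" using K r_pos by simp
  ultimately show ?thesis using K(2) by blast
qed

lemma pair_term_uniform_bound:
  assumes e: "e > 0" and \<delta>: "2 * r * e \<le> \<delta>"
  shows "\<exists>K\<ge>0. \<exists>R\<ge>0. \<forall>\<epsilon> v x1 x2. 0 < \<epsilon> \<longrightarrow> \<epsilon> \<le> e \<longrightarrow>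
    \<bar>pair_term \<epsilon> v x1 x2\<bar> \<le> K * near R x1 x2 * weight \<delta> (x2 - x1)"
proof -
  obtain K R where K: "K \<ge> 0" "R \<ge> 0" and D: "\<And>\<epsilon> v x1 x2 h. 0 < \<epsilon> \<Longrightarrow> \<epsilon> \<le> e \<Longrightarrow> norm (fst h) \<le> r \<Longrightarrow> norm (snd h) \<le> r \<Longrightarrow>
    \<bar>remainder \<epsilon> v x1 x2 h\<bar> \<le> K * near R x1 x2 * weight \<delta> (x2 - x1)"
    using remainder_bound[OF assms] by blast
  have "\<bar>pair_term \<epsilon> v x1 x2\<bar> \<le> (K * measure \<nu> UNIV) * near R x1 x2 * weight \<delta> (x2 - x1)"
    if \<epsilon>: "0 < \<epsilon>" "\<epsilon> \<le> e" for \<epsilon> v x1 x2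
  proof -
    have ae: "AE h in \<nu>. norm (remainder \<epsilon> v x1 x2 h) \<le> K * near R x1 x2 * weight \<delta> (x2 - x1)"
      using AE_\<nu>_support by eventually_elim (use D[OF \<epsilon>] in auto)
    have int: "integrable \<nu> (remainder \<epsilon> v x1 x2)"
      by (rule \<nu>.integrable_const_bound[OF ae]) measurable
    have "norm (\<integral>h. remainder \<epsilon> v x1 x2 h \<partial>\<nu>) \<le> (\<integral>h. norm (remainder \<epsilon> v x1 x2 h) \<partial>\<nu>)"
      by (rule integral_norm_bound)
    also have "\<dots> \<le> (\<integral>h. K * near R x1 x2 * weight \<delta> (x2 - x1) \<partial>\<nu>)"
      using int by (intro integral_mono_AE ae) auto
    finally have "norm (\<integral>h. remainder \<epsilon> v x1 x2 h \<partial>\<nu>) \<le> (\<integral>h. K * near R x1 x2 * weight \<delta> (x2 - x1) \<partial>\<nu>)" .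
    then show ?thesis by (simp add: pair_term_eq_remainder mult_ac)
  qed
  moreover have "K * measure \<nu> UNIV \<ge> 0" using K by simp
  ultimately show ?thesis using K(2) by blast
qed

text \<open>A bound for a single \<open>\<epsilon>\<close>, however large, hence also when the displacement of the relative position
  exceeds the radius within which increments of \<open>b\<close> are controlled: the potential is simply averaged over the jumps.
  The price is a constant that explodes as \<open>\<epsilon>\<close> tends to \<open>0\<close>.\<close>

lemma pair_term_bound:
  assumes \<epsilon>: "\<epsilon> > 0"
  shows "\<exists>K\<ge>0. \<exists>R\<ge>0. \<forall>v x1 x2. ennreal \<bar>pair_term \<epsilon> v x1 x2\<bar> \<le> ennreal (near R x1 x2) *
    (\<integral>\<^sup>+h. ennreal (K * (b (x2 - x1) + b (x2 - x1 + \<epsilon> *\<^sub>R (snd h - fst h)))) \<partial>\<nu>)"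
proof -
  obtain K R where K: "K \<ge> 0" "R \<ge> 0" and D: "\<And>v x1 x2 h1 h2 t. norm h1 \<le> r \<Longrightarrow> norm h2 \<le> r \<Longrightarrow> 0 < t \<Longrightarrow> t \<le> \<epsilon> \<Longrightarrow>
     \<bar>increment v x1 x2 t h1 h2\<bar> \<le> K * near R x1 x2 * t"
    using increment_bounds[of r \<epsilon>] r_pos \<epsilon> by (metis less_imp_le)
  have "ennreal \<bar>pair_term \<epsilon> v x1 x2\<bar> \<le> ennreal (near R x1 x2) *
    (\<integral>\<^sup>+h. ennreal (K / \<epsilon> * (b (x2 - x1) + b (x2 - x1 + \<epsilon> *\<^sub>R (snd h - fst h)))) \<partial>\<nu>)" for v x1 x2
  proof -
    have "ennreal \<bar>pair_term \<epsilon> v x1 x2\<bar> = ennreal (norm (\<integral>h. integrand \<epsilon> v x1 x2 h / \<epsilon>\<^sup>2 \<partial>\<nu>))"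
      by (simp add: pair_term_def)
    also have "\<dots> \<le> (\<integral>\<^sup>+h. ennreal (norm (integrand \<epsilon> v x1 x2 h / \<epsilon>\<^sup>2)) \<partial>\<nu>)"
      using integrand_integrable by (intro integral_norm_bound_ennreal) auto
    also have "\<dots> \<le> (\<integral>\<^sup>+h. ennreal (near R x1 x2) * ennreal (K / \<epsilon> * (b (x2 - x1) + b (x2 - x1 + \<epsilon> *\<^sub>R (snd h - fst h)))) \<partial>\<nu>)"
    proof (rule nn_integral_mono_AE)
      show "AE h in \<nu>. ennreal (norm (integrand \<epsilon> v x1 x2 h / \<epsilon>\<^sup>2)) \<le> ennreal (near R x1 x2) *
        ennreal (K / \<epsilon> * (b (x2 - x1) + b (x2 - x1 + \<epsilon> *\<^sub>R (snd h - fst h))))"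
        using AE_\<nu>_support
      proof eventually_elim
        case (elim h)
        let ?B = "b (x2 - x1) + b (x2 - x1 + \<epsilon> *\<^sub>R (snd h - fst h))"
        have B: "?B \<ge> 0" using b_nonneg by (intro add_nonneg_nonneg)
        have "norm (integrand \<epsilon> v x1 x2 h) \<le> ?B * (K * near R x1 x2 * \<epsilon>)"
          unfolding integrand_def norm_mult using D[of "fst h" "snd h" \<epsilon> v x1 x2] elim \<epsilon> B
          by (intro mult_mono) auto
        then have "norm (integrand \<epsilon> v x1 x2 h / \<epsilon>\<^sup>2) \<le> near R x1 x2 * (K / \<epsilon> * ?B)"
          using \<epsilon> by (simp add: field_simps power2_eq_square)
        then show ?case using near_nonneg K B \<epsilon> by (simp add: ennreal_mult[symmetric] ennreal_leI)
      qed
    qed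
    also have "\<dots> = ennreal (near R x1 x2) * (\<integral>\<^sup>+h. ennreal (K / \<epsilon> * (b (x2 - x1) + b (x2 - x1 + \<epsilon> *\<^sub>R (snd h - fst h)))) \<partial>\<nu>)"
      by (rule nn_integral_cmult) measurable
    finally show ?thesis .
  qed
  moreover have "K / \<epsilon> \<ge> 0" using K \<epsilon> by simp
  ultimately show ?thesis using K(2) by blast
qed

subsection \<open>The limit\<close>

text \<open>What the limiting generator attributes to the point \<open>x\<close> in the presence of \<open>y\<close>, up to the
  constant.\<close>

definition lim_term :: "real^'n \<Rightarrow> real^'d \<Rightarrow> real^'d \<Rightarrow> real" where
  "lim_term v x y = cyl_lap v x * b (x - y) + cyl_grad v x \<bullet> grad b (x - y)"

lemma cyl_hess_continuous: "continuous_on UNIV (\<lambda>h. cyl_hess v x1 x2 (fst h) (snd h))"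
  unfolding cyl_hess_def
  by (intro continuous_intros continuous_on_compose2[OF hess_form_continuous]) auto

lemma integral_\<nu>_cyl_hess:
  "(\<integral>h. cyl_hess v x1 x2 (fst h) (snd h) \<partial>\<nu>) = m0 * m2 k * (cyl_lap v x1 + cyl_lap v x2)"
proof -
  let ?p = "\<lambda>i h. grad (\<phi> i) x1 \<bullet> fst h + grad (\<phi> i) x2 \<bullet> snd h"
  have c1: "integrable \<nu> (\<lambda>h. ?p j h * ?p i h)" for i j
    by (intro integrable_\<nu>_continuous continuous_intros)
  have c2: "integrable \<nu> (\<lambda>h. hess_form (\<phi> i) x1 (fst h) + hess_form (\<phi> i) x2 (snd h))" for i
    by (intro integrable_\<nu>_continuous continuous_intros continuous_on_compose2[OF hess_form_continuous]) auto
  have c3: "integrable \<nu> (\<lambda>h. \<Sum>j\<in>UNIV. partial_deriv j (partial_deriv i g) v * (?p j h * ?p i h))" for i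
    by (intro Bochner_Integration.integrable_sum integrable_mult_right c1)
  have "(\<integral>h. cyl_hess v x1 x2 (fst h) (snd h) \<partial>\<nu>)
    = (\<Sum>i\<in>UNIV. \<integral>h. (\<Sum>j\<in>UNIV. partial_deriv j (partial_deriv i g) v * (?p j h * ?p i h))
       + partial_deriv i g v * (hess_form (\<phi> i) x1 (fst h) + hess_form (\<phi> i) x2 (snd h)) \<partial>\<nu>)"
    unfolding cyl_hess_def
    by (rule Bochner_Integration.integral_sum) (intro Bochner_Integration.integrable_add c3 integrable_mult_right c2)
  also have "\<dots> = (\<Sum>i\<in>UNIV. (\<Sum>j\<in>UNIV. partial_deriv j (partial_deriv i g) v * (\<integral>h. ?p j h * ?p i h \<partial>\<nu>))
       + partial_deriv i g v * (\<integral>h. hess_form (\<phi> i) x1 (fst h) + hess_form (\<phi> i) x2 (snd h) \<partial>\<nu>))"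
  proof (intro sum.cong refl)
    fix i
    have "(\<integral>h. (\<Sum>j\<in>UNIV. partial_deriv j (partial_deriv i g) v * (?p j h * ?p i h)) \<partial>\<nu>)
        = (\<Sum>j\<in>UNIV. partial_deriv j (partial_deriv i g) v * (\<integral>h. ?p j h * ?p i h \<partial>\<nu>))"
      by (subst Bochner_Integration.integral_sum) (intro integrable_mult_right c1, simp only: integral_mult_right_zero)
    then show "(\<integral>h. (\<Sum>j\<in>UNIV. partial_deriv j (partial_deriv i g) v * (?p j h * ?p i h))
       + partial_deriv i g v * (hess_form (\<phi> i) x1 (fst h) + hess_form (\<phi> i) x2 (snd h)) \<partial>\<nu>)
      = (\<Sum>j\<in>UNIV. partial_deriv j (partial_deriv i g) v * (\<integral>h. ?p j h * ?p i h \<partial>\<nu>))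
       + partial_deriv i g v * (\<integral>h. hess_form (\<phi> i) x1 (fst h) + hess_form (\<phi> i) x2 (snd h) \<partial>\<nu>)"
      by (subst Bochner_Integration.integral_add[OF c3 integrable_mult_right[OF c2]]) (simp only: integral_mult_right_zero)
  qed
  also have "\<dots> = m0 * m2 k * (cyl_lap v x1 + cyl_lap v x2)"
    unfolding integral_\<nu>_bilinear[of _ _ _ _ k] integral_\<nu>_hess_form[of _ _ _ _ k]
    by (simp add: cyl_lap_def sum_distrib_left sum.distrib algebra_simps)
  finally show ?thesis .
qed

text \<open>The Taylor quotient of \<open>F\<close> contributes its Hessian, which the average reduces to the two
  Laplacians; in the product of the first order terms the average pairs each jump with itself, which
  leaves \<open>\<nabla>b\<close> against the two gradients, with opposite signs. As \<open>\<nabla>b\<close> is odd, the signs are absorbed by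
  evaluating it at \<open>x1 - x2\<close> and \<open>x2 - x1\<close>.\<close>

lemma pair_term_limit: "((\<lambda>\<epsilon>. pair_term \<epsilon> v x1 x2) \<longlongrightarrow> m0 * m2 k * (lim_term v x1 x2 + lim_term v x2 x1)) (at_right 0)"
proof -
  let ?x = "x2 - x1"
  let ?lin = "\<lambda>h. cyl_lin v x1 x2 (fst h) (snd h)"
  let ?Q = "\<lambda>h. 2 * b ?x * (cyl_hess v x1 x2 (fst h) (snd h) / 2) + (grad b ?x \<bullet> (snd h - fst h)) * ?lin h"
  obtain K R where D: "\<And>\<epsilon> v x1 x2 h. 0 < \<epsilon> \<Longrightarrow> \<epsilon> \<le> 1 \<Longrightarrow> norm (fst h) \<le> r \<Longrightarrow> norm (snd h) \<le> r \<Longrightarrow>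
    \<bar>remainder \<epsilon> v x1 x2 h\<bar> \<le> K * near R x1 x2 * weight (2 * r) (x2 - x1)"
    using remainder_bound[of 1 "2 * r", unfolded mult_1_right, OF zero_less_one order_refl] by blast
  have cQ: "continuous_on UNIV ?Q"
    by (intro continuous_intros cyl_hess_continuous) simp
  have "((\<lambda>\<epsilon>. \<integral>h. remainder \<epsilon> v x1 x2 h \<partial>\<nu>) \<longlongrightarrow> (\<integral>h. ?Q h \<partial>\<nu>)) (at_right 0)"
  proof (rule dominated_convergence_at_right[where e = 1 and w = "\<lambda>_. K * near R x1 x2 * weight (2 * r) ?x"])
    show "?Q \<in> borel_measurable \<nu>"
      using integrable_\<nu>_continuous[OF cQ] by (rule borel_measurable_integrable)
    show "AE h in \<nu>. ((\<lambda>\<epsilon>. remainder \<epsilon> v x1 x2 h) \<longlongrightarrow> ?Q h) (at_right 0)"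
    proof (rule AE_I2)
      fix h
      have "((\<lambda>\<epsilon>. 2 * b (x2 - x1) * ((increment v x1 x2 \<epsilon> (fst h) (snd h)
            - \<epsilon> * (cyl_lin v x1 x2 (fst h) (snd h))) / \<epsilon>\<^sup>2)
         + ((b (x2 - x1 + \<epsilon> *\<^sub>R (snd h - fst h)) - b (x2 - x1)) / \<epsilon>)
           * ((increment v x1 x2 \<epsilon> (fst h) (snd h)) / \<epsilon>)) \<longlongrightarrow> ?Q h) (at_right 0)"
        by (intro tendsto_intros increment_limits b_difference_quotient)
      then show "((\<lambda>\<epsilon>. remainder \<epsilon> v x1 x2 h) \<longlongrightarrow> ?Q h) (at_right 0)"
        by (rule Lim_transform_eventually)
          (use eventually_at_right_less[of "0::real"] in \<open>eventually_elim, simp add: remainder_split\<close>)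
    qed
    show "AE h in \<nu>. \<bar>remainder \<epsilon> v x1 x2 h\<bar> \<le> K * near R x1 x2 * weight (2 * r) ?x" if "0 < \<epsilon>" "\<epsilon> \<le> 1" for \<epsilon>
      using AE_\<nu>_support by eventually_elim (use D[OF that] in auto)
  qed auto
  also have "(\<integral>h. ?Q h \<partial>\<nu>) = m0 * m2 k * (lim_term v x1 x2 + lim_term v x2 x1)"
  proof -
    have I1: "integrable \<nu> (\<lambda>h. cyl_hess v x1 x2 (fst h) (snd h))"
      by (rule integrable_\<nu>_continuous[OF cyl_hess_continuous])
    have I2: "integrable \<nu> (\<lambda>h. ((- grad b ?x) \<bullet> fst h + grad b ?x \<bullet> snd h) * ?lin h)"
      by (intro integrable_\<nu>_continuous continuous_intros)
    have "(\<integral>h. ?Q h \<partial>\<nu>) = (\<integral>h. b ?x * cyl_hess v x1 x2 (fst h) (snd h)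
       + ((- grad b ?x) \<bullet> fst h + grad b ?x \<bullet> snd h) * ?lin h \<partial>\<nu>)"
      by (simp add: inner_diff_right algebra_simps)
    also have "\<dots> = b ?x * (\<integral>h. cyl_hess v x1 x2 (fst h) (snd h) \<partial>\<nu>)
       + (\<integral>h. ((- grad b ?x) \<bullet> fst h + grad b ?x \<bullet> snd h) * ?lin h \<partial>\<nu>)"
      by (subst Bochner_Integration.integral_add[OF integrable_mult_right[OF I1] I2]) (simp only: integral_mult_right_zero)
    also have "\<dots> = b ?x * (m0 * m2 k * (cyl_lap v x1 + cyl_lap v x2))
       + m0 * m2 k * ((- grad b ?x) \<bullet> cyl_grad v x1 + grad b ?x \<bullet> cyl_grad v x2)"
      unfolding integral_\<nu>_cyl_hess[of _ _ _ k] integral_\<nu>_bilinear[of _ _ _ _ k] ..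
    also have "\<dots> = m0 * m2 k * (lim_term v x1 x2 + lim_term v x2 x1)"
      using b_even[of ?x] grad_b_odd[of ?x] by (simp add: lim_term_def inner_commute algebra_simps)
    finally show ?thesis .
  qed
  finally show ?thesis by (simp add: pair_term_eq_remainder)
qed

end

section \<open>Sums over pairs of distinct points\<close>

definition offdiag :: "'a set \<Rightarrow> ('a \<times> 'a) set" where
  "offdiag \<gamma> = Sigma \<gamma> (\<lambda>x. \<gamma> - {x})"

lemma offdiag_countable: "countable \<gamma> \<Longrightarrow> countable (offdiag \<gamma>)"
  unfolding offdiag_def by (intro countable_SIGMA) auto

lemma nn_integral_offdiag_swap:
  "(\<integral>\<^sup>+p. f (snd p, fst p) \<partial>count_space (offdiag \<gamma>)) = (\<integral>\<^sup>+p. f p \<partial>count_space (offdiag \<gamma>))"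
  by (rule nn_integral_bij_count_space[of "\<lambda>p. (snd p, fst p)" "offdiag \<gamma>" "offdiag \<gamma>" f])
    (rule bij_betwI[where g="\<lambda>p. (snd p, fst p)"], auto simp: offdiag_def)

lemma integral_offdiag_swap:
  fixes f :: "'a \<times> 'a \<Rightarrow> real"
  shows "(\<integral>p. f (snd p, fst p) \<partial>count_space (offdiag \<gamma>)) = (\<integral>p. f p \<partial>count_space (offdiag \<gamma>))"
  by (rule integral_bij_count_space[of "\<lambda>p. (snd p, fst p)" "offdiag \<gamma>" "offdiag \<gamma>" f])
    (rule bij_betwI[where g="\<lambda>p. (snd p, fst p)"], auto simp: offdiag_def)

lemma integrable_offdiag_swap:
  fixes f :: "'a \<times> 'a \<Rightarrow> real"
  assumes "integrable (count_space (offdiag \<gamma>)) f"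
  shows "integrable (count_space (offdiag \<gamma>)) (\<lambda>p. f (snd p, fst p))"
  using assms nn_integral_offdiag_swap[where f = "\<lambda>p. ennreal (norm (f p))" and \<gamma> = \<gamma>]
  by (simp add: integrable_iff_bounded)

lemma in_pairs_iff: "e \<in> pairs \<gamma> \<longleftrightarrow> (\<exists>x\<in>\<gamma>. \<exists>y\<in>\<gamma>. x \<noteq> y \<and> e = {x, y})"
  unfolding pairs_def card_2_iff by blast

lemma pairs_eq_image: "pairs \<gamma> = (\<lambda>p. {fst p, snd p}) ` offdiag \<gamma>"
proof (rule set_eqI)
  fix e
  have "e \<in> (\<lambda>p. {fst p, snd p}) ` offdiag \<gamma> \<longleftrightarrow> (\<exists>p\<in>offdiag \<gamma>. e = {fst p, snd p})" by blast
  also have "\<dots> \<longleftrightarrow> e \<in> pairs \<gamma>" unfolding in_pairs_iff offdiag_def split_paired_Bex_Sigma fst_conv snd_conv by blast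
  finally show "e \<in> pairs \<gamma> \<longleftrightarrow> e \<in> (\<lambda>p. {fst p, snd p}) ` offdiag \<gamma>" ..
qed

text \<open>Every unordered pair is hit by exactly two ordered ones.\<close>

lemma distr_offdiag_pairs:
  assumes "countable \<gamma>"
  shows "distr (count_space (offdiag \<gamma>)) (count_space (pairs \<gamma>)) (\<lambda>p. {fst p, snd p})
    = density (count_space (pairs \<gamma>)) (\<lambda>_. 2)" (is "distr ?M ?N ?t = _")
proof (rule measure_eqI_countable[where A = "pairs \<gamma>"])
  have t: "?t \<in> measurable ?M ?N" by (auto simp: pairs_eq_image)
  show "countable (pairs \<gamma>)" unfolding pairs_eq_image using offdiag_countable[OF assms] by simp
  fix e assume e: "e \<in> pairs \<gamma>"
  then obtain x y where xy: "e = {x, y}" "x \<noteq> y" "x \<in> \<gamma>" "y \<in> \<gamma>"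
    by (auto simp: in_pairs_iff)
  have "?t -` {e} \<inter> offdiag \<gamma> = {(x, y), (y, x)}"
  proof (rule set_eqI)
    fix p show "p \<in> ?t -` {e} \<inter> offdiag \<gamma> \<longleftrightarrow> p \<in> {(x, y), (y, x)}"
      using xy by (cases p) (auto simp: offdiag_def doubleton_eq_iff)
  qed
  moreover have "{(x, y), (y, x)} \<subseteq> offdiag \<gamma>" using xy by (auto simp: offdiag_def)
  ultimately have "emeasure (distr ?M ?N ?t) {e} = 2"
    using e t xy(2) \<open>{(x, y), (y, x)} \<subseteq> offdiag \<gamma>\<close>
    by (simp add: emeasure_distr emeasure_count_space_finite)
  moreover have "emeasure (density ?N (\<lambda>_. 2)) {e} = 2"
    using e by (simp add: emeasure_density nn_integral_cmult_indicator)
  ultimately show "emeasure (distr ?M ?N ?t) {e} = emeasure (density ?N (\<lambda>_. 2)) {e}" by simp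
qed auto

lemma integral_pairs:
  fixes f :: "'a \<times> 'a \<Rightarrow> real" and F :: "'a set \<Rightarrow> real"
  assumes c: "countable \<gamma>" and F: "\<And>x y. x \<in> \<gamma> \<Longrightarrow> y \<in> \<gamma> \<Longrightarrow> x \<noteq> y \<Longrightarrow> F {x, y} = f (x, y)"
  shows "(\<integral>e. F e \<partial>count_space (pairs \<gamma>)) = (\<integral>p. f p \<partial>count_space (offdiag \<gamma>)) / 2"
    and "integrable (count_space (offdiag \<gamma>)) f \<Longrightarrow> integrable (count_space (pairs \<gamma>)) F"
proof -
  let ?M = "count_space (offdiag \<gamma>)" and ?N = "count_space (pairs \<gamma>)"
  let ?t = "\<lambda>p::'a \<times> 'a. {fst p, snd p}"
  have t: "?t \<in> measurable ?M ?N" by (auto simp: pairs_eq_image)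
  have Ff: "F (?t p) = f p" if "p \<in> offdiag \<gamma>" for p
  proof -
    have "fst p \<in> \<gamma>" "snd p \<in> \<gamma>" "fst p \<noteq> snd p" using that by (auto simp: offdiag_def)
    then show ?thesis using F[of "fst p" "snd p"] by simp
  qed
  have d: "density ?N (\<lambda>_. 2) = density ?N (\<lambda>_. ennreal 2)" by simp
  have "(\<integral>p. f p \<partial>?M) = (\<integral>p. F (?t p) \<partial>?M)"
    by (intro Bochner_Integration.integral_cong refl) (simp add: Ff)
  also have "\<dots> = (\<integral>e. F e \<partial>distr ?M ?N ?t)" using t by (subst integral_distr) auto
  also have "\<dots> = 2 * (\<integral>e. F e \<partial>?N)"
    unfolding distr_offdiag_pairs[OF c] d by (subst integral_density) auto
  finally show "(\<integral>e. F e \<partial>?N) = (\<integral>p. f p \<partial>?M) / 2" by simp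
  assume "integrable ?M f"
  then have "integrable ?M (\<lambda>p. F (?t p))"
    by (subst Bochner_Integration.integrable_cong[OF refl, of _ _ f]) (simp_all add: Ff)
  then have "integrable (distr ?M ?N ?t) F" using t by (subst integrable_distr_eq) auto
  then have "integrable ?N (\<lambda>e. 2 *\<^sub>R F e)"
    unfolding distr_offdiag_pairs[OF c] d by (subst (asm) integrable_density) auto
  then show "integrable ?N F" by simp
qed

lemma nn_integral_offdiag:
  assumes c: "countable \<gamma>"
  shows "(\<integral>\<^sup>+p. f p \<partial>count_space (offdiag \<gamma>)) =
    (\<integral>\<^sup>+x. \<integral>\<^sup>+y. (if x = y then 0 else f (x, y)) \<partial>count_space \<gamma> \<partial>count_space \<gamma>)"
proof -
  interpret S: sigma_finite_measure "count_space \<gamma>" by (rule sigma_finite_measure_count_space_countable[OF c])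
  let ?f = "\<lambda>p. if fst p = snd p then 0 else f p"
  have "(\<integral>\<^sup>+p. f p \<partial>count_space (offdiag \<gamma>)) = (\<integral>\<^sup>+p. ?f p \<partial>count_space (offdiag \<gamma>))"
    by (intro nn_integral_cong) (auto simp: offdiag_def)
  also have "\<dots> = (\<integral>\<^sup>+p. ?f p \<partial>count_space (\<gamma> \<times> \<gamma>))"
    by (rule nn_integral_count_space_eq) (auto simp: offdiag_def)
  also have "\<dots> = (\<integral>\<^sup>+p. ?f p \<partial>(count_space \<gamma> \<Otimes>\<^sub>M count_space \<gamma>))"
    using c by (simp add: pair_measure_countable)
  also have "\<dots> = (\<integral>\<^sup>+x. \<integral>\<^sup>+y. ?f (x, y) \<partial>count_space \<gamma> \<partial>count_space \<gamma>)"
    by (rule S.nn_integral_fst[symmetric]) (use c in \<open>simp add: pair_measure_countable\<close>)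
  finally show ?thesis by simp
qed

context random_configuration begin

lemma nn_integral_offdiag_measurable:
  assumes K[measurable]: "K \<in> borel_measurable (M \<Otimes>\<^sub>M (borel \<Otimes>\<^sub>M borel))"
  shows "(\<lambda>w. \<integral>\<^sup>+p. K (w, p) \<partial>count_space (offdiag (G w))) \<in> borel_measurable M"
proof -
  interpret R: random_configuration "M \<Otimes>\<^sub>M borel" "\<lambda>q. G (fst q)" by (rule random_configuration_pair_fst)
  let ?K = "\<lambda>s. if snd (fst s) = snd s then 0 else K (fst (fst s), (snd (fst s), snd s))"
  have "?K \<in> borel_measurable ((M \<Otimes>\<^sub>M borel) \<Otimes>\<^sub>M borel)" by measurable
  from R.nn_integral_points_measurable[OF this]
  have "(\<lambda>q. \<integral>\<^sup>+y. ?K (q, y) \<partial>count_space (G (fst q))) \<in> borel_measurable (M \<Otimes>\<^sub>M borel)" .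
  from nn_integral_points_measurable[OF this]
  have "(\<lambda>w. \<integral>\<^sup>+x. \<integral>\<^sup>+y. ?K ((w, x), y) \<partial>count_space (G w) \<partial>count_space (G w)) \<in> borel_measurable M"
    by simp
  then show ?thesis
    by (rule measurable_cong[THEN iffD1, rotated]) (simp add: nn_integral_offdiag Config_countable[OF config] cong: if_cong)
qed

lemma integral_offdiag_measurable:
  fixes K :: "'w \<times> ((real^'d) \<times> (real^'d)) \<Rightarrow> real"
  assumes K: "K \<in> borel_measurable (M \<Otimes>\<^sub>M (borel \<Otimes>\<^sub>M borel))"
  shows "(\<lambda>w. \<integral>p. K (w, p) \<partial>count_space (offdiag (G w))) \<in> borel_measurable M"
proof -
  have [measurable]: "(\<lambda>w. \<integral>\<^sup>+p. norm (K (w, p)) \<partial>count_space (offdiag (G w))) \<in> borel_measurable M"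
    "(\<lambda>w. \<integral>\<^sup>+p. ennreal (K (w, p)) \<partial>count_space (offdiag (G w))) \<in> borel_measurable M"
    "(\<lambda>w. \<integral>\<^sup>+p. ennreal (- K (w, p)) \<partial>count_space (offdiag (G w))) \<in> borel_measurable M"
    using nn_integral_offdiag_measurable[of "\<lambda>p. ennreal (norm (K p))"]
      nn_integral_offdiag_measurable[of "\<lambda>p. ennreal (K p)"]
      nn_integral_offdiag_measurable[of "\<lambda>p. ennreal (- K p)"] K by auto
  have eq: "(\<integral>p. K (w, p) \<partial>count_space (offdiag (G w))) =
      (if (\<integral>\<^sup>+p. norm (K (w, p)) \<partial>count_space (offdiag (G w))) < \<infinity>
       then enn2real (\<integral>\<^sup>+p. ennreal (K (w, p)) \<partial>count_space (offdiag (G w)))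
          - enn2real (\<integral>\<^sup>+p. ennreal (- K (w, p)) \<partial>count_space (offdiag (G w))) else 0)" for w
    by (auto simp: integrable_iff_bounded not_integrable_integral_eq intro: real_lebesgue_integral_def)
  show ?thesis unfolding eq by measurable
qed

end

section \<open>Cylinder functions under changes of the configuration\<close>

lemma Config_Diff: "\<gamma> \<in> Config \<Longrightarrow> \<gamma> - A \<in> Config"
  by (auto simp: Config_def intro: finite_subset[rotated])

lemma Config_insert: "\<gamma> \<in> Config \<Longrightarrow> insert x \<gamma> \<in> Config"
  by (auto simp: Config_def Int_insert_left)

text \<open>Local finiteness turns the pairing into a finite sum, so that changing single points of the
  configuration can be followed by elementary means.\<close>

lemma pairing_eq_sum:
  assumes g: "\<gamma> \<in> Config" and f: "\<And>x. norm x > \<rho> \<Longrightarrow> f x = 0"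
  shows "pairing f \<gamma> = (\<Sum>x\<in>\<gamma> \<inter> cball 0 \<rho>. f x)"
proof -
  have "pairing f \<gamma> = infsum f (\<gamma> \<inter> cball 0 \<rho>)"
    unfolding pairing_def by (rule infsum_cong_neutral) (auto intro: f)
  then show ?thesis using Config_finite_Int_bounded[OF g bounded_cball] by simp
qed

lemma pairing_insert:
  assumes g: "\<gamma> \<in> Config" and f: "f \<in> C0_infinity" and x: "x \<notin> \<gamma>"
  shows "pairing f (insert x \<gamma>) = f x + pairing f \<gamma>"
proof -
  obtain \<rho> where \<rho>: "\<And>x. norm x > \<rho> \<Longrightarrow> f x = 0" using C0_infinity_bounded_support[OF f] by blast
  have fin: "finite (\<gamma> \<inter> cball 0 \<rho>)" by (rule Config_finite_Int_bounded[OF g bounded_cball])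
  have "(\<Sum>y\<in>insert x \<gamma> \<inter> cball 0 \<rho>. f y) = f x + (\<Sum>y\<in>\<gamma> \<inter> cball 0 \<rho>. f y)"
    using fin x \<rho>[of x] by (cases "x \<in> cball 0 \<rho>") (auto simp: Int_insert_left)
  then show ?thesis by (simp only: pairing_eq_sum[OF g \<rho>] pairing_eq_sum[OF Config_insert[OF g] \<rho>])
qed

context cylinder_function begin

definition pairings :: "(real^'d) set \<Rightarrow> real^'n" where "pairings \<gamma> = (\<chi> i. pairing (\<phi> i) \<gamma>)"

lemma pairings_insert: "\<gamma> \<in> Config \<Longrightarrow> x \<notin> \<gamma> \<Longrightarrow> pairings (insert x \<gamma>) = (\<chi> i. \<phi> i x) + pairings \<gamma>"
  by (simp add: pairings_def vec_eq_iff pairing_insert[OF _ \<phi>])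

lemma pairings_replace_pair:
  assumes g: "\<gamma> \<in> Config" and x: "x1 \<in> \<gamma>" "x2 \<in> \<gamma>" "x1 \<noteq> x2"
    and y: "x1 + h1 \<notin> \<gamma> - {x1, x2}" "x2 + h2 \<notin> \<gamma> - {x1, x2}" "x1 + h1 \<noteq> x2 + h2"
  shows "pairings ((\<gamma> - {x1, x2}) \<union> {x1 + h1, x2 + h2}) = moved (pairings \<gamma>) x1 x2 h1 h2"
    and "(\<gamma> - {x1, x2}) \<union> {x1 + h1, x2 + h2} \<in> Config"
proof -
  let ?g = "\<gamma> - {x1, x2}"
  have c: "?g \<in> Config" "insert a ?g \<in> Config" for a using g by (intro Config_Diff Config_insert; simp)+
  have "\<gamma> = insert x1 (insert x2 ?g)" using x by auto
  then have "pairings \<gamma> = pairings (insert x1 (insert x2 ?g))" by simp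
  also have "\<dots> = (\<chi> i. \<phi> i x1) + ((\<chi> i. \<phi> i x2) + pairings ?g)" using c x by (simp add: pairings_insert)
  finally have 1: "pairings \<gamma> = (\<chi> i. \<phi> i x1) + ((\<chi> i. \<phi> i x2) + pairings ?g)" .
  have e: "?g \<union> {x1 + h1, x2 + h2} = insert (x1 + h1) (insert (x2 + h2) ?g)" by auto
  show "?g \<union> {x1 + h1, x2 + h2} \<in> Config" unfolding e using c by (intro Config_insert) auto
  have "pairings (?g \<union> {x1 + h1, x2 + h2}) = (\<chi> i. \<phi> i (x1 + h1)) + ((\<chi> i. \<phi> i (x2 + h2)) + pairings ?g)"
    unfolding e using c y by (simp add: pairings_insert)
  then show "pairings (?g \<union> {x1 + h1, x2 + h2}) = moved (pairings \<gamma>) x1 x2 h1 h2"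
    using 1 by (simp add: moved_def vec_eq_iff)
qed

lemma pairings_replace_point:
  assumes g: "\<gamma> \<in> Config" and x: "x \<in> \<gamma>" and y: "y \<notin> \<gamma> - {x}"
  shows "pairings ((\<gamma> - {x}) \<union> {y}) = (\<chi> i. pairings \<gamma> $ i - \<phi> i x + \<phi> i y)" "(\<gamma> - {x}) \<union> {y} \<in> Config"
proof -
  have c: "\<gamma> - {x} \<in> Config" using g by (rule Config_Diff)
  have "pairings \<gamma> = pairings (insert x (\<gamma> - {x}))" using x by (simp add: insert_absorb)
  also have "\<dots> = (\<chi> i. \<phi> i x) + pairings (\<gamma> - {x})" by (rule pairings_insert[OF c]) simp
  finally show "pairings ((\<gamma> - {x}) \<union> {y}) = (\<chi> i. pairings \<gamma> $ i - \<phi> i x + \<phi> i y)"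
    using pairings_insert[OF c y] by (simp add: vec_eq_iff)
  show "(\<gamma> - {x}) \<union> {y} \<in> Config" using Config_insert[OF c] by simp
qed

lemma partial_deriv_eqI:
  "((\<lambda>t. f (x + t *\<^sub>R axis i 1)) has_real_derivative D) (at 0) \<Longrightarrow> partial_deriv i f x = D"
  unfolding partial_deriv_def by (rule DERIV_imp_deriv)

lemma has_real_derivative_axis:
  assumes "f differentiable_on UNIV"
  shows "((\<lambda>t. f (x + t *\<^sub>R axis i 1)) has_real_derivative partial_deriv i f x) (at 0)"
  using has_real_derivative_along_line[OF assms, of x "axis i 1" 0] by (simp add: inner_axis grad_def)

text \<open>Since the configuration is locally finite, a point moved slightly does not collide with another
  one, so that near \<open>x\<close> the function \<open>y \<mapsto> F (\<gamma> \<setminus> x \<union> y)\<close> is the smooth function \<open>y \<mapsto> g (pairings \<gamma> - \<phi> x + \<phi> y)\<close>.\<close>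

lemma grad_laplacian_point:
  assumes F: "\<And>\<gamma>. \<gamma> \<in> Config \<Longrightarrow> F \<gamma> = g (pairings \<gamma>)" and g: "\<gamma> \<in> Config" and x: "x \<in> \<gamma>"
  shows "grad_point x F \<gamma> = cyl_grad (pairings \<gamma>) x" and "laplacian_point x F \<gamma> = cyl_lap (pairings \<gamma>) x"
proof -
  define w where "w = (\<lambda>y. \<chi> i. pairings \<gamma> $ i - \<phi> i x + \<phi> i y)"
  let ?F = "\<lambda>y. F ((\<gamma> - {x}) \<union> {y})" and ?G = "\<lambda>y. g (w y)"
  define S where "S = ball x 1 - ((\<gamma> \<inter> cball x 1) - {x})"
  have S: "open S" "x \<in> S"
    unfolding S_def using Config_finite_Int_bounded[OF g bounded_cball, of x 1]
    by (auto intro!: open_Diff finite_imp_closed)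
  have FG: "?F y = ?G y" if "y \<in> S" for y
  proof -
    have "y \<notin> \<gamma> - {x}" using that by (auto simp: S_def)
    from pairings_replace_point[OF g x this] show ?thesis by (simp add: F w_def)
  qed
  have wx: "w x = pairings \<gamma>" by (simp add: w_def vec_eq_iff)
  have dw: "((\<lambda>t. w (y + t *\<^sub>R axis k 1) $ i) has_real_derivative partial_deriv k (\<phi> i) y) (at 0)" for y k i
    unfolding w_def using has_real_derivative_axis[OF smooth_differentiable[OF \<phi>_smooth]]
    by (auto intro!: derivative_eq_intros)
  have D1: "partial_deriv k ?G y = (\<Sum>i\<in>UNIV. partial_deriv i g (w y) * partial_deriv k (\<phi> i) y)" for k y
    using has_real_derivative_along_path[OF smooth_differentiable[OF g_smooth] dw, of y k]
    by (intro partial_deriv_eqI) simp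
  have D2: "partial_deriv k (\<lambda>y. \<Sum>i\<in>UNIV. partial_deriv i g (w y) * partial_deriv k (\<phi> i) y) y
    = (\<Sum>i\<in>UNIV. (\<Sum>j\<in>UNIV. partial_deriv j (partial_deriv i g) (w y) * partial_deriv k (\<phi> j) y) * partial_deriv k (\<phi> i) y
        + partial_deriv k (partial_deriv k (\<phi> i)) y * partial_deriv i g (w y))" for k y
  proof (intro partial_deriv_eqI DERIV_sum)
    fix i
    have "((\<lambda>t. partial_deriv i g (w (y + t *\<^sub>R axis k 1))) has_real_derivative
      (\<Sum>j\<in>UNIV. partial_deriv j (partial_deriv i g) (w y) * partial_deriv k (\<phi> j) y)) (at 0)"
      using has_real_derivative_along_path[OF smooth_differentiable[OF smooth_partial_deriv[OF g_smooth]] dw, of i y k] by simp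
    from DERIV_mult[OF this has_real_derivative_axis[OF smooth_differentiable[OF smooth_partial_deriv[OF \<phi>_smooth]], of k i y k]]
    show "((\<lambda>t. partial_deriv i g (w (y + t *\<^sub>R axis k 1)) * partial_deriv k (\<phi> i) (y + t *\<^sub>R axis k 1)) has_real_derivative
      (\<Sum>j\<in>UNIV. partial_deriv j (partial_deriv i g) (w y) * partial_deriv k (\<phi> j) y) * partial_deriv k (\<phi> i) y
        + partial_deriv k (partial_deriv k (\<phi> i)) y * partial_deriv i g (w y)) (at 0)" by simp
  qed
  have F1: "partial_deriv k ?F y = partial_deriv k ?G y" if "y \<in> S" for k y
    by (rule partial_deriv_cong_open[OF S(1) that FG])
  have "grad_point x F \<gamma> = (\<chi> k. \<Sum>i\<in>UNIV. partial_deriv i g (pairings \<gamma>) * partial_deriv k (\<phi> i) x)"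
    unfolding grad_point_def grad_def F1[OF S(2)] D1 wx ..
  then show "grad_point x F \<gamma> = cyl_grad (pairings \<gamma>) x"
    by (simp add: cyl_grad_def grad_def vec_eq_iff)
  have "partial_deriv k (partial_deriv k ?F) x = partial_deriv k (partial_deriv k ?G) x" for k
    by (rule partial_deriv_cong_open[OF S F1])
  then have "laplacian_point x F \<gamma> = (\<Sum>k\<in>UNIV. \<Sum>i\<in>UNIV.
      (\<Sum>j\<in>UNIV. partial_deriv j (partial_deriv i g) (pairings \<gamma>) * partial_deriv k (\<phi> j) x) * partial_deriv k (\<phi> i) x
        + partial_deriv k (partial_deriv k (\<phi> i)) x * partial_deriv i g (pairings \<gamma>))"
    unfolding laplacian_point_def laplacian_def D1 D2 wx by simp
  also have "\<dots> = (\<Sum>i\<in>UNIV. \<Sum>k\<in>UNIV.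
      (\<Sum>j\<in>UNIV. partial_deriv j (partial_deriv i g) (pairings \<gamma>) * partial_deriv k (\<phi> j) x) * partial_deriv k (\<phi> i) x
        + partial_deriv k (partial_deriv k (\<phi> i)) x * partial_deriv i g (pairings \<gamma>))"
    by (rule sum.swap)
  also have "\<dots> = cyl_lap (pairings \<gamma>) x"
    unfolding cyl_lap_def
  proof (intro sum.cong refl)
    fix i
    have "(\<Sum>k\<in>UNIV. (\<Sum>j\<in>UNIV. partial_deriv j (partial_deriv i g) (pairings \<gamma>) * partial_deriv k (\<phi> j) x) * partial_deriv k (\<phi> i) x)
      = (\<Sum>k\<in>UNIV. \<Sum>j\<in>UNIV. partial_deriv j (partial_deriv i g) (pairings \<gamma>) * (partial_deriv k (\<phi> j) x * partial_deriv k (\<phi> i) x))"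
      by (simp add: sum_distrib_right mult.assoc)
    also have "\<dots> = (\<Sum>j\<in>UNIV. \<Sum>k\<in>UNIV. partial_deriv j (partial_deriv i g) (pairings \<gamma>) * (partial_deriv k (\<phi> j) x * partial_deriv k (\<phi> i) x))"
      by (rule sum.swap)
    also have "\<dots> = (\<Sum>j\<in>UNIV. partial_deriv j (partial_deriv i g) (pairings \<gamma>) * (grad (\<phi> j) x \<bullet> grad (\<phi> i) x))"
      by (simp add: grad_def inner_vec_def sum_distrib_left)
    finally show "(\<Sum>k\<in>UNIV. (\<Sum>j\<in>UNIV. partial_deriv j (partial_deriv i g) (pairings \<gamma>) * partial_deriv k (\<phi> j) x) * partial_deriv k (\<phi> i) x
        + partial_deriv k (partial_deriv k (\<phi> i)) x * partial_deriv i g (pairings \<gamma>))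
      = (\<Sum>j\<in>UNIV. partial_deriv j (partial_deriv i g) (pairings \<gamma>) * (grad (\<phi> j) x \<bullet> grad (\<phi> i) x)) + partial_deriv i g (pairings \<gamma>) * laplacian (\<phi> i) x"
      by (simp add: sum.distrib laplacian_def sum_distrib_left mult.commute)
  qed
  finally show "laplacian_point x F \<gamma> = cyl_lap (pairings \<gamma>) x" .
qed

end

section \<open>The generators as sums over pairs of distinct points\<close>

lemma integral_lborel_scale:
  fixes f :: "'a::euclidean_space \<Rightarrow> real"
  assumes [measurable]: "f \<in> borel_measurable borel" and e: "e > 0"
  shows "(\<integral>x. f x \<partial>lborel) = e ^ DIM('a) * (\<integral>x. f (e *\<^sub>R x) \<partial>lborel)"
proof -
  have "(\<integral>x. f x \<partial>lborel) =
      (\<integral>x. f x \<partial>density (distr lborel borel (\<lambda>x::'a. 0 + e *\<^sub>R x)) (\<lambda>_. ennreal (\<bar>e\<bar> ^ DIM('a))))"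
    using lborel_affine[of e "0::'a"] e by simp
  also have "\<dots> = e ^ DIM('a) * (\<integral>x. f (e *\<^sub>R x) \<partial>lborel)"
    using e by (subst integral_density) (auto simp: integral_distr)
  finally show ?thesis .
qed

context scaled_dynamics begin

text \<open>A jump to a point occupied by another particle would lose a particle, but such jumps form a
  countable set and hence a null set in each variable; outside it the configuration after the jump
  has pairings \<open>moved\<close>. Substituting \<open>\<epsilon> h\<close> for each jump produces \<open>\<epsilon>\<close> to the power of twice the
  dimension.\<close>

lemma L_eps_term_eq:
  assumes F: "\<And>\<gamma>. \<gamma> \<in> Config \<Longrightarrow> F \<gamma> = g (pairings \<gamma>)" and gam: "\<gamma> \<in> Config" and \<epsilon>: "\<epsilon> > 0"
    and x: "x1 \<in> \<gamma>" "x2 \<in> \<gamma>" "x1 \<noteq> x2"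
  shows "L_eps_term a b \<epsilon> F \<gamma> x1 x2 = pair_term \<epsilon> (pairings \<gamma>) x1 x2"
proof -
  let ?d = "CARD('d)" and ?g = "\<gamma> - {x1, x2}"
  define Z where "Z = (\<lambda>h1 h2. (1 / \<epsilon> ^ (2 * ?d + 2)) * \<alpha> (h1 /\<^sub>R \<epsilon>) * \<alpha> (h2 /\<^sub>R \<epsilon>) *
     (b (x2 - x1) + b (x2 - x1 + h2 - h1)) * (g (moved (pairings \<gamma>) x1 x2 h1 h2) - g (pairings \<gamma>)))"
  have Z_measurable[measurable]: "(\<lambda>w. Z (f w) (f' w)) \<in> borel_measurable M"
    if [measurable]: "f \<in> borel_measurable M" "f' \<in> borel_measurable M" for f f' and M :: "'x measure"
    unfolding Z_def moved_def by measurable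
  have cnt: "countable ?g" using Config_countable[OF gam] by simp
  have q: "enn2real (q_rate a b \<epsilon> (x2 - x1) h1 h2) =
     (1 / \<epsilon> ^ (2 * ?d + 2)) * \<alpha> (h1 /\<^sub>R \<epsilon>) * \<alpha> (h2 /\<^sub>R \<epsilon>) * (b (x2 - x1) + b (x2 - x1 + h2 - h1))" for h1 h2
  proof -
    have "\<epsilon> powi (- 2 * int ?d - 2) = 1 / \<epsilon> ^ (2 * ?d + 2)"
    proof -
      have "- 2 * int ?d - 2 = - int (2 * ?d + 2)" by simp
      then show ?thesis by (simp only: power_int_minus power_int_of_nat inverse_eq_divide)
    qed
    then show ?thesis
      using \<epsilon> b_nonneg by (simp add: q_rate_def enn2real_mult \<alpha>_def add_nonneg_nonneg del: ennreal_plus)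
  qed
  have inner: "(\<integral>h2. enn2real (q_rate a b \<epsilon> (x2 - x1) h1 h2) * (F (?g \<union> {x1 + h1, x2 + h2}) - F \<gamma>) \<partial>lborel)
      = (\<integral>h2. Z h1 h2 \<partial>lborel)" if h1: "h1 \<notin> (\<lambda>y. y - x1) ` ?g" for h1
  proof (rule integral_discrete_difference[where X = "(\<lambda>y. y - x2) ` (insert (x1 + h1) ?g)"])
    fix h2 assume h2: "h2 \<notin> (\<lambda>y. y - x2) ` (insert (x1 + h1) ?g)"
    have n1: "x1 + h1 \<notin> ?g"
    proof
      assume "x1 + h1 \<in> ?g"
      then have "x1 + h1 - x1 \<in> (\<lambda>y. y - x1) ` ?g" by (rule imageI)
      then show False using h1 by simp
    qed
    have n2: "x2 + h2 \<notin> insert (x1 + h1) ?g"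
    proof
      assume "x2 + h2 \<in> insert (x1 + h1) ?g"
      then have "x2 + h2 - x2 \<in> (\<lambda>y. y - x2) ` (insert (x1 + h1) ?g)" by (rule imageI)
      then show False using h2 by simp
    qed
    have "F (?g \<union> {x1 + h1, x2 + h2}) = g (moved (pairings \<gamma>) x1 x2 h1 h2)"
    proof -
      have n: "x1 + h1 \<notin> ?g" "x2 + h2 \<notin> ?g" "x1 + h1 \<noteq> x2 + h2" using n1 n2 by auto
      show ?thesis by (simp only: F[OF pairings_replace_pair(2)[OF gam x n]] pairings_replace_pair(1)[OF gam x n])
    qed
    then show "enn2real (q_rate a b \<epsilon> (x2 - x1) h1 h2) * (F (?g \<union> {x1 + h1, x2 + h2}) - F \<gamma>) = Z h1 h2"
      by (simp add: q Z_def F[OF gam])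
  qed (use cnt in auto)
  have "L_eps_term a b \<epsilon> F \<gamma> x1 x2 = (\<integral>h1. \<integral>h2. Z h1 h2 \<partial>lborel \<partial>lborel)"
    unfolding L_eps_term_def
    by (rule integral_discrete_difference[where X = "(\<lambda>y. y - x1) ` ?g"]) (use cnt inner in auto)
  also have "\<dots> = (\<integral>h1. \<epsilon> ^ ?d * (\<integral>h2. Z h1 (\<epsilon> *\<^sub>R h2) \<partial>lborel) \<partial>lborel)"
    by (intro Bochner_Integration.integral_cong refl, subst integral_lborel_scale[OF _ \<epsilon>]) auto
  also have "\<dots> = \<epsilon> ^ ?d * (\<integral>h1. \<integral>h2. Z h1 (\<epsilon> *\<^sub>R h2) \<partial>lborel \<partial>lborel)" by simp
  also have "(\<integral>h1. \<integral>h2. Z h1 (\<epsilon> *\<^sub>R h2) \<partial>lborel \<partial>lborel)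
      = \<epsilon> ^ ?d * (\<integral>h1. \<integral>h2. Z (\<epsilon> *\<^sub>R h1) (\<epsilon> *\<^sub>R h2) \<partial>lborel \<partial>lborel)"
    by (subst integral_lborel_scale[OF _ \<epsilon>]) auto
  also have "(\<integral>h1. \<integral>h2. Z (\<epsilon> *\<^sub>R h1) (\<epsilon> *\<^sub>R h2) \<partial>lborel \<partial>lborel)
      = (\<integral>h1. (1 / \<epsilon> ^ (2 * ?d + 2)) * (\<alpha> h1 * (\<integral>h2. \<alpha> h2 * integrand \<epsilon> (pairings \<gamma>) x1 x2 (h1, h2) \<partial>lborel)) \<partial>lborel)"
  proof (intro Bochner_Integration.integral_cong refl)
    fix h1
    have "Z (\<epsilon> *\<^sub>R h1) (\<epsilon> *\<^sub>R h2) = (1 / \<epsilon> ^ (2 * ?d + 2) * \<alpha> h1) * (\<alpha> h2 * integrand \<epsilon> (pairings \<gamma>) x1 x2 (h1, h2))" for h2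
      using \<epsilon> by (simp add: Z_def integrand_def scaleR_diff_right add_diff_eq mult_ac)
    then show "(\<integral>h2. Z (\<epsilon> *\<^sub>R h1) (\<epsilon> *\<^sub>R h2) \<partial>lborel) =
      1 / \<epsilon> ^ (2 * ?d + 2) * (\<alpha> h1 * (\<integral>h2. \<alpha> h2 * integrand \<epsilon> (pairings \<gamma>) x1 x2 (h1, h2) \<partial>lborel))"
      by (simp only: integral_mult_right_zero mult.assoc)
  qed
  also have "\<dots> = (1 / \<epsilon> ^ (2 * ?d + 2)) * (\<integral>h1. \<alpha> h1 * (\<integral>h2. integrand \<epsilon> (pairings \<gamma>) x1 x2 (h1, h2) \<partial>\<mu>) \<partial>lborel)"
    by (simp only: integral_mult_right_zero) (simp add: integral_\<mu>)
  also have "(\<integral>h1. \<alpha> h1 * (\<integral>h2. integrand \<epsilon> (pairings \<gamma>) x1 x2 (h1, h2) \<partial>\<mu>) \<partial>lborel)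
      = (\<integral>h1. \<integral>h2. integrand \<epsilon> (pairings \<gamma>) x1 x2 (h1, h2) \<partial>\<mu> \<partial>\<mu>)"
    by (rule integral_\<mu>[symmetric]) measurable
  also have "\<dots> = (\<integral>h. integrand \<epsilon> (pairings \<gamma>) x1 x2 h \<partial>\<nu>)"
    by (rule integral_\<nu>_iterated[symmetric, OF integrand_integrable])
  also have "\<epsilon> ^ ?d * (\<epsilon> ^ ?d * (1 / \<epsilon> ^ (2 * ?d + 2) * (\<integral>h. integrand \<epsilon> (pairings \<gamma>) x1 x2 h \<partial>\<nu>))) = pair_term \<epsilon> (pairings \<gamma>) x1 x2"
  proof -
    have "\<epsilon> ^ (2 * ?d + 2) = \<epsilon> ^ ?d * \<epsilon> ^ ?d * \<epsilon>\<^sup>2" by (simp only: power_add mult_2)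
    then show ?thesis using \<epsilon> by (simp add: pair_term_def)
  qed
  finally show ?thesis .
qed

text \<open>By symmetry it is irrelevant which enumeration of the pair is chosen.\<close>

lemma L_eps_pair_eq:
  assumes F: "\<And>\<gamma>. \<gamma> \<in> Config \<Longrightarrow> F \<gamma> = g (pairings \<gamma>)" and gam: "\<gamma> \<in> Config" and \<epsilon>: "\<epsilon> > 0"
    and x: "x \<in> \<gamma>" "y \<in> \<gamma>" "x \<noteq> y"
  shows "L_eps_pair a b \<epsilon> F \<gamma> {x, y} = pair_term \<epsilon> (pairings \<gamma>) x y"
proof -
  let ?p = "SOME (x1, x2). {x, y} = {x1, x2}"
  have "case ?p of (x1, x2) \<Rightarrow> {x, y} = {x1, x2}"
    by (rule someI[of "\<lambda>(x1, x2). {x, y} = {x1, x2}" "(x, y)"]) simp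
  then have "?p = (x, y) \<or> ?p = (y, x)" by (auto simp: doubleton_eq_iff split: prod.splits)
  then show ?thesis
    unfolding L_eps_pair_def
    using L_eps_term_eq[OF F gam \<epsilon>] x pair_term_commute[of \<epsilon> "pairings \<gamma>" x y] by auto
qed

lemma L_eps_eq:
  assumes F: "\<And>\<gamma>. \<gamma> \<in> Config \<Longrightarrow> F \<gamma> = g (pairings \<gamma>)" and gam: "\<gamma> \<in> Config" and \<epsilon>: "\<epsilon> > 0"
  shows "L_eps a b \<epsilon> F \<gamma> = (\<integral>p. pair_term \<epsilon> (pairings \<gamma>) (fst p) (snd p) \<partial>count_space (offdiag \<gamma>)) / 2"
    and "integrable (count_space (offdiag \<gamma>)) (\<lambda>p. pair_term \<epsilon> (pairings \<gamma>) (fst p) (snd p)) \<Longrightarrow> L_eps_converges a b \<epsilon> F \<gamma>"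
proof -
  note I = integral_pairs[OF Config_countable[OF gam], of "L_eps_pair a b \<epsilon> F \<gamma>" "\<lambda>p. pair_term \<epsilon> (pairings \<gamma>) (fst p) (snd p)"]
  show "L_eps a b \<epsilon> F \<gamma> = (\<integral>p. pair_term \<epsilon> (pairings \<gamma>) (fst p) (snd p) \<partial>count_space (offdiag \<gamma>)) / 2"
    unfolding L_eps_def infsum_real_eq_integral
    by (rule I(1)) (simp add: L_eps_pair_eq[OF F gam \<epsilon>])
  assume "integrable (count_space (offdiag \<gamma>)) (\<lambda>p. pair_term \<epsilon> (pairings \<gamma>) (fst p) (snd p))"
  then have "integrable (count_space (pairs \<gamma>)) (L_eps_pair a b \<epsilon> F \<gamma>)"
    by (intro I(2)) (simp_all add: L_eps_pair_eq[OF F gam \<epsilon>])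
  then show "L_eps_converges a b \<epsilon> F \<gamma>"
    unfolding L_eps_converges_def abs_summable_equivalent abs_summable_on_def .
qed

text \<open>Putting the summand to \<open>0\<close> at \<open>x\<close> makes the range of summation independent of \<open>x\<close>, in the form in which
  sums over points were shown to be measurable.\<close>

lemma L_zero_term_eq:
  assumes F: "\<And>\<gamma>. \<gamma> \<in> Config \<Longrightarrow> F \<gamma> = g (pairings \<gamma>)" and gam: "\<gamma> \<in> Config" and x: "x \<in> \<gamma>"
  shows "L_zero_term b F \<gamma> x =
    cyl_lap (pairings \<gamma>) x * (\<integral>y. (if y = x then 0 else b (x - y)) \<partial>count_space \<gamma>) +
    cyl_grad (pairings \<gamma>) x \<bullet> (\<integral>y. (if y = x then 0 else grad b (x - y)) \<partial>count_space \<gamma>)"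
proof -
  have "(\<Sum>\<^sub>\<infinity>y\<in>\<gamma> - {x}. b (x - y)) = (\<Sum>\<^sub>\<infinity>y\<in>\<gamma>. if y = x then 0 else b (x - y))"
    "(\<Sum>\<^sub>\<infinity>y\<in>\<gamma> - {x}. grad b (x - y)) = (\<Sum>\<^sub>\<infinity>y\<in>\<gamma>. if y = x then 0 else grad b (x - y))"
    by (intro infsum_cong_neutral; auto)+
  then show ?thesis
    by (simp add: L_zero_term_def grad_laplacian_point[OF F gam x] infsum_real_eq_integral infsum_vec_eq_integral)
qed

text \<open>Absolute convergence of the double sum, in the form of the bound for each ball, permits summing
  over \<open>y\<close> first.\<close>

lemma L_zero_eq:
  assumes F: "\<And>\<gamma>. \<gamma> \<in> Config \<Longrightarrow> F \<gamma> = g (pairings \<gamma>)" and gam: "\<gamma> \<in> Config"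
    and fin: "\<And>R. (\<integral>\<^sup>+p. ennreal (indicator (cball 0 R) (fst p) * (b (fst p - snd p) + norm (grad b (fst p - snd p))))
        \<partial>count_space (offdiag \<gamma>)) < \<infinity>"
  shows "L_zero_converges b F \<gamma>"
    and "L_zero c b F \<gamma> = c * (\<integral>p. lim_term (pairings \<gamma>) (fst p) (snd p) \<partial>count_space (offdiag \<gamma>))"
    and "integrable (count_space (offdiag \<gamma>)) (\<lambda>p. lim_term (pairings \<gamma>) (fst p) (snd p))"
proof -
  have cg: "countable \<gamma>" "countable (\<gamma> - {x})" for x using Config_countable[OF gam] by auto
  let ?B = "\<lambda>R p. indicator (cball 0 R) (fst p) * (b (fst p - snd p) + norm (grad b (fst p - snd p)))"
  have B0: "?B R p \<ge> 0" for R p by (intro mult_nonneg_nonneg add_nonneg_nonneg b_nonneg) auto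
  have B_int: "integrable (count_space (offdiag \<gamma>)) (?B R)" for R
    using fin[of R] B0 by (simp add: integrable_iff_bounded)
  have B_int_x: "integrable (count_space (\<gamma> - {x})) (\<lambda>y. b (x - y) + norm (grad b (x - y)))" if x: "x \<in> \<gamma>" for x
  proof -
    have "Infinite_Set_Sum.abs_summable_on (?B (norm x)) (Sigma \<gamma> (\<lambda>x. \<gamma> - {x}))"
      using B_int unfolding abs_summable_on_def offdiag_def by blast
    then have "Infinite_Set_Sum.abs_summable_on (\<lambda>y. ?B (norm x) (x, y)) (\<gamma> - {x})"
      using cg x by (subst (asm) abs_summable_on_Sigma_iff) auto
    then show ?thesis by (simp add: abs_summable_on_def)
  qed
  have b_int: "integrable (count_space (\<gamma> - {x})) (\<lambda>y. b (x - y))" if x: "x \<in> \<gamma>" for x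
    by (rule Bochner_Integration.integrable_bound[OF B_int_x[OF x]]) (auto simp: b_nonneg intro!: AE_I2)
  have gb_int: "integrable (count_space (\<gamma> - {x})) (\<lambda>y. grad b (x - y))" if x: "x \<in> \<gamma>" for x
    by (rule Bochner_Integration.integrable_bound[OF B_int_x[OF x]]) (auto simp: b_nonneg intro!: AE_I2)
  have term_eq: "L_zero_term b F \<gamma> x = (\<integral>y. lim_term (pairings \<gamma>) x y \<partial>count_space (\<gamma> - {x}))" if x: "x \<in> \<gamma>" for x
  proof -
    have "(\<integral>y. lim_term (pairings \<gamma>) x y \<partial>count_space (\<gamma> - {x})) =
       cyl_lap (pairings \<gamma>) x * (\<integral>y. b (x - y) \<partial>count_space (\<gamma> - {x}))
       + cyl_grad (pairings \<gamma>) x \<bullet> (\<integral>y. grad b (x - y) \<partial>count_space (\<gamma> - {x}))"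
      unfolding lim_term_def using b_int[OF x] gb_int[OF x] by simp
    then show ?thesis
      by (simp add: L_zero_term_def grad_laplacian_point[OF F gam x] infsum_real_eq_integral infsum_vec_eq_integral)
  qed
  obtain K R where K: "K \<ge> 0" and KR: "\<And>v x. \<bar>cyl_lap v x\<bar> \<le> K * indicator (cball 0 R) x \<and>
    norm (cyl_grad v x) \<le> K * indicator (cball 0 R) x" using cyl_lap_grad_bound by blast
  have lim_bound: "\<bar>lim_term v (fst p) (snd p)\<bar> \<le> K * ?B R p" for v p
  proof -
    have "\<bar>lim_term v (fst p) (snd p)\<bar> \<le> \<bar>cyl_lap v (fst p)\<bar> * b (fst p - snd p)
        + norm (cyl_grad v (fst p)) * norm (grad b (fst p - snd p))"
      unfolding lim_term_def
      by (rule order_trans[OF abs_triangle_ineq add_mono])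
        (auto simp: abs_mult b_nonneg Cauchy_Schwarz_ineq2)
    also have "\<dots> \<le> (K * indicator (cball 0 R) (fst p)) * b (fst p - snd p)
        + (K * indicator (cball 0 R) (fst p)) * norm (grad b (fst p - snd p))"
      using KR[of v "fst p"] b_nonneg by (intro add_mono mult_right_mono) auto
    finally show ?thesis by (simp add: algebra_simps)
  qed
  show lim_int: "integrable (count_space (offdiag \<gamma>)) (\<lambda>p. lim_term (pairings \<gamma>) (fst p) (snd p))"
  proof (rule Bochner_Integration.integrable_bound[OF integrable_mult_right[OF B_int[of R], of K]])
    show "AE p in count_space (offdiag \<gamma>). norm (lim_term (pairings \<gamma>) (fst p) (snd p)) \<le> norm (K * ?B R p)"
      unfolding real_norm_def by (rule AE_I2) (rule order_trans[OF lim_bound abs_ge_self])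
  qed simp
  then have lim_sum: "Infinite_Set_Sum.abs_summable_on (\<lambda>p. lim_term (pairings \<gamma>) (fst p) (snd p)) (Sigma \<gamma> (\<lambda>x. \<gamma> - {x}))"
    by (simp add: abs_summable_on_def offdiag_def)
  have "(\<integral>p. lim_term (pairings \<gamma>) (fst p) (snd p) \<partial>count_space (offdiag \<gamma>))
      = (\<integral>x. (\<integral>y. lim_term (pairings \<gamma>) x y \<partial>count_space (\<gamma> - {x})) \<partial>count_space \<gamma>)"
    using infsetsum_Sigma[OF cg(1) cg(2) lim_sum] by (simp add: infsetsum_def offdiag_def)
  also have "\<dots> = (\<integral>x. L_zero_term b F \<gamma> x \<partial>count_space \<gamma>)"
    by (intro Bochner_Integration.integral_cong refl) (simp add: term_eq)
  finally show "L_zero c b F \<gamma> = c * (\<integral>p. lim_term (pairings \<gamma>) (fst p) (snd p) \<partial>count_space (offdiag \<gamma>))"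
    by (simp add: L_zero_def infsum_real_eq_integral)
  have "Infinite_Set_Sum.abs_summable_on (\<lambda>x. infsetsum (\<lambda>y. norm (lim_term (pairings \<gamma>) x y)) (\<gamma> - {x})) \<gamma>"
    using lim_sum cg by (subst (asm) abs_summable_on_Sigma_iff) auto
  then have "integrable (count_space \<gamma>) (\<lambda>x. \<integral>y. norm (lim_term (pairings \<gamma>) x y) \<partial>count_space (\<gamma> - {x}))"
    by (simp add: abs_summable_on_def infsetsum_def)
  then have "integrable (count_space \<gamma>) (L_zero_term b F \<gamma>)"
    by (rule Bochner_Integration.integrable_bound)
      (auto intro!: AE_I2 order_trans[OF integral_norm_bound] simp: term_eq)
  then have s1: "(\<lambda>x. norm (L_zero_term b F \<gamma> x)) summable_on \<gamma>"
    unfolding abs_summable_equivalent abs_summable_on_def .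
  show "L_zero_converges b F \<gamma>"
    unfolding L_zero_converges_def
  proof (intro conjI ballI s1)
    fix x assume x: "x \<in> \<gamma>"
    show "(\<lambda>y. norm (b (x - y))) summable_on (\<gamma> - {x})"
      using b_int[OF x] unfolding abs_summable_equivalent abs_summable_on_def .
    show "(\<lambda>y. norm (grad b (x - y))) summable_on (\<gamma> - {x})"
      using gb_int[OF x] unfolding abs_summable_equivalent abs_summable_on_def .
  qed
qed

end

section \<open>Convergence of the generators\<close>

lemma ennreal_abs_integral_le:
  fixes f :: "'a \<Rightarrow> real"
  shows "ennreal \<bar>\<integral>x. f x \<partial>M\<bar> \<le> (\<integral>\<^sup>+x. ennreal \<bar>f x\<bar> \<partial>M)"
proof (cases "integrable M f")
  case True
  then show ?thesis using integral_norm_bound_ennreal[OF True] by simp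
qed (simp add: not_integrable_integral_eq)

lemma L2_space_dominated:
  assumes f: "f \<in> borel_measurable P" and U: "U \<in> borel_measurable P" "(\<integral>\<^sup>+\<gamma>. (U \<gamma>)\<^sup>2 \<partial>P) < \<infinity>"
    and bound: "AE \<gamma> in P. ennreal \<bar>f \<gamma>\<bar> \<le> ennreal C * U \<gamma>"
  shows "f \<in> L2_space P"
proof -
  have "(\<integral>\<^sup>+\<gamma>. ennreal (norm ((f \<gamma>)\<^sup>2)) \<partial>P) \<le> (\<integral>\<^sup>+\<gamma>. (ennreal C)\<^sup>2 * (U \<gamma>)\<^sup>2 \<partial>P)"
  proof (rule nn_integral_mono_AE, use bound in eventually_elim)
    case (elim \<gamma>)
    have "ennreal (norm ((f \<gamma>)\<^sup>2)) = (ennreal \<bar>f \<gamma>\<bar>)\<^sup>2" by (simp add: ennreal_power)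
    also have "\<dots> \<le> (ennreal C * U \<gamma>)\<^sup>2" using elim by (intro power_mono) auto
    finally show ?case by (simp add: power_mult_distrib)
  qed
  also have "\<dots> = (ennreal C)\<^sup>2 * (\<integral>\<^sup>+\<gamma>. (U \<gamma>)\<^sup>2 \<partial>P)" using U by (intro nn_integral_cmult) measurable
  also have "\<dots> < \<infinity>" using U(2) by (simp add: ennreal_mult_less_top power2_eq_square)
  finally show ?thesis using f by (simp add: L2_space_def integrable_iff_bounded)
qed

lemma AE_finite_of_square:
  fixes U :: "'a \<Rightarrow> ennreal"
  assumes U: "U \<in> borel_measurable P" "(\<integral>\<^sup>+\<gamma>. (U \<gamma>)\<^sup>2 \<partial>P) < \<infinity>"
  shows "AE \<gamma> in P. U \<gamma> < \<infinity>"
proof -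
  have "AE \<gamma> in P. (U \<gamma>)\<^sup>2 \<noteq> \<infinity>" using U by (intro nn_integral_PInf_AE) auto
  then show ?thesis by eventually_elim (auto simp: power2_eq_square less_top ennreal_mult_eq_top_iff)
qed

context cylinder_function begin

lemma near_mono: "R \<le> R' \<Longrightarrow> near R x y \<le> near R' x y"
  unfolding near_def by (intro add_mono) (auto simp: indicator_def)

text \<open>Exchanging the points in one half of the sum, one may assume that it is always the first point
  that lies in the ball; the kernel is then reflected in that half.\<close>

lemma near_pair_sums:
  fixes W D :: "real^'d \<Rightarrow> ennreal"
  assumes P: "is_Poisson_measure z P" and z: "z > 0"
    and W[measurable]: "W \<in> borel_measurable borel" and W_int: "(\<integral>\<^sup>+u. W u \<partial>lborel) < \<infinity>"
    and \<delta>: "\<delta> > 0" and D: "\<And>x u. norm (x - u) \<le> \<delta> \<Longrightarrow> D x \<le> W u"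
  shows "\<exists>U\<in>borel_measurable P. (\<integral>\<^sup>+\<gamma>. (U \<gamma>)\<^sup>2 \<partial>P) < \<infinity> \<and>
    (\<forall>\<gamma>\<in>Config. (\<integral>\<^sup>+p. ennreal (near R (fst p) (snd p)) * D (fst p - snd p) \<partial>count_space (offdiag \<gamma>)) \<le> U \<gamma>)"
proof -
  obtain U1 where U1[measurable]: "U1 \<in> borel_measurable P" and U1': "(\<integral>\<^sup>+\<gamma>. (U1 \<gamma>)\<^sup>2 \<partial>P) < \<infinity>"
    "\<And>\<gamma>. \<gamma> \<in> Config \<Longrightarrow> (\<integral>\<^sup>+(x, y). indicator (cball 0 R) x * D (x - y) \<partial>count_space (\<gamma> \<times> \<gamma>)) \<le> U1 \<gamma>"
    using pair_sum_square_integrable[OF P z W W_int \<delta>, of R "\<lambda>x y. D (x - y)"] D by blast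
  have W': "(\<lambda>u. W (0 - u)) \<in> borel_measurable borel" by measurable
  have W'_int: "(\<integral>\<^sup>+u. W (0 - u) \<partial>lborel) < \<infinity>" using W_int nn_integral_lborel_reflect[OF W, of 0] by simp
  have D': "D (y - x) \<le> W (0 - u)" if "norm (x - y - u) \<le> \<delta>" for x y u
    using that by (intro D) (simp add: norm_minus_commute algebra_simps)
  obtain U2 where U2[measurable]: "U2 \<in> borel_measurable P" and U2': "(\<integral>\<^sup>+\<gamma>. (U2 \<gamma>)\<^sup>2 \<partial>P) < \<infinity>"
    "\<And>\<gamma>. \<gamma> \<in> Config \<Longrightarrow> (\<integral>\<^sup>+(x, y). indicator (cball 0 R) x * D (y - x) \<partial>count_space (\<gamma> \<times> \<gamma>)) \<le> U2 \<gamma>"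
    using pair_sum_square_integrable[OF P z W' W'_int \<delta>, of R "\<lambda>x y. D (y - x)"] D' by blast
  have sub: "(\<integral>\<^sup>+p. f p \<partial>count_space (offdiag \<gamma>)) \<le> (\<integral>\<^sup>+p. f p \<partial>count_space (\<gamma> \<times> \<gamma>))"
    for f :: "(real^'d) \<times> (real^'d) \<Rightarrow> ennreal" and \<gamma>
    by (simp add: nn_integral_count_space_indicator) (intro nn_integral_mono mult_left_mono, auto simp: offdiag_def indicator_def)
  have "(\<integral>\<^sup>+p. ennreal (near R (fst p) (snd p)) * D (fst p - snd p) \<partial>count_space (offdiag \<gamma>)) \<le> U1 \<gamma> + U2 \<gamma>"
    if g: "\<gamma> \<in> Config" for \<gamma>
  proof -
    let ?A = "\<lambda>p. indicator (cball 0 R) (fst p) * D (fst p - snd p)"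
    let ?B = "\<lambda>p. indicator (cball 0 R) (fst p) * D (snd p - fst p)"
    have "(\<integral>\<^sup>+p. ennreal (near R (fst p) (snd p)) * D (fst p - snd p) \<partial>count_space (offdiag \<gamma>))
       = (\<integral>\<^sup>+p. ?A p + ?B (snd p, fst p) \<partial>count_space (offdiag \<gamma>))"
      by (intro nn_integral_cong) (simp add: near_def ennreal_plus distrib_right ennreal_indicator)
    also have "\<dots> = (\<integral>\<^sup>+p. ?A p \<partial>count_space (offdiag \<gamma>)) + (\<integral>\<^sup>+p. ?B (snd p, fst p) \<partial>count_space (offdiag \<gamma>))"
      by (rule nn_integral_add) auto
    also have "(\<integral>\<^sup>+p. ?B (snd p, fst p) \<partial>count_space (offdiag \<gamma>)) = (\<integral>\<^sup>+p. ?B p \<partial>count_space (offdiag \<gamma>))"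
      by (rule nn_integral_offdiag_swap)
    also have "(\<integral>\<^sup>+p. ?A p \<partial>count_space (offdiag \<gamma>)) + (\<integral>\<^sup>+p. ?B p \<partial>count_space (offdiag \<gamma>)) \<le> U1 \<gamma> + U2 \<gamma>"
      using order_trans[OF sub U1'(2)[OF g, unfolded split_beta']] order_trans[OF sub U2'(2)[OF g, unfolded split_beta']]
      by (intro add_mono)
    finally show ?thesis .
  qed
  moreover have "(\<integral>\<^sup>+\<gamma>. (U1 \<gamma> + U2 \<gamma>)\<^sup>2 \<partial>P) < \<infinity>"
  proof -
    have sq: "(a + b)\<^sup>2 \<le> 4 * a\<^sup>2 + 4 * b\<^sup>2" for a b :: ennreal
    proof -
      have "(a + b)\<^sup>2 \<le> (2 * max a b)\<^sup>2"
        by (intro power_mono) (auto simp: mult_2 intro!: add_mono)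
      also have "\<dots> = 4 * (max a b)\<^sup>2" by (simp add: power_mult_distrib)
      also have "\<dots> \<le> 4 * a\<^sup>2 + 4 * b\<^sup>2" by (auto simp: max_def)
      finally show ?thesis .
    qed
    have "(\<integral>\<^sup>+\<gamma>. (U1 \<gamma> + U2 \<gamma>)\<^sup>2 \<partial>P) \<le> (\<integral>\<^sup>+\<gamma>. 4 * (U1 \<gamma>)\<^sup>2 + 4 * (U2 \<gamma>)\<^sup>2 \<partial>P)"
      by (intro nn_integral_mono sq)
    also have "\<dots> = 4 * (\<integral>\<^sup>+\<gamma>. (U1 \<gamma>)\<^sup>2 \<partial>P) + 4 * (\<integral>\<^sup>+\<gamma>. (U2 \<gamma>)\<^sup>2 \<partial>P)"
      by (simp add: nn_integral_add nn_integral_cmult)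
    also have "\<dots> < \<infinity>" using U1'(1) U2'(1) by (simp add: ennreal_mult_less_top)
    finally show ?thesis .
  qed
  ultimately show ?thesis by (intro bexI[of _ "\<lambda>\<gamma>. U1 \<gamma> + U2 \<gamma>"]) auto
qed

end

text \<open>The radius in the hypothesis on the gradient is \<open>2 \<delta>\<close>: bounds are stated with suprema over radius
  \<open>\<delta>\<close>, and the doubling in \<open>weight_shift_le\<close> uses up the rest.\<close>

locale poisson_dynamics = scaled_dynamics a r \<phi> g b
  for a :: "real^'d::finite \<Rightarrow> ennreal" and r :: real
    and \<phi> :: "'n::finite \<Rightarrow> real^'d \<Rightarrow> real" and g :: "real^'n \<Rightarrow> real" and b :: "real^'d \<Rightarrow> real" +
  fixes z :: real and P :: "(real^'d) set measure" and F :: "(real^'d) set \<Rightarrow> real" and \<delta> :: real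
  assumes Poisson: "is_Poisson_measure z P" and z_pos: "z > 0"
    and F_cyl: "\<And>\<gamma>. \<gamma> \<in> Config \<Longrightarrow> F \<gamma> = g (pairings \<gamma>)"
    and b_integrable: "integrable lborel b"
    and \<delta>_pos: "\<delta> > 0" and gsup_integrable: "(\<integral>\<^sup>+x. ennreal (gsup (2 * \<delta>) x) \<partial>lborel) < \<infinity>"
begin

lemma space_P: "space P = Config" using Poisson by (simp add: is_Poisson_measure_def)

sublocale prob_space P using Poisson by (simp add: is_Poisson_measure_def)

sublocale points: random_configuration P "\<lambda>\<gamma>. \<gamma>" by (rule is_Poisson_measure_random_configuration[OF Poisson])

lemma pairings_measurable [measurable]: "pairings \<in> borel_measurable P"
proof -
  have [measurable]: "(\<lambda>\<gamma>. pairing (\<phi> i) \<gamma>) \<in> borel_measurable P" for i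
    unfolding pairing_def infsum_real_eq_integral
    using points.integral_points_measurable[of "\<lambda>p. \<phi> i (snd p)"] by simp
  show ?thesis unfolding pairings_def by measurable
qed

lemma L_eps_measurable:
  assumes "\<epsilon> > 0" shows "L_eps a b \<epsilon> F \<in> borel_measurable P"
proof -
  have "(\<lambda>\<gamma>. \<integral>p. pair_term \<epsilon> (pairings \<gamma>) (fst p) (snd p) \<partial>count_space (offdiag \<gamma>)) \<in> borel_measurable P"
    using points.integral_offdiag_measurable[of "\<lambda>w. pair_term \<epsilon> (pairings (fst w)) (fst (snd w)) (snd (snd w))"] by simp
  then have "(\<lambda>\<gamma>. (\<integral>p. pair_term \<epsilon> (pairings \<gamma>) (fst p) (snd p) \<partial>count_space (offdiag \<gamma>)) / 2) \<in> borel_measurable P" by measurable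
  then show ?thesis
    by (rule measurable_cong[THEN iffD1, rotated]) (simp add: space_P L_eps_eq(1)[OF F_cyl _ assms])
qed

lemma L_zero_measurable: "L_zero c b F \<in> borel_measurable P"
proof -
  interpret R: random_configuration "P \<Otimes>\<^sub>M borel" "\<lambda>q. fst q" by (rule points.random_configuration_pair_fst)
  have [measurable]: "(\<lambda>q. \<integral>y. (if y = snd q then 0 else b (snd q - y)) \<partial>count_space (fst q)) \<in> borel_measurable (P \<Otimes>\<^sub>M borel)"
    using R.integral_points_measurable[of "\<lambda>s. if snd s = snd (fst s) then 0 else b (snd (fst s) - snd s)"] by (simp cong: if_cong)
  have [measurable]: "(\<lambda>q. \<integral>y. (if y = snd q then 0 else grad b (snd q - y)) \<partial>count_space (fst q)) \<in> borel_measurable (P \<Otimes>\<^sub>M borel)"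
    using R.integral_vec_points_measurable[of "\<lambda>s. if snd s = snd (fst s) then 0 else grad b (snd (fst s) - snd s)"] by (simp cong: if_cong)
  have [measurable]: "partial_deriv i g \<in> borel_measurable borel" "partial_deriv j (partial_deriv i g) \<in> borel_measurable borel"
    "grad (\<phi> i) \<in> borel_measurable borel" "partial_deriv k (partial_deriv k (\<phi> i)) \<in> borel_measurable borel" for i j k
    by (intro borel_measurable_continuous_onI smooth_continuous smooth_grad_continuous smooth_partial_deriv g_smooth \<phi>_smooth)+
  define K where "K = (\<lambda>q. cyl_lap (pairings (fst q)) (snd q) * (\<integral>y. (if y = snd q then 0 else b (snd q - y)) \<partial>count_space (fst q)) +
    cyl_grad (pairings (fst q)) (snd q) \<bullet> (\<integral>y. (if y = snd q then 0 else grad b (snd q - y)) \<partial>count_space (fst q)))"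
  have "K \<in> borel_measurable (P \<Otimes>\<^sub>M borel)"
    unfolding K_def cyl_lap_def cyl_grad_def laplacian_def by measurable
  from points.integral_points_measurable[OF this]
  have "(\<lambda>\<gamma>. c * (\<integral>x. K (\<gamma>, x) \<partial>count_space \<gamma>)) \<in> borel_measurable P" by measurable
  then show ?thesis
  proof (rule measurable_cong[THEN iffD1, rotated])
    fix \<gamma> assume "\<gamma> \<in> space P"
    then have g: "\<gamma> \<in> Config" by (simp add: space_P)
    have "(\<integral>x. L_zero_term b F \<gamma> x \<partial>count_space \<gamma>) = (\<integral>x. K (\<gamma>, x) \<partial>count_space \<gamma>)"
      by (intro Bochner_Integration.integral_cong refl) (simp add: L_zero_term_eq[OF F_cyl g] K_def cong: if_cong)
    then show "c * (\<integral>x. K (\<gamma>, x) \<partial>count_space \<gamma>) = L_zero c b F \<gamma>"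
      by (simp add: L_zero_def infsum_real_eq_integral)
  qed
qed

abbreviation weight_sum :: "real \<Rightarrow> (real^'d) set \<Rightarrow> ennreal" where
  "weight_sum R \<gamma> \<equiv> \<integral>\<^sup>+p. ennreal (near R (fst p) (snd p)) * ennreal (weight \<delta> (fst p - snd p)) \<partial>count_space (offdiag \<gamma>)"

text \<open>This pair sum dominates the generators for all small \<open>\<epsilon>\<close> at once.\<close>

lemma weight_pair_sums:
  "\<exists>U\<in>borel_measurable P. (\<integral>\<^sup>+\<gamma>. (U \<gamma>)\<^sup>2 \<partial>P) < \<infinity> \<and>
    (\<forall>\<gamma>\<in>Config. weight_sum R \<gamma> \<le> U \<gamma>)"
proof (rule near_pair_sums[OF Poisson z_pos _ _ \<delta>_pos, where W = "\<lambda>u. ennreal ((1 + \<delta>) * weight (2 * \<delta>) u)"])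
  have "(\<integral>\<^sup>+u. ennreal ((1 + \<delta>) * weight (2 * \<delta>) u) \<partial>lborel) = ennreal (1 + \<delta>) * (\<integral>\<^sup>+u. ennreal (weight (2 * \<delta>) u) \<partial>lborel)"
    using \<delta>_pos by (subst nn_integral_cmult[symmetric]) (auto simp: ennreal_mult weight_nonneg)
  then show "(\<integral>\<^sup>+u. ennreal ((1 + \<delta>) * weight (2 * \<delta>) u) \<partial>lborel) < \<infinity>"
    using integral_weight_finite[OF _ b_integrable gsup_integrable] \<delta>_pos by (simp add: ennreal_mult_less_top)
qed (use \<delta>_pos in \<open>auto intro!: ennreal_leI weight_shift_le\<close>)

lemma AE_weight_pair_sums_finite:
  "AE \<gamma> in P. \<forall>R. weight_sum R \<gamma> < \<infinity>"
proof -
  have "AE \<gamma> in P. \<forall>n::nat. weight_sum (real n) \<gamma> < \<infinity>"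
    unfolding AE_all_countable
  proof
    fix n :: nat
    obtain U where U: "U \<in> borel_measurable P" "(\<integral>\<^sup>+\<gamma>. (U \<gamma>)\<^sup>2 \<partial>P) < \<infinity>" "\<And>\<gamma>. \<gamma> \<in> Config \<Longrightarrow> weight_sum (real n) \<gamma> \<le> U \<gamma>"
      using weight_pair_sums[of "real n"] by blast
    show "AE \<gamma> in P. weight_sum (real n) \<gamma> < \<infinity>"
      using AE_finite_of_square[OF U(1,2)] AE_space
      by eventually_elim (use U(3) space_P in \<open>auto intro: order.strict_trans1\<close>)
  qed
  then show ?thesis
  proof eventually_elim
    case (elim \<gamma>)
    show ?case
    proof
      fix R :: real
      obtain n :: nat where n: "R \<le> real n" using real_arch_simple by blast
      have "weight_sum R \<gamma> \<le> weight_sum (real n) \<gamma>"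
        by (intro nn_integral_mono mult_right_mono ennreal_leI near_mono[OF n]) auto
      then show "weight_sum R \<gamma> < \<infinity>" using spec[OF elim, of n] by (rule order.strict_trans1)
    qed
  qed
qed

lemma uniform_bounds:
  "\<exists>e>0. \<exists>K\<ge>0. \<exists>R. (\<forall>\<epsilon> v x1 x2. 0 < \<epsilon> \<longrightarrow> \<epsilon> \<le> e \<longrightarrow> \<bar>pair_term \<epsilon> v x1 x2\<bar> \<le> K * near R x1 x2 * weight \<delta> (x1 - x2)) \<and>
     (\<forall>v x y. \<bar>lim_term v x y\<bar> \<le> K * near R x y * weight \<delta> (x - y))"
proof -
  \<comment> \<open>For \<open>\<epsilon> \<le> e\<close> the relative position of the two points is displaced by at most \<open>\<delta>\<close>.\<close>
  define e where "e = \<delta> / (2 * r)"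
  have e: "e > 0" "2 * r * e \<le> \<delta>" using \<delta>_pos r_pos by (auto simp: e_def)
  obtain K1 R1 where K1: "K1 \<ge> 0" and T1: "\<And>\<epsilon> v x1 x2. 0 < \<epsilon> \<Longrightarrow> \<epsilon> \<le> e \<Longrightarrow> \<bar>pair_term \<epsilon> v x1 x2\<bar> \<le> K1 * near R1 x1 x2 * weight \<delta> (x2 - x1)"
    using pair_term_uniform_bound[OF e] by blast
  obtain K2 R2 where K2: "K2 \<ge> 0" and L2: "\<And>v x. \<bar>cyl_lap v x\<bar> \<le> K2 * indicator (cball 0 R2) x \<and>
    norm (cyl_grad v x) \<le> K2 * indicator (cball 0 R2) x" using cyl_lap_grad_bound by blast
  let ?K = "max K1 K2" and ?R = "max R1 R2"
  have d0: "weight \<delta> x \<ge> 0" for x using \<delta>_pos by (simp add: weight_nonneg)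
  have "\<bar>pair_term \<epsilon> v x1 x2\<bar> \<le> ?K * near ?R x1 x2 * weight \<delta> (x1 - x2)" if "0 < \<epsilon>" "\<epsilon> \<le> e" for \<epsilon> v x1 x2
  proof -
    have "\<bar>pair_term \<epsilon> v x1 x2\<bar> \<le> K1 * near R1 x1 x2 * weight \<delta> (x1 - x2)"
      using T1[OF that, of v x1 x2] weight_even[of \<delta> "x1 - x2"] \<delta>_pos by simp
    also have "\<dots> \<le> ?K * near ?R x1 x2 * weight \<delta> (x1 - x2)"
      using K1 d0 by (intro mult_right_mono mult_mono near_mono near_nonneg) auto
    finally show ?thesis .
  qed
  moreover have "\<bar>lim_term v x y\<bar> \<le> ?K * near ?R x y * weight \<delta> (x - y)" for v x y
  proof -
    have "\<bar>lim_term v x y\<bar> \<le> \<bar>cyl_lap v x\<bar> * b (x - y) + norm (cyl_grad v x) * norm (grad b (x - y))"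
      unfolding lim_term_def
      by (rule order_trans[OF abs_triangle_ineq add_mono])
        (auto simp: abs_mult b_nonneg Cauchy_Schwarz_ineq2)
    also have "\<dots> \<le> (K2 * indicator (cball 0 R2) x) * b (x - y) + (K2 * indicator (cball 0 R2) x) * gsup \<delta> (x - y)"
      using L2[of v x] b_nonneg K2 \<delta>_pos gsup_upper[of "x - y" "x - y" \<delta>]
      by (intro add_mono mult_mono mult_right_mono) auto
    also have "\<dots> = K2 * indicator (cball 0 R2) x * weight \<delta> (x - y)" by (simp add: weight_def distrib_left)
    also have "\<dots> \<le> K2 * near R2 x y * weight \<delta> (x - y)"
      using K2 d0 by (intro mult_right_mono mult_left_mono) (auto simp: near_def)
    also have "\<dots> \<le> ?K * near ?R x y * weight \<delta> (x - y)"
      using K2 d0 by (intro mult_right_mono mult_mono near_mono near_nonneg) auto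
    finally show ?thesis .
  qed
  ultimately show ?thesis using e(1) K1 by (intro exI[of _ e] exI[of _ ?K] exI[of _ ?R] conjI) auto
qed

text \<open>For a fixed \<open>\<epsilon>\<close>, not necessarily small, the pair contribution is dominated by the average of
  the potential over the jumps.\<close>

lemma pair_term_sums:
  assumes \<epsilon>: "\<epsilon> > 0"
  shows "\<exists>U\<in>borel_measurable P. (\<integral>\<^sup>+\<gamma>. (U \<gamma>)\<^sup>2 \<partial>P) < \<infinity> \<and>
    (\<forall>\<gamma>\<in>Config. (\<integral>\<^sup>+p. ennreal \<bar>pair_term \<epsilon> (pairings \<gamma>) (fst p) (snd p)\<bar> \<partial>count_space (offdiag \<gamma>)) \<le> U \<gamma>)"
proof -
  obtain K R where K: "K \<ge> 0" and TK: "\<And>v x1 x2. ennreal \<bar>pair_term \<epsilon> v x1 x2\<bar> \<le> ennreal (near R x1 x2) *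
    (\<integral>\<^sup>+h. ennreal (K * (b (x2 - x1) + b (x2 - x1 + \<epsilon> *\<^sub>R (snd h - fst h)))) \<partial>\<nu>)"
    using pair_term_bound[OF \<epsilon>] by blast
  let ?D = "\<lambda>x. \<integral>\<^sup>+h. ennreal (K * (b (- x) + b (- x + \<epsilon> *\<^sub>R (snd h - fst h)))) \<partial>\<nu>"
  let ?W = "\<lambda>u. \<integral>\<^sup>+h. ennreal (K * (1 + \<delta>)) * (ennreal (weight (2 * \<delta>) (- u)) + ennreal (weight (2 * \<delta>) (\<epsilon> *\<^sub>R (snd h - fst h) - u))) \<partial>\<nu>"
  have d0: "weight \<delta> x \<ge> 0" "weight (2 * \<delta>) x \<ge> 0" for x using \<delta>_pos by (auto simp: weight_nonneg)
  have bd: "b x \<le> (1 + \<delta>) * weight (2 * \<delta>) u" if "norm (x - u) \<le> \<delta>" for x u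
    using weight_shift_le[OF _ that] \<delta>_pos gsup_nonneg[of \<delta> x] by (simp add: weight_def)
  have DW: "?D x \<le> ?W u" if xu: "norm (x - u) \<le> \<delta>" for x u
  proof (rule nn_integral_mono)
    fix h :: "(real^'d) \<times> (real^'d)"
    have n: "norm (- x - (- u)) \<le> \<delta>" "norm ((- x + \<epsilon> *\<^sub>R (snd h - fst h)) - (\<epsilon> *\<^sub>R (snd h - fst h) - u)) \<le> \<delta>"
      using xu by (simp_all add: norm_minus_commute algebra_simps)
    have "K * (b (- x) + b (- x + \<epsilon> *\<^sub>R (snd h - fst h)))
       \<le> K * ((1 + \<delta>) * weight (2 * \<delta>) (- u) + (1 + \<delta>) * weight (2 * \<delta>) (\<epsilon> *\<^sub>R (snd h - fst h) - u))"
      using K bd[OF n(1)] bd[OF n(2)] by (intro mult_left_mono add_mono)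
    also have "\<dots> = (K * (1 + \<delta>)) * (weight (2 * \<delta>) (- u) + weight (2 * \<delta>) (\<epsilon> *\<^sub>R (snd h - fst h) - u))"
      by (simp add: algebra_simps)
    finally show "ennreal (K * (b (- x) + b (- x + \<epsilon> *\<^sub>R (snd h - fst h))))
       \<le> ennreal (K * (1 + \<delta>)) * (ennreal (weight (2 * \<delta>) (- u)) + ennreal (weight (2 * \<delta>) (\<epsilon> *\<^sub>R (snd h - fst h) - u)))"
      using K \<delta>_pos d0 by (simp add: ennreal_mult[symmetric] ennreal_plus[symmetric] ennreal_leI del: ennreal_plus)
  qed
  have Wm: "?W \<in> borel_measurable borel" by measurable
  let ?I = "\<integral>\<^sup>+u. ennreal (weight (2 * \<delta>) u) \<partial>lborel"
  have I: "?I < \<infinity>" using integral_weight_finite[OF _ b_integrable gsup_integrable] \<delta>_pos by simp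
  interpret pair_sigma_finite \<nu> lborel ..
  have "(\<integral>\<^sup>+u. ?W u \<partial>lborel) = (\<integral>\<^sup>+h. \<integral>\<^sup>+u. ennreal (K * (1 + \<delta>)) * (ennreal (weight (2 * \<delta>) (- u))
      + ennreal (weight (2 * \<delta>) (\<epsilon> *\<^sub>R (snd h - fst h) - u))) \<partial>lborel \<partial>\<nu>)"
    by (rule Fubini') measurable
  also have "\<dots> = (\<integral>\<^sup>+h. ennreal (K * (1 + \<delta>)) * (?I + ?I) \<partial>\<nu>)"
  proof (intro nn_integral_cong)
    fix h :: "(real^'d) \<times> (real^'d)"
    have "(\<integral>\<^sup>+u. ennreal (weight (2 * \<delta>) (0 - u)) \<partial>lborel) = ?I"
      "(\<integral>\<^sup>+u. ennreal (weight (2 * \<delta>) (\<epsilon> *\<^sub>R (snd h - fst h) - u)) \<partial>lborel) = ?I"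
      by (rule nn_integral_lborel_reflect[of "\<lambda>u. ennreal (weight (2 * \<delta>) u)"], measurable)+
    then show "(\<integral>\<^sup>+u. ennreal (K * (1 + \<delta>)) * (ennreal (weight (2 * \<delta>) (- u))
      + ennreal (weight (2 * \<delta>) (\<epsilon> *\<^sub>R (snd h - fst h) - u))) \<partial>lborel) = ennreal (K * (1 + \<delta>)) * (?I + ?I)"
      by (simp add: nn_integral_cmult nn_integral_add)
  qed
  also have "\<dots> < \<infinity>"
  proof -
    have "emeasure \<nu> UNIV < \<infinity>" by (metis \<nu>.emeasure_finite infinity_ennreal_def top.not_eq_extremum)
    then show ?thesis using I by (simp add: ennreal_mult_less_top)
  qed
  finally have Wi: "(\<integral>\<^sup>+u. ?W u \<partial>lborel) < \<infinity>" .
  obtain U where U: "U \<in> borel_measurable P" "(\<integral>\<^sup>+\<gamma>. (U \<gamma>)\<^sup>2 \<partial>P) < \<infinity>"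
    "\<And>\<gamma>. \<gamma> \<in> Config \<Longrightarrow> (\<integral>\<^sup>+p. ennreal (near R (fst p) (snd p)) * ?D (fst p - snd p) \<partial>count_space (offdiag \<gamma>)) \<le> U \<gamma>"
    using near_pair_sums[where R = R and D = ?D, OF Poisson z_pos Wm Wi \<delta>_pos DW] by blast
  have "(\<integral>\<^sup>+p. ennreal \<bar>pair_term \<epsilon> (pairings \<gamma>) (fst p) (snd p)\<bar> \<partial>count_space (offdiag \<gamma>)) \<le> U \<gamma>" if "\<gamma> \<in> Config" for \<gamma>
  proof (rule order_trans[OF nn_integral_mono U(3)[OF that]])
    fix p show "ennreal \<bar>pair_term \<epsilon> (pairings \<gamma>) (fst p) (snd p)\<bar> \<le> ennreal (near R (fst p) (snd p)) * ?D (fst p - snd p)"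
      using TK[of "pairings \<gamma>" "fst p" "snd p"] by simp
  qed
  then show ?thesis using U(1,2) by blast
qed

theorem L_eps_L2:
  assumes \<epsilon>: "\<epsilon> > 0"
  shows "AE \<gamma> in P. L_eps_converges a b \<epsilon> F \<gamma>" and "L_eps a b \<epsilon> F \<in> L2_space P"
proof -
  obtain U where U: "U \<in> borel_measurable P" "(\<integral>\<^sup>+\<gamma>. (U \<gamma>)\<^sup>2 \<partial>P) < \<infinity>"
    "\<And>\<gamma>. \<gamma> \<in> Config \<Longrightarrow> (\<integral>\<^sup>+p. ennreal \<bar>pair_term \<epsilon> (pairings \<gamma>) (fst p) (snd p)\<bar> \<partial>count_space (offdiag \<gamma>)) \<le> U \<gamma>"
    using pair_term_sums[OF \<epsilon>] by blast
  show "AE \<gamma> in P. L_eps_converges a b \<epsilon> F \<gamma>"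
    using AE_finite_of_square[OF U(1,2)] AE_space
  proof eventually_elim
    case (elim \<gamma>)
    then have g: "\<gamma> \<in> Config" by (simp add: space_P)
    have "integrable (count_space (offdiag \<gamma>)) (\<lambda>p. pair_term \<epsilon> (pairings \<gamma>) (fst p) (snd p))"
      using U(3)[OF g] elim(1) by (auto simp: integrable_iff_bounded intro: order.strict_trans1)
    then show ?case by (intro L_eps_eq(2)[OF _ g \<epsilon>] F_cyl)
  qed
  show "L_eps a b \<epsilon> F \<in> L2_space P"
  proof (rule L2_space_dominated[OF L_eps_measurable[OF \<epsilon>] U(1,2), where C = 1], rule AE_I2)
    fix \<gamma> assume "\<gamma> \<in> space P"
    then have g: "\<gamma> \<in> Config" by (simp add: space_P)
    let ?J = "\<integral>p. pair_term \<epsilon> (pairings \<gamma>) (fst p) (snd p) \<partial>count_space (offdiag \<gamma>)"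
    have "ennreal \<bar>L_eps a b \<epsilon> F \<gamma>\<bar> \<le> ennreal \<bar>?J\<bar>"
      by (intro ennreal_leI) (simp add: L_eps_eq(1)[OF F_cyl g \<epsilon>])
    also have "\<dots> \<le> U \<gamma>" by (rule order_trans[OF ennreal_abs_integral_le U(3)[OF g]])
    finally show "ennreal \<bar>L_eps a b \<epsilon> F \<gamma>\<bar> \<le> ennreal 1 * U \<gamma>" by simp
  qed
qed

lemma L_zero_formula:
  assumes g: "\<gamma> \<in> Config"
    and fin: "\<forall>R. weight_sum R \<gamma> < \<infinity>"
  shows "L_zero_converges b F \<gamma>"
    and "L_zero c b F \<gamma> = c * (\<integral>p. lim_term (pairings \<gamma>) (fst p) (snd p) \<partial>count_space (offdiag \<gamma>))"
    and "integrable (count_space (offdiag \<gamma>)) (\<lambda>p. lim_term (pairings \<gamma>) (fst p) (snd p))"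
proof -
  have *: "(\<integral>\<^sup>+p. ennreal (indicator (cball 0 R) (fst p) * (b (fst p - snd p) + norm (grad b (fst p - snd p))))
        \<partial>count_space (offdiag \<gamma>)) < \<infinity>" for R
  proof (rule order.strict_trans1[OF nn_integral_mono spec[OF fin, of R]])
    fix p :: "(real^'d) \<times> (real^'d)"
    have "indicator (cball 0 R) (fst p) * (b (fst p - snd p) + norm (grad b (fst p - snd p)))
        \<le> near R (fst p) (snd p) * weight \<delta> (fst p - snd p)"
      unfolding weight_def using \<delta>_pos gsup_upper[of "fst p - snd p" "fst p - snd p" \<delta>] b_nonneg
      by (intro mult_mono add_mono) (auto simp: near_def intro: add_nonneg_nonneg)
    then show "ennreal (indicator (cball 0 R) (fst p) * (b (fst p - snd p) + norm (grad b (fst p - snd p))))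
       \<le> ennreal (near R (fst p) (snd p)) * ennreal (weight \<delta> (fst p - snd p))"
      using \<delta>_pos by (simp add: ennreal_mult[symmetric] near_nonneg weight_nonneg ennreal_leI)
  qed
  show "L_zero_converges b F \<gamma>"
    by (rule L_zero_eq(1)[OF _ g *]) (rule F_cyl)
  show "L_zero c b F \<gamma> = c * (\<integral>p. lim_term (pairings \<gamma>) (fst p) (snd p) \<partial>count_space (offdiag \<gamma>))"
    by (rule L_zero_eq(2)[OF _ g *]) (rule F_cyl)
  show "integrable (count_space (offdiag \<gamma>)) (\<lambda>p. lim_term (pairings \<gamma>) (fst p) (snd p))"
    by (rule L_zero_eq(3)[OF _ g *]) (rule F_cyl)
qed

text \<open>Dominated convergence is used twice: for almost every configuration, to pass to the limit in the
  sum over its pairs, and then under the Poisson measure, where the square of that dominating pair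
  sum is an integrable majorant.\<close>

theorem L_eps_tendsto_L_zero:
  assumes c: "c = m0 * m2 k"
  shows "AE \<gamma> in P. L_zero_converges b F \<gamma>" and "L_zero c b F \<in> L2_space P"
    and "((\<lambda>\<epsilon>. L2_norm P (\<lambda>\<gamma>. L_eps a b \<epsilon> F \<gamma> - L_zero c b F \<gamma>)) \<longlongrightarrow> 0) (at_right 0)"
proof -
  obtain e K R where e: "e > 0" and K: "K \<ge> 0"
    and TK: "\<And>\<epsilon> v x1 x2. 0 < \<epsilon> \<Longrightarrow> \<epsilon> \<le> e \<Longrightarrow> \<bar>pair_term \<epsilon> v x1 x2\<bar> \<le> K * near R x1 x2 * weight \<delta> (x1 - x2)"
    and LK: "\<And>v x y. \<bar>lim_term v x y\<bar> \<le> K * near R x y * weight \<delta> (x - y)"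
    using uniform_bounds by blast
  obtain U where U[measurable]: "U \<in> borel_measurable P" and U2: "(\<integral>\<^sup>+\<gamma>. (U \<gamma>)\<^sup>2 \<partial>P) < \<infinity>"
    and US: "\<And>\<gamma>. \<gamma> \<in> Config \<Longrightarrow> weight_sum R \<gamma> \<le> U \<gamma>" using weight_pair_sums[of R] by blast
  have sumK: "(\<integral>\<^sup>+p. ennreal (K * near R (fst p) (snd p) * weight \<delta> (fst p - snd p)) \<partial>count_space (offdiag \<gamma>)) \<le> ennreal K * U \<gamma>"
    if "\<gamma> \<in> Config" for \<gamma>
  proof -
    have "(\<integral>\<^sup>+p. ennreal (K * near R (fst p) (snd p) * weight \<delta> (fst p - snd p)) \<partial>count_space (offdiag \<gamma>)) = ennreal K * weight_sum R \<gamma>"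
      using K \<delta>_pos by (subst nn_integral_cmult[symmetric]) (auto simp: ennreal_mult near_nonneg weight_nonneg mult.assoc)
    then show ?thesis using US[OF that] by (simp add: mult_left_mono)
  qed
  show "AE \<gamma> in P. L_zero_converges b F \<gamma>"
    using AE_weight_pair_sums_finite AE_space by eventually_elim (auto simp: space_P intro: L_zero_formula(1))
  have Tb: "ennreal \<bar>L_eps a b \<epsilon> F \<gamma>\<bar> \<le> ennreal K * U \<gamma>" if g: "\<gamma> \<in> Config" and \<epsilon>: "0 < \<epsilon>" "\<epsilon> \<le> e" for \<epsilon> \<gamma>
  proof -
    have "ennreal \<bar>L_eps a b \<epsilon> F \<gamma>\<bar> \<le> ennreal \<bar>\<integral>p. pair_term \<epsilon> (pairings \<gamma>) (fst p) (snd p) \<partial>count_space (offdiag \<gamma>)\<bar>"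
      by (intro ennreal_leI) (simp add: L_eps_eq(1)[OF F_cyl g \<epsilon>(1)])
    also have "\<dots> \<le> (\<integral>\<^sup>+p. ennreal \<bar>pair_term \<epsilon> (pairings \<gamma>) (fst p) (snd p)\<bar> \<partial>count_space (offdiag \<gamma>))" by (rule ennreal_abs_integral_le)
    also have "\<dots> \<le> (\<integral>\<^sup>+p. ennreal (K * near R (fst p) (snd p) * weight \<delta> (fst p - snd p)) \<partial>count_space (offdiag \<gamma>))"
      by (intro nn_integral_mono ennreal_leI TK \<epsilon>)
    also have "\<dots> \<le> ennreal K * U \<gamma>" by (rule sumK[OF g])
    finally show ?thesis .
  qed
  have Lb: "AE \<gamma> in P. ennreal \<bar>L_zero c b F \<gamma>\<bar> \<le> ennreal (\<bar>c\<bar> * K) * U \<gamma>"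
    using AE_weight_pair_sums_finite AE_space
  proof eventually_elim
    case (elim \<gamma>)
    then have g: "\<gamma> \<in> Config" by (simp add: space_P)
    have "ennreal \<bar>L_zero c b F \<gamma>\<bar> = ennreal \<bar>c\<bar> * ennreal \<bar>\<integral>p. lim_term (pairings \<gamma>) (fst p) (snd p) \<partial>count_space (offdiag \<gamma>)\<bar>"
      by (simp add: L_zero_formula(2)[OF g elim(1)] abs_mult ennreal_mult)
    also have "\<dots> \<le> ennreal \<bar>c\<bar> * (\<integral>\<^sup>+p. ennreal \<bar>lim_term (pairings \<gamma>) (fst p) (snd p)\<bar> \<partial>count_space (offdiag \<gamma>))"
      by (intro mult_left_mono ennreal_abs_integral_le) auto
    also have "\<dots> \<le> ennreal \<bar>c\<bar> * (\<integral>\<^sup>+p. ennreal (K * near R (fst p) (snd p) * weight \<delta> (fst p - snd p)) \<partial>count_space (offdiag \<gamma>))"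
      by (intro mult_left_mono nn_integral_mono ennreal_leI LK) auto
    also have "\<dots> \<le> ennreal \<bar>c\<bar> * (ennreal K * U \<gamma>)" by (intro mult_left_mono sumK[OF g]) auto
    finally show ?case using K by (simp add: ennreal_mult mult.assoc)
  qed
  show "L_zero c b F \<in> L2_space P"
    by (rule L2_space_dominated[OF L_zero_measurable U U2 Lb])
  have lim: "AE \<gamma> in P. ((\<lambda>\<epsilon>. L_eps a b \<epsilon> F \<gamma>) \<longlongrightarrow> L_zero c b F \<gamma>) (at_right 0)"
    using AE_weight_pair_sums_finite AE_space
  proof eventually_elim
    case (elim \<gamma>)
    then have g: "\<gamma> \<in> Config" by (simp add: space_P)
    note L0 = L_zero_formula[OF g elim(1)]
    let ?l = "\<lambda>p. lim_term (pairings \<gamma>) (fst p) (snd p)"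
    let ?C = "count_space (offdiag \<gamma>)"
    have w: "integrable ?C (\<lambda>p. K * near R (fst p) (snd p) * weight \<delta> (fst p - snd p))"
    proof -
      have "ennreal K * weight_sum R \<gamma> < \<infinity>" using elim(1) by (auto simp: ennreal_mult_less_top)
      also have "ennreal K * weight_sum R \<gamma> = (\<integral>\<^sup>+p. ennreal (norm (K * near R (fst p) (snd p) * weight \<delta> (fst p - snd p))) \<partial>?C)"
        using K \<delta>_pos by (subst nn_integral_cmult[symmetric]) (auto simp: ennreal_mult abs_mult near_nonneg weight_nonneg mult.assoc)
      finally show ?thesis by (simp add: integrable_iff_bounded)
    qed
    have "((\<lambda>\<epsilon>. \<integral>p. pair_term \<epsilon> (pairings \<gamma>) (fst p) (snd p) \<partial>?C) \<longlongrightarrow> (\<integral>p. c * (?l p + ?l (snd p, fst p)) \<partial>?C)) (at_right 0)"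
      by (rule dominated_convergence_at_right[OF _ _ w e])
        (use pair_term_limit[of "pairings \<gamma>" _ _ k] TK in \<open>auto simp: c intro!: AE_I2\<close>)
    moreover have "(\<integral>p. c * (?l p + ?l (snd p, fst p)) \<partial>?C) = 2 * L_zero c b F \<gamma>"
    proof -
      have "(\<integral>p. c * (?l p + ?l (snd p, fst p)) \<partial>?C) = c * ((\<integral>p. ?l p \<partial>?C) + (\<integral>p. ?l (snd p, fst p) \<partial>?C))"
        by (simp only: integral_mult_right_zero Bochner_Integration.integral_add[OF L0(3) integrable_offdiag_swap[OF L0(3)]])
      also have "(\<integral>p. ?l (snd p, fst p) \<partial>?C) = (\<integral>p. ?l p \<partial>?C)" by (rule integral_offdiag_swap)
      finally show ?thesis by (simp add: L0(2))
    qed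
    ultimately have "((\<lambda>\<epsilon>. (\<integral>p. pair_term \<epsilon> (pairings \<gamma>) (fst p) (snd p) \<partial>?C) / 2) \<longlongrightarrow> 2 * L_zero c b F \<gamma> / 2) (at_right 0)"
      by (intro tendsto_divide) auto
    then have "((\<lambda>\<epsilon>. (\<integral>p. pair_term \<epsilon> (pairings \<gamma>) (fst p) (snd p) \<partial>?C) / 2) \<longlongrightarrow> L_zero c b F \<gamma>) (at_right 0)" by simp
    then show ?case
      by (rule Lim_transform_eventually)
        (use eventually_at_right_less[of "0::real"] in \<open>eventually_elim, simp add: L_eps_eq(1)[OF F_cyl g]\<close>)
  qed
  define w where "w = (\<lambda>\<gamma>. ((1 + \<bar>c\<bar>) * K * enn2real (U \<gamma>))\<^sup>2)"
  have w: "integrable P w"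
  proof -
    have "(\<integral>\<^sup>+\<gamma>. ennreal (norm (w \<gamma>)) \<partial>P) \<le> (\<integral>\<^sup>+\<gamma>. (ennreal ((1 + \<bar>c\<bar>) * K))\<^sup>2 * (U \<gamma>)\<^sup>2 \<partial>P)"
    proof (rule nn_integral_mono)
      fix \<gamma>
      have "ennreal (enn2real (U \<gamma>)) \<le> U \<gamma>" by (cases "U \<gamma>") auto
      then have "(ennreal ((1 + \<bar>c\<bar>) * K) * ennreal (enn2real (U \<gamma>)))\<^sup>2 \<le> (ennreal ((1 + \<bar>c\<bar>) * K) * U \<gamma>)\<^sup>2"
        by (intro power_mono mult_left_mono) auto
      then show "ennreal (norm (w \<gamma>)) \<le> (ennreal ((1 + \<bar>c\<bar>) * K))\<^sup>2 * (U \<gamma>)\<^sup>2"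
        using K by (simp add: w_def ennreal_power ennreal_mult[symmetric] power_mult_distrib)
    qed
    also have "\<dots> = (ennreal ((1 + \<bar>c\<bar>) * K))\<^sup>2 * (\<integral>\<^sup>+\<gamma>. (U \<gamma>)\<^sup>2 \<partial>P)" by (intro nn_integral_cmult) measurable
    also have "\<dots> < \<infinity>" using U2 by (simp add: ennreal_mult_less_top power2_eq_square)
    finally show ?thesis by (simp add: integrable_iff_bounded w_def)
  qed
  note [measurable] = L_zero_measurable
  have "((\<lambda>\<epsilon>. \<integral>\<gamma>. (L_eps a b \<epsilon> F \<gamma> - L_zero c b F \<gamma>)\<^sup>2 \<partial>P) \<longlongrightarrow> (\<integral>\<gamma>. 0 \<partial>P)) (at_right 0)"
  proof (rule dominated_convergence_at_right[OF _ _ w e])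
    fix \<epsilon> :: real assume \<epsilon>: "\<epsilon> > 0"
    note [measurable] = L_eps_measurable[OF \<epsilon>]
    show "(\<lambda>\<gamma>. (L_eps a b \<epsilon> F \<gamma> - L_zero c b F \<gamma>)\<^sup>2) \<in> borel_measurable P" by measurable
  next
    show "AE \<gamma> in P. ((\<lambda>\<epsilon>. (L_eps a b \<epsilon> F \<gamma> - L_zero c b F \<gamma>)\<^sup>2) \<longlongrightarrow> 0) (at_right 0)"
      using lim
    proof eventually_elim
      case (elim \<gamma>)
      have "((\<lambda>\<epsilon>. (L_eps a b \<epsilon> F \<gamma> - L_zero c b F \<gamma>)\<^sup>2) \<longlongrightarrow> (L_zero c b F \<gamma> - L_zero c b F \<gamma>)\<^sup>2) (at_right 0)"
        by (intro tendsto_intros elim)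
      then show ?case by simp
    qed
  next
    fix \<epsilon> :: real assume \<epsilon>: "0 < \<epsilon>" "\<epsilon> \<le> e"
    show "AE \<gamma> in P. \<bar>(L_eps a b \<epsilon> F \<gamma> - L_zero c b F \<gamma>)\<^sup>2\<bar> \<le> w \<gamma>"
      using Lb AE_finite_of_square[OF U U2] AE_space
    proof eventually_elim
      case (elim \<gamma>)
      then have g: "\<gamma> \<in> Config" by (simp add: space_P)
      obtain u where u: "U \<gamma> = ennreal u" "u \<ge> 0" using elim(2) by (cases "U \<gamma>") auto
      have "\<bar>L_eps a b \<epsilon> F \<gamma>\<bar> \<le> K * u"
        using Tb[OF g \<epsilon>] K u by (simp add: ennreal_mult[symmetric])
      moreover have "\<bar>L_zero c b F \<gamma>\<bar> \<le> \<bar>c\<bar> * K * u"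
        using elim(1) K u by (simp add: ennreal_mult[symmetric])
      ultimately have "\<bar>L_eps a b \<epsilon> F \<gamma> - L_zero c b F \<gamma>\<bar> \<le> (1 + \<bar>c\<bar>) * K * u"
        using abs_triangle_ineq4[of "L_eps a b \<epsilon> F \<gamma>" "L_zero c b F \<gamma>"] by (simp add: algebra_simps)
      then have "\<bar>L_eps a b \<epsilon> F \<gamma> - L_zero c b F \<gamma>\<bar>\<^sup>2 \<le> ((1 + \<bar>c\<bar>) * K * u)\<^sup>2"
        by (rule power_mono) auto
      then show ?case using u by (simp add: w_def)
    qed
  qed simp
  then show "((\<lambda>\<epsilon>. L2_norm P (\<lambda>\<gamma>. L_eps a b \<epsilon> F \<gamma> - L_zero c b F \<gamma>)) \<longlongrightarrow> 0) (at_right 0)"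
    unfolding L2_norm_def using tendsto_real_sqrt by fastforce
qed

end

theorem theorem3:
  fixes z c :: real
    and a :: "real^'d::finite \<Rightarrow> ennreal" and a' :: "real \<Rightarrow> ennreal"
    and b :: "real^'d \<Rightarrow> real"
    and k :: 'd
    and P :: "(real^'d) set measure"
    and F :: "(real^'d) set \<Rightarrow> real"
  assumes z: "z > 0"
    and b_nonneg: "\<And>x. b x \<ge> 0"
    and a_radial: "a' \<in> borel_measurable (restrict_space borel {0..})" "\<And>x. a x = a' (norm x)"
    and b_even: "\<And>x. b (- x) = b x"
    and a_L1: "a \<in> borel_measurable borel" "(\<integral>\<^sup>+x. a x \<partial>lborel) < \<infinity>"
    and b_L1: "integrable lborel b"
    and a_supp: "compact_support a"
    and b_Cb1: "b \<in> Cb1"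
    and grad_b: "\<exists>R>0. (\<integral>\<^sup>+x. (SUP y\<in>cball x R. ennreal (norm (grad b y))) \<partial>lborel) < \<infinity>"
    and c: "c = (\<integral>h. enn2real (a h) \<partial>lborel) * (\<integral>h. enn2real (a h) * (h $ k)\<^sup>2 \<partial>lborel)"
    and P: "is_Poisson_measure z P"
    and F: "F \<in> FCb_infinity TYPE('n::finite)"
  shows "(\<forall>\<epsilon>>0. (AE \<gamma> in P. L_eps_converges a b \<epsilon> F \<gamma>) \<and> L_eps a b \<epsilon> F \<in> L2_space P) \<and>
         (AE \<gamma> in P. L_zero_converges b F \<gamma>) \<and> L_zero c b F \<in> L2_space P \<and>
         ((\<lambda>\<epsilon>. L2_norm P (\<lambda>\<gamma>. L_eps a b \<epsilon> F \<gamma> - L_zero c b F \<gamma>)) \<longlongrightarrow> 0) (at_right 0)"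
proof -
  have "bounded (closure {x. a x \<noteq> 0})"
    using a_supp unfolding compact_support_def by (rule compact_imp_bounded)
  then obtain r where r: "r > 0" "\<And>x. x \<in> closure {x. a x \<noteq> 0} \<Longrightarrow> norm x \<le> r"
    unfolding bounded_pos by blast
  obtain \<phi> :: "'n \<Rightarrow> real^'d \<Rightarrow> real" and g :: "real^'n \<Rightarrow> real" where
    \<phi>: "\<And>i. \<phi> i \<in> C0_infinity" and g: "g \<in> Cb_infinity"
    and Fg: "\<And>\<gamma>. \<gamma> \<in> Config \<Longrightarrow> F \<gamma> = g (\<chi> i. pairing (\<phi> i) \<gamma>)"
    using F unfolding FCb_infinity_def by blast
  obtain R where R: "R > 0" "(\<integral>\<^sup>+x. (SUP y\<in>cball x R. ennreal (norm (grad b y))) \<partial>lborel) < \<infinity>"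
    using grad_b by blast
  interpret scaled_dynamics a r \<phi> g b
  proof
    show "a x = 0" if "norm x > r" for x
      using r(2)[of x] that closure_subset[of "{x. a x \<noteq> 0}"] by fastforce
    show "a x = a y" if "norm x = norm y" for x y using that by (simp add: a_radial)
  qed (use a_L1 r \<phi> g b_nonneg b_even b_Cb1 in \<open>auto simp: Cb1_def\<close>)
  interpret poisson_dynamics a r \<phi> g b z P F "R / 2"
  proof
    show "F \<gamma> = g (pairings \<gamma>)" if "\<gamma> \<in> Config" for \<gamma> using Fg[OF that] by (simp add: pairings_def)
    show "(\<integral>\<^sup>+x. ennreal (gsup (2 * (R / 2)) x) \<partial>lborel) < \<infinity>" using integral_gsup_finite[OF R] by simp
  qed (use P z b_L1 R in auto)
  have c': "c = m0 * m2 k" by (simp add: c m0_def m2_def \<alpha>_def)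
  show ?thesis using L_eps_L2 L_eps_tendsto_L_zero[OF c'] by blast
qed

end
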